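(* Let $(G,V)$ be a saturated representation with representation diagram $\mathcal{G}$. If $(G,V)$ is skew multiplicity-free, then for every connected subgraph $\mathcal{G}'$ of $\mathcal{G}$ the representation $(G',V')$ belonging to $\mathcal{G}'$ is skew multiplicity-free.
   Context: All groups are complex algebraic groups and representations are finite dimensional over $\mathbb{C}$. $(G,V)$ is skew multiplicity-free (SMF) if $\bigwedge V$ is a multiplicity-free $G$-module. A representation of $G$ on $V=V_1\oplus\dots\oplus V_l$ ($V_i$ irreducible) is saturated if $G=(\mathbb{C}^* )^l\times G_1\times\dots\times G_k=(\mathbb{C}^* )^l\times[G,G]$ with $G_j$ simple groups, where the $i$-th torus factor acts by scalar multiplication on $V_i$ and trivially on the other summands. As a module for $G_1\times\dots\times G_k$ write $V_i=W_i^1\otimes\dots\otimes W_i^k$ with $W_i^j$ an irreducible $G_j$-module. The representation diagram $\mathcal{G}$ of $(G,V)$ is the bipartite graph with $k$ top vertices labeled $G_1,\dots,G_k$ and $l$ bottom vertices labeled $V_1,\dots,V_l$, where $G_j$ and $V_i$ are joined by an edge if and only if $G_j$ acts nontrivially on $V_i$ (i.e. $W_i^j$ is nontrivial). The representation $(G',V')$ belonging to a connected subgraph $\mathcal{G}'$ is defined as follows. Let $J$ and $I$ be the sets of indices of top and bottom vertices of $\mathcal{G}'$. Then $G'=(\mathbb{C}^* )^{I}\times\prod_{j\in J}G_j$ and $V'=\bigoplus_{i\in I}V_i'$ with $V_i'=\bigotimes_{j}W_i^j$, the tensor product over those $j\in J$ for which the edge $\{G_j,V_i\}$ belongs to $\mathcal{G}'$;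 a factor $G_j$ acts on $V_i'$ through $W_i^j$ if this edge belongs to $\mathcal{G}'$ and trivially otherwise, and the torus factor with index $i\in I$ acts by scalar multiplication on $V_i'$ and trivially on the other summands. (That is, deleting an edge replaces the tensor factor $W_i^j$ of $V_i$ by the trivial one-dimensional module, and vertices not in $\mathcal{G}'$ are omitted.) *)

theory Defs
  imports
    "HOL-Analysis.Abstract_Topology"
    "HOL-Algebra.Algebra"
    "Jordan_Normal_Form.VS_Connect"
    "Graph_Theory.Digraph_Component"
begin

section \<open>Linear algebraic groups and their rational representations\<close>

abbreviation complex_ring :: "complex ring" where
  "complex_ring \<equiv> class_ring"

definition GL :: "nat \<Rightarrow> complex mat monoid" where
  "GL n = units_of (ring_mat TYPE(complex) n ())"

definition Cstar :: "complex monoid" where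
  "Cstar = units_of complex_ring"

lemma carrier_Cstar: "carrier Cstar = - {0}"
proof -
  have "\<exists>y. y * x = 1 \<and> x * y = 1" if "x \<noteq> 0" for x :: complex
    by (rule exI[of _ "inverse x"]) (simp add: that)
  then show ?thesis
    unfolding Cstar_def units_of_def Units_def by auto
qed

lemma carrier_GL: "carrier (GL n) = {A \<in> carrier_mat n n. det A \<noteq> 0}"
proof -
  have "carrier (GL n) = Units (ring_mat TYPE(complex) n ())" by (simp add: GL_def units_of_def)
  also have "\<dots> = {A \<in> carrier_mat n n. det A \<noteq> 0}"
    using unit_imp_det_non_zero det_non_zero_imp_unit
    by (auto simp: ring_mat_simps Units_def) blast+
  finally show ?thesis .
qed

inductive_set poly_funs :: "nat \<Rightarrow> (complex mat \<Rightarrow> complex) set" for n :: nat where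
  const: "(\<lambda>A. c) \<in> poly_funs n"
| entry: "a < n \<Longrightarrow> b < n \<Longrightarrow> (\<lambda>A. A $$ (a, b)) \<in> poly_funs n"
| add: "p \<in> poly_funs n \<Longrightarrow> q \<in> poly_funs n \<Longrightarrow> (\<lambda>A. p A + q A) \<in> poly_funs n"
| mult: "p \<in> poly_funs n \<Longrightarrow> q \<in> poly_funs n \<Longrightarrow> (\<lambda>A. p A * q A) \<in> poly_funs n"

text \<open>The Zariski topology on \<open>GL\<^sub>n(\<complex>)\<close>, generated by the principal open subsets.\<close>

definition zariski :: "nat \<Rightarrow> complex mat topology" where
  "zariski n = topology_generated_by
     ((\<lambda>p. {A \<in> carrier (GL n). p A \<noteq> 0}) ` poly_funs n)"

lemma topspace_zariski: "topspace (zariski n) = carrier (GL n)"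
proof -
  have "(\<lambda>A. 1) \<in> poly_funs n" by (rule poly_funs.const)
  then have "carrier (GL n) \<in> (\<lambda>p. {A \<in> carrier (GL n). p A \<noteq> 0}) ` poly_funs n"
    by (rule image_eqI[rotated]) simp
  then show ?thesis unfolding zariski_def topology_generated_by_topspace by blast
qed

text \<open>Every affine algebraic group is a closed subgroup of some \<open>GL\<^sub>n\<close>; its regular functions are
  the restrictions of polynomials in the matrix entries and \<open>1/det\<close>.\<close>

definition closed_subgroup :: "nat \<Rightarrow> complex mat set \<Rightarrow> bool" where
  "closed_subgroup n G \<longleftrightarrow> subgroup G (GL n) \<and> closedin (zariski n) G"

abbreviation matrix_group :: "nat \<Rightarrow> complex mat set \<Rightarrow> complex mat monoid" where
  "matrix_group n G \<equiv> (GL n)\<lparr>carrier := G\<rparr>"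

definition regular_on :: "nat \<Rightarrow> complex mat set \<Rightarrow> (complex mat \<Rightarrow> complex) \<Rightarrow> bool" where
  "regular_on n G f \<longleftrightarrow>
     (\<exists>p\<in>poly_funs n. \<exists>r::nat. \<forall>A\<in>G. f A = p A / det A ^ r)"

text \<open>Simple in the sense of algebraic groups: a finite centre is allowed.\<close>

definition simple_algebraic_group :: "nat \<Rightarrow> complex mat set \<Rightarrow> bool" where
  "simple_algebraic_group n G \<longleftrightarrow>
     closed_subgroup n G \<and> connectedin (zariski n) G \<and>
     \<not> comm_group (matrix_group n G) \<and>
     (\<forall>N. N \<lhd> matrix_group n G \<and> closedin (zariski n) N \<and> connectedin (zariski n) N
        \<longrightarrow> N = {1\<^sub>m n} \<or> N = G)"

definition rational_rep ::
  "nat \<Rightarrow> complex mat set \<Rightarrow> nat \<Rightarrow> (complex mat \<Rightarrow> complex mat) \<Rightarrow> bool" where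
  "rational_rep n G d \<rho> \<longleftrightarrow>
     \<rho> \<in> hom (matrix_group n G) (GL d) \<and>
     (\<forall>a<d. \<forall>b<d. regular_on n G (\<lambda>A. \<rho> A $$ (a, b)))"


section \<open>Modules over a group\<close>

text \<open>A module of a group \<open>H\<close> is given by a complex vector space \<open>M\<close> and, for every \<open>g\<close> in \<open>H\<close>,
  an operator \<open>act g\<close> on it.\<close>

definition G_submodule ::
  "('g, 'm) monoid_scheme \<Rightarrow> (complex, 'v) module \<Rightarrow> ('g \<Rightarrow> 'v \<Rightarrow> 'v) \<Rightarrow> 'v set \<Rightarrow> bool" where
  "G_submodule H M act U \<longleftrightarrow>
     Module.submodule U complex_ring M \<and> (\<forall>g\<in>carrier H. act g ` U \<subseteq> U)"

definition irreducible_submodule ::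
  "('g, 'm) monoid_scheme \<Rightarrow> (complex, 'v) module \<Rightarrow> ('g \<Rightarrow> 'v \<Rightarrow> 'v) \<Rightarrow> 'v set \<Rightarrow> bool" where
  "irreducible_submodule H M act U \<longleftrightarrow>
     G_submodule H M act U \<and> U \<noteq> {\<zero>\<^bsub>M\<^esub>} \<and>
     (\<forall>U'. G_submodule H M act U' \<and> U' \<subseteq> U \<longrightarrow> U' = {\<zero>\<^bsub>M\<^esub>} \<or> U' = U)"

definition isomorphic_submodules ::
  "('g, 'm) monoid_scheme \<Rightarrow> (complex, 'v) module \<Rightarrow> ('g \<Rightarrow> 'v \<Rightarrow> 'v)
     \<Rightarrow> 'v set \<Rightarrow> 'v set \<Rightarrow> bool" where
  "isomorphic_submodules H M act U U' \<longleftrightarrow>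
     (\<exists>f. bij_betw f U U' \<and>
        (\<forall>u\<in>U. \<forall>v\<in>U. f (u \<oplus>\<^bsub>M\<^esub> v) = f u \<oplus>\<^bsub>M\<^esub> f v) \<and>
        (\<forall>c. \<forall>u\<in>U. f (c \<odot>\<^bsub>M\<^esub> u) = c \<odot>\<^bsub>M\<^esub> f u) \<and>
        (\<forall>g\<in>carrier H. \<forall>u\<in>U. f (act g u) = act g (f u)))"

text \<open>\<open>M\<close> is the direct sum of finitely many pairwise non-isomorphic irreducible submodules.\<close>

definition multiplicity_free ::
  "('g, 'm) monoid_scheme \<Rightarrow> (complex, 'v) module \<Rightarrow> ('g \<Rightarrow> 'v \<Rightarrow> 'v) \<Rightarrow> bool" where
  "multiplicity_free H M act \<longleftrightarrow>
     (\<exists>S. finite S \<and>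
        (\<forall>U\<in>S. irreducible_submodule H M act U) \<and>
        (\<forall>U\<in>S. \<forall>U'\<in>S. isomorphic_submodules H M act U U' \<longrightarrow> U = U') \<and>
        (\<forall>m\<in>carrier M. \<exists>!f. f \<in> (\<Pi>\<^sub>E U\<in>S. U) \<and> m = finsum M f S))"

text \<open>\<open>coord_space B\<close> is the vector space \<open>\<complex>\<^sup>B\<close> with standard basis indexed by \<open>B\<close>. An operator on it
  is given by its matrix \<open>m x y\<close> (row \<open>x\<close>, column \<open>y\<close>).\<close>

definition coord_space :: "'b set \<Rightarrow> (complex, 'b \<Rightarrow> complex) module" where
  "coord_space B =
     \<lparr>carrier = {v. \<forall>x. x \<notin> B \<longrightarrow> v x = 0}, monoid.mult = undefined, monoid.one = undefined,
      ring.zero = (\<lambda>x. 0), ring.add = (\<lambda>v w x. v x + w x), smult = (\<lambda>c v x. c * v x)\<rparr>"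

definition coord_map :: "'b set \<Rightarrow> ('b \<Rightarrow> 'b \<Rightarrow> complex) \<Rightarrow> ('b \<Rightarrow> complex) \<Rightarrow> 'b \<Rightarrow> complex" where
  "coord_map B m v = (\<lambda>x. if x \<in> B then \<Sum>y\<in>B. m x y * v y else 0)"

definition irreducible_rational_rep ::
  "nat \<Rightarrow> complex mat set \<Rightarrow> nat \<Rightarrow> (complex mat \<Rightarrow> complex mat) \<Rightarrow> bool" where
  "irreducible_rational_rep n G d \<rho> \<longleftrightarrow>
     rational_rep n G d \<rho> \<and>
     irreducible_submodule (matrix_group n G) (coord_space {..<d})
       (\<lambda>g. coord_map {..<d} (\<lambda>a b. \<rho> g $$ (a, b))) (carrier (coord_space {..<d}))"


section \<open>The exterior algebra\<close>

text \<open>The tensor algebra of \<open>\<complex>\<^sup>B\<close>: an element is a finite linear combination of words over \<open>B\<close>, the word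
  \<open>[x\<^sub>1, \<dots>, x\<^sub>p]\<close> standing for the tensor product of the corresponding basis vectors.\<close>

definition tensor_algebra :: "'b set \<Rightarrow> (complex, 'b list \<Rightarrow> complex) module" where
  "tensor_algebra B =
     \<lparr>carrier = {t. finite {xs. t xs \<noteq> 0} \<and> (\<forall>xs. t xs \<noteq> 0 \<longrightarrow> set xs \<subseteq> B)},
      monoid.mult = (\<lambda>s t xs. \<Sum>p\<le>length xs. s (take p xs) * t (drop p xs)),
      monoid.one = (\<lambda>xs. if xs = [] then 1 else 0),
      ring.zero = (\<lambda>xs. 0), ring.add = (\<lambda>s t xs. s xs + t xs), smult = (\<lambda>c t xs. c * t xs)\<rparr>"

definition degree_one :: "('b \<Rightarrow> complex) \<Rightarrow> 'b list \<Rightarrow> complex" where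
  "degree_one v xs = (case xs of [x] \<Rightarrow> v x | _ \<Rightarrow> 0)"

definition exterior_ideal :: "'b set \<Rightarrow> ('b list \<Rightarrow> complex) set" where
  "exterior_ideal B = Idl\<^bsub>tensor_algebra B\<^esub>
     ((\<lambda>v. degree_one v \<otimes>\<^bsub>tensor_algebra B\<^esub> degree_one v) ` carrier (coord_space B))"

lemma conv_assoc:
  fixes f g h :: "'b list \<Rightarrow> complex"
  shows "(\<Sum>p\<le>length xs. (\<Sum>q\<le>length (take p xs). f (take q (take p xs)) * g (drop q (take p xs))) * h (drop p xs))
    = (\<Sum>p\<le>length xs. f (take p xs) * (\<Sum>q\<le>length (drop p xs). g (take q (drop p xs)) * h (drop q (drop p xs))))"
proof -
  let ?n = "length xs"
  have "(\<Sum>p\<le>?n. (\<Sum>q\<le>length (take p xs). f (take q (take p xs)) * g (drop q (take p xs))) * h (drop p xs))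
     = (\<Sum>p\<le>?n. \<Sum>q\<le>p. f (take q xs) * g (drop q (take p xs)) * h (drop p xs))"
    by (intro sum.cong refl) (auto simp: sum_distrib_right min_def intro!: sum.cong)
  also have "\<dots> = (\<Sum>(p,q)\<in>(SIGMA p:{..?n}. {..p}). f (take q xs) * g (drop q (take p xs)) * h (drop p xs))"
    by (rule sum.Sigma) auto
  also have "\<dots> = (\<Sum>(q,r)\<in>(SIGMA q:{..?n}. {..?n-q}). f (take q xs) * g (take r (drop q xs)) * h (drop (r+q) xs))"
    by (rule sum.reindex_bij_witness[where i="\<lambda>(q,r). (r+q,q)" and j="\<lambda>(p,q). (q,p-q)"])
      (auto simp: drop_take)
  also have "\<dots> = (\<Sum>q\<le>?n. \<Sum>r\<le>?n-q. f (take q xs) * g (take r (drop q xs)) * h (drop (r+q) xs))"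
    by (rule sum.Sigma[symmetric]) auto
  also have "\<dots> = (\<Sum>p\<le>?n. f (take p xs) * (\<Sum>q\<le>length (drop p xs). g (take q (drop p xs)) * h (drop q (drop p xs))))"
    by (intro sum.cong refl) (auto simp: sum_distrib_left mult.assoc)
  finally show ?thesis .
qed

lemma ring_tensor_algebra:
  fixes B :: "'a set"
  shows "ring (tensor_algebra B)"
proof (rule ringI)
  show "abelian_group (tensor_algebra B)"
  proof (rule abelian_groupI)
    fix x y assume x: "x \<in> carrier (tensor_algebra B)" and y: "y \<in> carrier (tensor_algebra B)"
    have "{xs. x xs + y xs \<noteq> 0} \<subseteq> {xs. x xs \<noteq> 0} \<union> {xs. y xs \<noteq> 0}" by auto
    with x y show "x \<oplus>\<^bsub>tensor_algebra B\<^esub> y \<in> carrier (tensor_algebra B)"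
      by (auto simp: tensor_algebra_def intro: finite_subset)
  next
    fix x assume x: "x \<in> carrier (tensor_algebra B)"
    show "\<exists>y\<in>carrier (tensor_algebra B). y \<oplus>\<^bsub>tensor_algebra B\<^esub> x = \<zero>\<^bsub>tensor_algebra B\<^esub>"
      by (rule bexI[of _ "\<lambda>xs. - x xs"]) (use x in \<open>auto simp: tensor_algebra_def\<close>)
  qed (simp_all add: tensor_algebra_def ac_simps)
  show "monoid (tensor_algebra B)"
  proof (rule monoidI)
    fix x y assume x: "x \<in> carrier (tensor_algebra B)" and y: "y \<in> carrier (tensor_algebra B)"
    have ex: "\<exists>p. x (take p xs) \<noteq> 0 \<and> y (drop p xs) \<noteq> 0"
      if "(\<Sum>p\<le>length xs. x (take p xs) * y (drop p xs)) \<noteq> 0" for xs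
      using sum.not_neutral_contains_not_neutral[OF that] by auto
    have 1: "{xs. (\<Sum>p\<le>length xs. x (take p xs) * y (drop p xs)) \<noteq> 0}
       \<subseteq> (\<lambda>(u,v). u @ v) ` ({xs. x xs \<noteq> 0} \<times> {xs. y xs \<noteq> 0})"
    proof
      fix xs assume "xs \<in> {xs. (\<Sum>p\<le>length xs. x (take p xs) * y (drop p xs)) \<noteq> 0}"
      then obtain p where "x (take p xs) \<noteq> 0" "y (drop p xs) \<noteq> 0" using ex by auto
      then show "xs \<in> (\<lambda>(u,v). u @ v) ` ({xs. x xs \<noteq> 0} \<times> {xs. y xs \<noteq> 0})"
        by (intro image_eqI[of _ _ "(take p xs, drop p xs)"]) auto
    qed
    have 2: "set xs \<subseteq> B" if nz: "(\<Sum>p\<le>length xs. x (take p xs) * y (drop p xs)) \<noteq> 0" for xs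
    proof -
      obtain p where "x (take p xs) \<noteq> 0" "y (drop p xs) \<noteq> 0" using ex[OF nz] by auto
      then have "set (take p xs) \<subseteq> B" "set (drop p xs) \<subseteq> B"
        using x y by (auto simp: tensor_algebra_def)
      then show ?thesis by (metis append_take_drop_id le_sup_iff set_append)
    qed
    show "x \<otimes>\<^bsub>tensor_algebra B\<^esub> y \<in> carrier (tensor_algebra B)"
      using finite_subset[OF 1] 2 x y by (simp add: tensor_algebra_def)
  next
    fix x y z
    show "x \<otimes>\<^bsub>tensor_algebra B\<^esub> y \<otimes>\<^bsub>tensor_algebra B\<^esub> z
      = x \<otimes>\<^bsub>tensor_algebra B\<^esub> (y \<otimes>\<^bsub>tensor_algebra B\<^esub> z)"
      by (simp only: tensor_algebra_def monoid.simps fun_eq_iff conv_assoc simp_thms)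
  next
    fix x :: "'a list \<Rightarrow> complex"
    have "(\<Sum>p\<le>length xs. (if take p xs = [] then 1 else 0) * x (drop p xs)) = x xs"
      for xs :: "'a list"
    proof -
      have "(\<Sum>p\<le>length xs. (if take p xs = [] then 1 else 0) * x (drop p xs))
        = (\<Sum>p\<in>{0}. (if take p xs = [] then 1 else 0) * x (drop p xs))"
        by (rule sum.mono_neutral_right) auto
      then show ?thesis by simp
    qed
    then show "\<one>\<^bsub>tensor_algebra B\<^esub> \<otimes>\<^bsub>tensor_algebra B\<^esub> x = x"
      by (simp add: tensor_algebra_def)
    have "(\<Sum>p\<le>length xs. x (take p xs) * (if drop p xs = [] then 1 else 0)) = x xs"
      for xs :: "'a list"
    proof -
      have "(\<Sum>p\<le>length xs. x (take p xs) * (if drop p xs = [] then 1 else 0))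
        = (\<Sum>p\<in>{length xs}. x (take p xs) * (if drop p xs = [] then 1 else 0))"
        by (rule sum.mono_neutral_right) auto
      then show ?thesis by simp
    qed
    then show "x \<otimes>\<^bsub>tensor_algebra B\<^esub> \<one>\<^bsub>tensor_algebra B\<^esub> = x"
      by (simp add: tensor_algebra_def)
  qed (simp_all add: tensor_algebra_def)
  fix x y z :: "'a list \<Rightarrow> complex"
  show "(x \<oplus>\<^bsub>tensor_algebra B\<^esub> y) \<otimes>\<^bsub>tensor_algebra B\<^esub> z
    = x \<otimes>\<^bsub>tensor_algebra B\<^esub> z \<oplus>\<^bsub>tensor_algebra B\<^esub> y \<otimes>\<^bsub>tensor_algebra B\<^esub> z"
    by (simp add: tensor_algebra_def distrib_right sum.distrib)
  show "z \<otimes>\<^bsub>tensor_algebra B\<^esub> (x \<oplus>\<^bsub>tensor_algebra B\<^esub> y)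
    = z \<otimes>\<^bsub>tensor_algebra B\<^esub> x \<oplus>\<^bsub>tensor_algebra B\<^esub> z \<otimes>\<^bsub>tensor_algebra B\<^esub> y"
    by (simp add: tensor_algebra_def distrib_left sum.distrib)
qed

lemma degree_one_closed:
  assumes "finite B" "v \<in> carrier (coord_space B)"
  shows "degree_one v \<in> carrier (tensor_algebra B)"
proof -
  have v: "x \<in> B" if "v x \<noteq> 0" for x
    using assms(2) that unfolding coord_space_def by auto
  have *: "xs \<in> (\<lambda>x. [x]) ` B" if nz: "degree_one v xs \<noteq> 0" for xs
  proof -
    obtain x where "xs = [x]" "v x \<noteq> 0"
      using nz unfolding degree_one_def by (cases xs; cases "tl xs") auto
    then show ?thesis using v by blast
  qed
  then have "finite {xs. degree_one v xs \<noteq> 0}"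
    by (intro finite_subset[OF _ finite_imageI[OF assms(1)]]) blast
  moreover have "set xs \<subseteq> B" if "degree_one v xs \<noteq> 0" for xs
  proof -
    from *[OF that] obtain x where "x \<in> B" "xs = [x]" by blast
    then show ?thesis by simp
  qed
  ultimately show ?thesis by (simp add: tensor_algebra_def)
qed

lemma ideal_exterior_ideal:
  assumes "finite B"
  shows "ideal (exterior_ideal B) (tensor_algebra B)"
proof -
  interpret ring "tensor_algebra B" by (rule ring_tensor_algebra)
  show ?thesis unfolding exterior_ideal_def
    by (rule genideal_ideal) (use degree_one_closed[OF assms] in auto)
qed

text \<open>In the next two definitions the set sum with the ideal turns the image of a coset into a coset;
  multiplication by \<open>0\<close>, for instance, maps a coset to \<open>{0}\<close>.\<close>

definition exterior_algebra :: "'b set \<Rightarrow> (complex, ('b list \<Rightarrow> complex) set) module" where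
  "exterior_algebra B =
     ring.extend (tensor_algebra B Quot exterior_ideal B)
       (module.fields (\<lambda>c C. set_add (tensor_algebra B) (exterior_ideal B)
          ((\<lambda>t. c \<odot>\<^bsub>tensor_algebra B\<^esub> t) ` C)))"

text \<open>The algebra endomorphism of the tensor algebra induced by the operator with matrix \<open>m\<close>, that is
  \<open>v\<^sub>1 \<otimes> \<dots> \<otimes> v\<^sub>p \<mapsto> m v\<^sub>1 \<otimes> \<dots> \<otimes> m v\<^sub>p\<close>.\<close>

definition tensor_map ::
  "'b set \<Rightarrow> ('b \<Rightarrow> 'b \<Rightarrow> complex) \<Rightarrow> ('b list \<Rightarrow> complex) \<Rightarrow> 'b list \<Rightarrow> complex" where
  "tensor_map B m t = (\<lambda>xs. if set xs \<subseteq> B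
     then \<Sum>ys | set ys \<subseteq> B \<and> length ys = length xs. (\<Prod>p<length xs. m (xs ! p) (ys ! p)) * t ys
     else 0)"

lemma tensor_map_mult:
  assumes "finite B" "s \<in> carrier (tensor_algebra B)" "t \<in> carrier (tensor_algebra B)"
  shows "tensor_map B m (s \<otimes>\<^bsub>tensor_algebra B\<^esub> t)
    = tensor_map B m s \<otimes>\<^bsub>tensor_algebra B\<^esub> tensor_map B m t"
proof
  fix xs
  let ?W = "\<lambda>xs. {ys. set ys \<subseteq> B \<and> length ys = length xs}"
  let ?c = "\<lambda>xs ys. \<Prod>p<length xs. m (xs ! p) (ys ! p)"
  have fin: "finite (?W xs)" for xs :: "'a list" using finite_lists_length_eq[OF assms(1)] by simp
  show "tensor_map B m (s \<otimes>\<^bsub>tensor_algebra B\<^esub> t) xs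
    = (tensor_map B m s \<otimes>\<^bsub>tensor_algebra B\<^esub> tensor_map B m t) xs"
  proof (cases "set xs \<subseteq> B")
    case False
    have "\<not> (set (take p xs) \<subseteq> B \<and> set (drop p xs) \<subseteq> B)" for p
      using False by (metis append_take_drop_id le_sup_iff set_append)
    then have "(tensor_map B m s \<otimes>\<^bsub>tensor_algebra B\<^esub> tensor_map B m t) xs = 0"
      by (auto simp: tensor_algebra_def tensor_map_def intro!: sum.neutral)
    then show ?thesis using False by (simp add: tensor_map_def)
  next
    case True
    have sub: "set (take p xs) \<subseteq> B" "set (drop p xs) \<subseteq> B" for p
      using True set_take_subset set_drop_subset by (metis order_trans)+
    have split: "?c (u @ u') (v @ v') = ?c u v * ?c u' v'" if "length v = length u" for u u' v v' :: "'a list"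
    proof -
      have "{..<length (u @ u')} = {..<length u} \<union> {length u..<length u + length u'}" by auto
      then have "?c (u @ u') (v @ v') = (\<Prod>p<length u. m ((u@u') ! p) ((v@v') ! p)) *
         (\<Prod>p=length u..<length u + length u'. m ((u@u') ! p) ((v@v') ! p))"
        by (simp add: prod.union_disjoint[symmetric] ivl_disj_int)
      also have "(\<Prod>p=length u..<length u + length u'. m ((u@u') ! p) ((v@v') ! p))
         = (\<Prod>p<length u'. m (u' ! p) (v' ! p))"
        by (rule prod.reindex_bij_witness[where i="\<lambda>p. p + length u" and j="\<lambda>p. p - length u"])
          (auto simp: nth_append that)
      also have "(\<Prod>p<length u. m ((u@u') ! p) ((v@v') ! p)) = ?c u v"
        by (rule prod.cong) (auto simp: nth_append that)
      finally show ?thesis .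
    qed
    have "tensor_map B m (s \<otimes>\<^bsub>tensor_algebra B\<^esub> t) xs
       = (\<Sum>ys\<in>?W xs. \<Sum>p\<le>length xs. ?c xs ys * (s (take p ys) * t (drop p ys)))"
      using True by (simp add: tensor_map_def tensor_algebra_def sum_distrib_left)
    also have "\<dots> = (\<Sum>p\<le>length xs. \<Sum>ys\<in>?W xs. ?c xs ys * (s (take p ys) * t (drop p ys)))"
      by (rule sum.swap)
    also have "\<dots> = (\<Sum>p\<le>length xs. tensor_map B m s (take p xs) * tensor_map B m t (drop p xs))"
    proof (rule sum.cong[OF refl])
      fix p assume "p \<in> {..length xs}" then have p: "p \<le> length xs" by simp
      have "tensor_map B m s (take p xs) * tensor_map B m t (drop p xs)
        = (\<Sum>u\<in>?W (take p xs). \<Sum>v\<in>?W (drop p xs).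
             (?c (take p xs) u * s u) * (?c (drop p xs) v * t v))"
        using sub unfolding tensor_map_def by (simp only: if_True sum_product simp_thms)
      also have "\<dots> = (\<Sum>(u,v)\<in>?W (take p xs) \<times> ?W (drop p xs).
             (?c (take p xs) u * s u) * (?c (drop p xs) v * t v))"
        by (rule sum.cartesian_product)
      also have "\<dots> = (\<Sum>ys\<in>?W xs. ?c xs ys * (s (take p ys) * t (drop p ys)))"
      proof (rule sum.reindex_bij_witness[where j="\<lambda>(u,v). u @ v" and i="\<lambda>ys. (take p ys, drop p ys)"], goal_cases)
        case (5 a)
        then obtain u v where a: "a = (u,v)" "u \<in> ?W (take p xs)" "v \<in> ?W (drop p xs)" by blast
        have "?c xs (u @ v) = ?c (take p xs) u * ?c (drop p xs) v"
          using split[of u "take p xs" "drop p xs" v] a by simp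
        then show ?case using a p by simp
      qed (use p in \<open>auto dest: in_set_takeD in_set_dropD\<close>)
      finally show "(\<Sum>ys\<in>?W xs. ?c xs ys * (s (take p ys) * t (drop p ys)))
         = tensor_map B m s (take p xs) * tensor_map B m t (drop p xs)" by simp
    qed
    finally show ?thesis by (simp add: tensor_algebra_def)
  qed
qed

definition exterior_map ::
  "'b set \<Rightarrow> ('b \<Rightarrow> 'b \<Rightarrow> complex) \<Rightarrow> ('b list \<Rightarrow> complex) set \<Rightarrow> ('b list \<Rightarrow> complex) set" where
  "exterior_map B m C = set_add (tensor_algebra B) (exterior_ideal B) (tensor_map B m ` C)"

text \<open>The module is \<open>\<complex>\<^sup>B\<close>, on which \<open>g\<close> acts by the matrix \<open>m g\<close>.\<close>

definition skew_multiplicity_free ::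
  "('g, 'm) monoid_scheme \<Rightarrow> 'b set \<Rightarrow> ('g \<Rightarrow> 'b \<Rightarrow> 'b \<Rightarrow> complex) \<Rightarrow> bool" where
  "skew_multiplicity_free H B m \<longleftrightarrow>
     multiplicity_free H (exterior_algebra B) (\<lambda>g. exterior_map B (m g))"


section \<open>Saturated representations and their diagrams\<close>

text \<open>The groups \<open>G\<^sub>j\<close> are indexed by \<open>j < k\<close> and the summands \<open>V\<^sub>i\<close> by \<open>i < l\<close>. The simple group \<open>G\<^sub>j\<close>
  is a closed subgroup of \<open>GL\<close> of size \<open>msize j\<close>, and \<open>W\<^sub>i\<^sup>j\<close> is the representation \<open>factor i j\<close> of \<open>G\<^sub>j\<close>
  on the coordinate space of dimension \<open>fdim i j\<close>. The summand \<open>V\<^sub>i\<close> is the tensor product of all \<open>W\<^sub>i\<^sup>j\<close>,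
  hence irreducible, and the saturated group acts on it as described further below.\<close>

record saturated_data =
  num_groups :: nat
  num_summands :: nat
  msize :: "nat \<Rightarrow> nat"
  simple_group :: "nat \<Rightarrow> complex mat set"
  fdim :: "nat \<Rightarrow> nat \<Rightarrow> nat"
  factor :: "nat \<Rightarrow> nat \<Rightarrow> complex mat \<Rightarrow> complex mat"

definition saturated :: "saturated_data \<Rightarrow> bool" where
  "saturated D \<longleftrightarrow>
     (\<forall>j<num_groups D. simple_algebraic_group (msize D j) (simple_group D j)) \<and>
     (\<forall>i<num_summands D. \<forall>j<num_groups D.
        irreducible_rational_rep (msize D j) (simple_group D j) (fdim D i j) (factor D i j))"

text \<open>The representation of \<open>(\<complex>\<^sup>*)\<^sup>I \<times> \<Prod>\<^sub>j\<^sub>\<in>\<^sub>J G\<^sub>j\<close> on the direct sum over \<open>i \<in> I\<close> of the tensor products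
  of the \<open>W\<^sub>i\<^sup>j\<close> with \<open>j \<in> N i\<close>. A basis of the \<open>i\<close>-th tensor product is indexed by the families
  \<open>(a\<^sub>j)\<close>, \<open>j \<in> N i\<close>, of basis indices of the factors, and its matrix is the Kronecker product of
  those of the factors.\<close>

definition sat_group ::
  "saturated_data \<Rightarrow> nat set \<Rightarrow> nat set \<Rightarrow> ((nat \<Rightarrow> complex) \<times> (nat \<Rightarrow> complex mat)) monoid" where
  "sat_group D I J =
     product_group I (\<lambda>i. Cstar) \<times>\<times>
     product_group J (\<lambda>j. matrix_group (msize D j) (simple_group D j))"

definition sat_basis ::
  "saturated_data \<Rightarrow> nat set \<Rightarrow> (nat \<Rightarrow> nat set) \<Rightarrow> (nat \<times> (nat \<Rightarrow> nat)) set" where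
  "sat_basis D I N = (SIGMA i:I. \<Pi>\<^sub>E j\<in>N i. {..<fdim D i j})"

definition sat_matrix ::
  "saturated_data \<Rightarrow> (nat \<Rightarrow> nat set) \<Rightarrow> (nat \<Rightarrow> complex) \<times> (nat \<Rightarrow> complex mat)
     \<Rightarrow> nat \<times> (nat \<Rightarrow> nat) \<Rightarrow> nat \<times> (nat \<Rightarrow> nat) \<Rightarrow> complex" where
  "sat_matrix D N = (\<lambda>(z, g) (i, a) (i', b).
     if i = i' then z i * (\<Prod>j\<in>N i. factor D i j (g j) $$ (a j, b j)) else 0)"

definition SMF :: "saturated_data \<Rightarrow> bool" where
  "SMF D \<longleftrightarrow>
     (let I = {..<num_summands D}; J = {..<num_groups D}; N = (\<lambda>i. J)
      in skew_multiplicity_free (sat_group D I J) (sat_basis D I N) (sat_matrix D N))"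

datatype node = Top nat | Bottom nat

text \<open>The edge joining \<open>G\<^sub>j\<close> and \<open>V\<^sub>i\<close> is encoded as a single arc from top to bottom; the predicate
  \<open>connected\<close> of the graph library refers to the underlying undirected graph and requires at least
  one vertex.\<close>

definition rep_diagram :: "saturated_data \<Rightarrow> node pair_pre_digraph" where
  "rep_diagram D =
     \<lparr>pverts = Top ` {..<num_groups D} \<union> Bottom ` {..<num_summands D},
      parcs = {(Top j, Bottom i) | i j. i < num_summands D \<and> j < num_groups D \<and>
                 (\<exists>g\<in>simple_group D j. factor D i j g \<noteq> 1\<^sub>m (fdim D i j))}\<rparr>"

definition SMF_subgraph :: "saturated_data \<Rightarrow> node pair_pre_digraph \<Rightarrow> bool" where
  "SMF_subgraph D H \<longleftrightarrow>
     (let I = {i. Bottom i \<in> pverts H}; J = {j. Top j \<in> pverts H};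
          N = (\<lambda>i. {j. (Top j, Bottom i) \<in> parcs H})
      in skew_multiplicity_free (sat_group D I J) (sat_basis D I N) (sat_matrix D N))"

end

theory Submission
  imports Defs "HOL-Library.Function_Algebras"
begin

text \<open>
  Why the statement holds. For every summand \<open>V\<^sub>i\<close> kept by the subgraph write \<open>V\<^sub>i = X\<^sub>i \<otimes> V\<^sub>i'\<close>, where
  \<open>X\<^sub>i\<close> is the tensor product of the factors \<open>W\<^sub>i\<^sup>j\<close> whose edge is missing. Multiplying out, the exterior
  algebra of \<open>V\<close> contains, for every multidegree \<open>d\<close>, the module \<open>S\<^sup>d(X) \<otimes> \<Lambda>\<^sup>d(V')\<close>, where
  \<open>S\<^sup>d(X)\<close> is the tensor product of the symmetric powers \<open>S\<^sup>d\<^sup>i(X\<^sub>i)\<close>: a product of commuting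
  coordinates on the \<open>X\<^sub>i\<close> with an alternating function on \<open>V'\<close> is an alternating function on \<open>V\<close>.
  If \<open>X \<otimes> M\<close> is multiplicity free with \<open>X \<noteq> 0\<close>, then so is \<open>M\<close>. Indeed a repeated constituent of \<open>M\<close>
  gives one of \<open>X \<otimes> M\<close>, and complete reducibility passes from \<open>X \<otimes> M\<close> to \<open>M\<close> by a partial trace:
  if \<open>Q\<close> is an equivariant projection onto \<open>X \<otimes> N\<close>, then the trace of \<open>Q\<close> over \<open>X\<close> is an equivariant
  map from \<open>M\<close> into \<open>N\<close> which is multiplication by \<open>dim X\<close> on \<open>N\<close>. The scalar is invertible in
  characteristic zero.

  Both halves of this argument become one when multiplicity-freeness is expressed as follows: every
  invariant subspace \<open>N\<close> is the image of an equivariant projection that maps \<^emph>\<open>every\<close> invariant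
  subspace into itself (\<open>multiplicity_free_imp_strong_projections\<close> and
  \<open>strong_projections_imp_multiplicity_free\<close>). This property is what the partial trace transports.

  To compute, the exterior algebra is replaced by the space of alternating functions on words over
  a basis (\<open>skew_multiplicity_free_iff_strong_projections\<close>). It is a complement of the exterior ideal in
  the tensor algebra that is stable under all maps induced by matrices. There the embedding of
  \<open>S(X) \<otimes> \<Lambda>(V')\<close> is \<open>lift\<close>, its transpose is \<open>contract\<close>, and the partial trace is a sum over monomials.
  This sum is equivariant because the element \<open>\<Sum>\<^sub>\<alpha> e\<^sub>\<alpha> \<otimes> e\<^sub>\<alpha>\<^sup>*\<close> attached to a pair of dual bases is
  invariant (\<open>casimir_invariance\<close>). The result is \<open>strong_projections_transfer\<close>.

  All multidegrees are treated at once. On the part of multidegree \<open>d\<close> the partial trace is the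
  dimension of \<open>S\<^sup>d(X)\<close> up to normalisation, and the torus is used exactly once, to show that an
  invariant subspace is the sum of its multihomogeneous parts (\<open>type_multiset_graded\<close>), so that
  these scalars can be divided out. That the \<open>W\<^sub>i\<^sup>j\<close> are nonzero guarantees that they do not vanish.
\<close>

section \<open>Multiplicity-free modules and equivariant projections\<close>

text \<open>The module is a finite dimensional subspace \<open>V\<close> of an ambient vector space, so that the spaces of
  functions on words below, which are not types of their own, are instances.\<close>

locale group_rep = vector_space scale
  for scale :: "complex \<Rightarrow> 'v::ab_group_add \<Rightarrow> 'v" (infixr "*s" 75) +
  fixes K :: "('g, 'm) monoid_scheme" and V :: "'v set" and act :: "'g \<Rightarrow> 'v \<Rightarrow> 'v"
  assumes subspace_V: "subspace V"
    and finite_dim: "\<exists>T. finite T \<and> V \<subseteq> span T"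
    and act_closed: "g \<in> carrier K \<Longrightarrow> x \<in> V \<Longrightarrow> act g x \<in> V"
    and act_add: "g \<in> carrier K \<Longrightarrow> x \<in> V \<Longrightarrow> y \<in> V \<Longrightarrow> act g (x + y) = act g x + act g y"
    and act_scale: "g \<in> carrier K \<Longrightarrow> x \<in> V \<Longrightarrow> act g (c *s x) = c *s act g x"
begin

definition module_of :: "(complex, 'v) module" where
  "module_of = \<lparr>carrier = V, monoid.mult = undefined, monoid.one = undefined,
     ring.zero = 0, ring.add = (+), smult = scale\<rparr>"

definition invariant :: "'v set \<Rightarrow> bool" where
  "invariant N \<longleftrightarrow> subspace N \<and> N \<subseteq> V \<and> (\<forall>g\<in>carrier K. act g ` N \<subseteq> N)"

definition equivariant :: "('v \<Rightarrow> 'v) \<Rightarrow> bool" where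
  "equivariant Q \<longleftrightarrow>
     (\<forall>x\<in>V. Q x \<in> V) \<and> (\<forall>x\<in>V. \<forall>y\<in>V. Q (x + y) = Q x + Q y) \<and>
     (\<forall>c. \<forall>x\<in>V. Q (c *s x) = c *s Q x) \<and> (\<forall>g\<in>carrier K. \<forall>x\<in>V. Q (act g x) = act g (Q x))"

text \<open>The last clause is the point: the projections onto the invariant subspaces of a module with a
  repeated constituent \<open>U \<oplus> U\<close> cannot preserve all the diagonals in it.\<close>

definition strong_projections :: bool where
  "strong_projections \<longleftrightarrow> (\<forall>N. invariant N \<longrightarrow>
     (\<exists>Q. equivariant Q \<and> Q ` V \<subseteq> N \<and> (\<forall>x\<in>N. Q x = x) \<and>
        (\<forall>L. invariant L \<longrightarrow> Q ` L \<subseteq> L)))"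

lemma invariantD:
  assumes "invariant N"
  shows "0 \<in> N" "x \<in> N \<Longrightarrow> x \<in> V" "x \<in> N \<Longrightarrow> y \<in> N \<Longrightarrow> x + y \<in> N"
    "x \<in> N \<Longrightarrow> y \<in> N \<Longrightarrow> x - y \<in> N" "x \<in> N \<Longrightarrow> c *s x \<in> N"
    "x \<in> N \<Longrightarrow> g \<in> carrier K \<Longrightarrow> act g x \<in> N"
  using assms by (auto simp: invariant_def image_subset_iff intro: subspace_0 subspace_add subspace_diff subspace_scale)

lemma act_0: "g \<in> carrier K \<Longrightarrow> act g 0 = 0"
  using act_scale[of g 0 0] subspace_0[OF subspace_V] by simp

lemma act_sum:
  assumes "g \<in> carrier K" "finite S" "\<And>s. s \<in> S \<Longrightarrow> f s \<in> V"
  shows "act g (\<Sum>s\<in>S. f s) = (\<Sum>s\<in>S. act g (f s))"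
  using assms(2,3)
proof (induction S)
  case (insert s S)
  then show ?case using subspace_sum[OF subspace_V, of S f] by (simp add: act_add assms(1))
qed (simp add: act_0 assms(1))

lemma invariant_V: "invariant V"
  using subspace_V act_closed by (auto simp: invariant_def)

lemma invariant_Int: "invariant N \<Longrightarrow> invariant L \<Longrightarrow> invariant (N \<inter> L)"
  by (auto simp: invariant_def image_subset_iff intro: subspace_inter)

lemma equivariantD:
  assumes "equivariant Q"
  shows "x \<in> V \<Longrightarrow> Q x \<in> V" "x \<in> V \<Longrightarrow> y \<in> V \<Longrightarrow> Q (x + y) = Q x + Q y"
    "x \<in> V \<Longrightarrow> Q (c *s x) = c *s Q x" "g \<in> carrier K \<Longrightarrow> x \<in> V \<Longrightarrow> Q (act g x) = act g (Q x)"
    "Q 0 = 0" "x \<in> V \<Longrightarrow> y \<in> V \<Longrightarrow> Q (x - y) = Q x - Q y"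
proof -
  show *: "x \<in> V \<Longrightarrow> Q x \<in> V" "x \<in> V \<Longrightarrow> y \<in> V \<Longrightarrow> Q (x + y) = Q x + Q y"
    "x \<in> V \<Longrightarrow> Q (c *s x) = c *s Q x" "g \<in> carrier K \<Longrightarrow> x \<in> V \<Longrightarrow> Q (act g x) = act g (Q x)"
    for x y c g using assms by (auto simp: equivariant_def)
  show "Q 0 = 0" using *(2)[of 0 0] subspace_0[OF subspace_V] by simp
  assume "x \<in> V" "y \<in> V"
  then show "Q (x - y) = Q x - Q y"
    using *(2)[of "x - y" y] subspace_diff[OF subspace_V] by (simp add: eq_diff_eq)
qed

lemma equivariant_sum:
  assumes "equivariant Q" "finite S" "\<And>s. s \<in> S \<Longrightarrow> f s \<in> V"
  shows "Q (\<Sum>s\<in>S. f s) = (\<Sum>s\<in>S. Q (f s))"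
  using assms(2,3)
proof (induction S)
  case (insert s S)
  then show ?case using subspace_sum[OF subspace_V, of S f] by (simp add: equivariantD(2)[OF assms(1)])
qed (simp add: equivariantD(5)[OF assms(1)])

lemma invariant_kernel:
  assumes "equivariant Q" "invariant N"
  shows "invariant {x \<in> N. Q x = 0}"
  unfolding invariant_def subspace_def
  using assms(1) invariantD[OF assms(2)]
  by (auto simp: equivariantD act_0)

lemma invariant_image:
  assumes Q: "equivariant Q" and N: "invariant N"
  shows "invariant (Q ` N)"
proof -
  note N' = invariantD[OF N] and Q' = equivariantD[OF Q]
  have "subspace (Q ` N)"
    unfolding subspace_def
  proof (intro conjI ballI allI)
    show "0 \<in> Q ` N" using Q'(5) N'(1) by force
  next
    fix x y assume "x \<in> Q ` N" "y \<in> Q ` N"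
    then obtain a b where "a \<in> N" "b \<in> N" "x = Q a" "y = Q b" by blast
    then show "x + y \<in> Q ` N" using Q'(2)[of a b] N' by (intro image_eqI[of _ _ "a + b"]) auto
  next
    fix c x assume "x \<in> Q ` N"
    then obtain a where "a \<in> N" "x = Q a" by blast
    then show "c *s x \<in> Q ` N" using Q'(3)[of a c] N' by (intro image_eqI[of _ _ "c *s a"]) auto
  qed
  moreover have "act g (Q x) \<in> Q ` N" if "g \<in> carrier K" "x \<in> N" for g x
    using that N' Q'(4)[of g x] by (intro image_eqI[of _ _ "act g x"]) auto
  ultimately show ?thesis using N' Q'(1) by (auto simp: invariant_def)
qed

lemma abelian_group_module_of: "abelian_group module_of"
proof (rule abelian_groupI)
  fix x assume "x \<in> carrier module_of"
  then show "\<exists>y\<in>carrier module_of. y \<oplus>\<^bsub>module_of\<^esub> x = \<zero>\<^bsub>module_of\<^esub>"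
    by (intro bexI[of _ "- x"]) (auto simp: module_of_def subspace_neg[OF subspace_V])
qed (auto simp: module_of_def add_ac subspace_add[OF subspace_V] subspace_0[OF subspace_V])

lemma finsum_module_of:
  assumes "finite S" "\<And>s. s \<in> S \<Longrightarrow> f s \<in> V"
  shows "finsum module_of f S = (\<Sum>s\<in>S. f s)"
proof -
  interpret M: abelian_group module_of by (rule abelian_group_module_of)
  show ?thesis using assms
  proof (induction S)
    case (insert s S)
    then have "f \<in> S \<rightarrow> carrier module_of" "f s \<in> carrier module_of" by (auto simp: module_of_def)
    then have "finsum module_of f (insert s S) = f s \<oplus>\<^bsub>module_of\<^esub> finsum module_of f S"
      using insert.hyps by (intro M.finsum_insert) auto
    then show ?case using insert by (simp add: module_of_def)
  next
    case empty
    have "finsum module_of f {} = \<zero>\<^bsub>module_of\<^esub>" by (rule M.finsum_empty)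
    then show ?case by (simp add: module_of_def)
  qed
qed

lemma submodule_module_of_iff:
  "Module.submodule N complex_ring module_of \<longleftrightarrow> subspace N \<and> N \<subseteq> V"
proof -
  interpret M: abelian_group module_of by (rule abelian_group_module_of)
  have neg: "inv\<^bsub>add_monoid module_of\<^esub> x = - x" if "x \<in> V" for x
  proof -
    have "- x \<in> carrier module_of" "x \<in> carrier module_of"
      using that subspace_neg[OF subspace_V] by (auto simp: module_of_def)
    then show ?thesis using M.minus_equality[of "- x" x] by (auto simp: module_of_def a_inv_def)
  qed
  show ?thesis
  proof
    assume "Module.submodule N complex_ring module_of"
    then interpret N: Module.submodule N complex_ring module_of .
    show "subspace N \<and> N \<subseteq> V"
      using N.subset N.m_closed N.one_closed N.smult_closed
      by (auto simp: module_of_def subspace_def)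
  next
    assume N: "subspace N \<and> N \<subseteq> V"
    then have "subgroup N (add_monoid module_of)"
      by (intro subgroup.intro)
        (auto simp: neg subsetD subspace_neg, auto simp: module_of_def subspace_def)
    moreover have "Module.submodule_axioms N complex_ring module_of"
      using N by (auto simp: submodule_axioms_def module_of_def subspace_def)
    ultimately show "Module.submodule N complex_ring module_of" by (rule Module.submodule.intro)
  qed
qed

lemma G_submodule_iff: "G_submodule K module_of act N \<longleftrightarrow> invariant N"
  by (auto simp: G_submodule_def invariant_def submodule_module_of_iff)

definition irreducible :: "'v set \<Rightarrow> bool" where
  "irreducible U \<longleftrightarrow> invariant U \<and> U \<noteq> {0} \<and> (\<forall>N. invariant N \<and> N \<subseteq> U \<longrightarrow> N = {0} \<or> N = U)"

lemma irreducible_iff: "irreducible_submodule K module_of act U \<longleftrightarrow> irreducible U"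
  unfolding irreducible_submodule_def irreducible_def G_submodule_iff by (simp add: module_of_def)

lemma irreducible_subset:
  assumes "irreducible U" "invariant N" "x \<in> U" "x \<in> N" "x \<noteq> 0"
  shows "U \<subseteq> N"
  using assms invariant_Int[of U N] unfolding irreducible_def by blast

definition isomorphic :: "'v set \<Rightarrow> 'v set \<Rightarrow> bool" where
  "isomorphic U U' \<longleftrightarrow> (\<exists>f. bij_betw f U U' \<and>
        (\<forall>u\<in>U. \<forall>v\<in>U. f (u + v) = f u + f v) \<and> (\<forall>c. \<forall>u\<in>U. f (c *s u) = c *s f u) \<and>
        (\<forall>g\<in>carrier K. \<forall>u\<in>U. f (act g u) = act g (f u)))"

lemma isomorphic_iff: "isomorphic_submodules K module_of act U U' \<longleftrightarrow> isomorphic U U'"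
  unfolding isomorphic_submodules_def isomorphic_def by (simp add: module_of_def)

text \<open>The isomorphism is \<open>q\<close> after the inverse of \<open>p\<close>.\<close>

lemma isomorphic_via:
  assumes p: "equivariant p" and q: "equivariant q" and W: "invariant W"
    and p': "bij_betw p W U" and q': "bij_betw q W U'"
  shows "isomorphic U U'"
proof -
  let ?r = "inv_into W p"
  note W' = invariantD[OF W]
  have r: "bij_betw ?r U W" by (rule bij_betw_inv_into[OF p'])
  have rW: "?r u \<in> W" "p (?r u) = u" if "u \<in> U" for u
    using that r p' by (auto simp: bij_betw_def f_inv_into_f inv_into_into)
  have rI: "?r (p w) = w" if "w \<in> W" for w using that p' by (auto simp: bij_betw_def)
  have 1: "?r (u + v) = ?r u + ?r v" if "u \<in> U" "v \<in> U" for u v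
    using rI[of "?r u + ?r v"] rW[of u] rW[of v] that W' by (simp add: equivariantD[OF p])
  have 2: "?r (c *s u) = c *s ?r u" if "u \<in> U" for c u
    using rI[of "c *s ?r u"] rW[of u] that W' by (simp add: equivariantD[OF p])
  have 3: "?r (act g u) = act g (?r u)" if "u \<in> U" "g \<in> carrier K" for g u
    using rI[of "act g (?r u)"] rW[of u] that W' by (simp add: equivariantD[OF p])
  have "bij_betw (q \<circ> ?r) U U'" by (rule bij_betw_trans[OF r q'])
  then show ?thesis unfolding isomorphic_def
    using 1 2 3 rW W' by (intro exI[of _ "q \<circ> ?r"]) (auto simp: equivariantD[OF q])
qed

text \<open>By induction on the number of nonzero components of \<open>x\<close>. Either some element of \<open>N\<close> supported on fewer
  of the components of \<open>x\<close> exists; then \<open>N\<close> contains one of the summands, which can be subtracted from \<open>x\<close>.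
  Or the projections to two different summands are both bijective on the elements of \<open>N\<close> with support
  inside that of \<open>x\<close>, and these two summands would be isomorphic.\<close>

lemma decomposition_respects_invariant:
  assumes fin: "finite S" and irr: "\<And>U. U \<in> S \<Longrightarrow> irreducible U"
    and noniso: "\<And>U U'. U \<in> S \<Longrightarrow> U' \<in> S \<Longrightarrow> isomorphic U U' \<Longrightarrow> U = U'"
    and p: "\<And>U. U \<in> S \<Longrightarrow> equivariant (p U)"
    and pU: "\<And>U x. U \<in> S \<Longrightarrow> x \<in> V \<Longrightarrow> p U x \<in> U"
    and sum: "\<And>x. x \<in> V \<Longrightarrow> x = (\<Sum>U\<in>S. p U x)"
    and pp: "\<And>U U' x. U \<in> S \<Longrightarrow> U' \<in> S \<Longrightarrow> x \<in> U \<Longrightarrow> p U' x = (if U' = U then x else 0)"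
    and N: "invariant N" and x: "x \<in> N" and U: "U \<in> S"
  shows "p U x \<in> N"
  using x U
proof (induction "card {U\<in>S. p U x \<noteq> 0}" arbitrary: x U rule: less_induct)
  case less
  note N' = invariantD[OF N]
  let ?T = "{U\<in>S. p U x \<noteq> 0}"
  have T: "finite ?T" using fin by simp
  have xV: "x \<in> V" using less.prems N' by blast
  show ?case
  proof (cases "card ?T \<le> 1")
    case True
    show ?thesis
    proof (cases "p U x = 0")
      case False
      then have "?T = {U}" using True less.prems T by (auto simp: card_le_Suc0_iff_eq)
      then have "\<And>U'. U' \<in> S - {U} \<Longrightarrow> p U' x = 0" by blast
      then have "x = p U x"
        using sum[OF xV] fin less.prems(2) by (simp add: sum.remove[of S U])
      then show ?thesis using less.prems by simp
    qed (use N' in simp)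
  next
    case False
    define N0 where "N0 = {y\<in>N. \<forall>U\<in>S - ?T. p U y = 0}"
    have N0: "invariant N0"
    proof -
      have "subspace N0" unfolding N0_def subspace_def
        using N' by (auto simp: equivariantD[OF p])
      moreover have "act g y \<in> N0" if "g \<in> carrier K" "y \<in> N0" for g y
        using that N' unfolding N0_def by (auto simp: equivariantD[OF p] act_0)
      ultimately show ?thesis using N' by (auto simp: invariant_def N0_def)
    qed
    have xN0: "x \<in> N0" using less.prems by (auto simp: N0_def)
    show ?thesis
    proof (cases "\<exists>y\<in>N0. y \<noteq> 0 \<and> (\<exists>U\<in>?T. p U y = 0)")
      case True
      then obtain y U1 where y: "y \<in> N0" "y \<noteq> 0" "U1 \<in> ?T" "p U1 y = 0" by blast
      have yN: "y \<in> N" "y \<in> V" using y N' by (auto simp: N0_def)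
      have "{U\<in>S. p U y \<noteq> 0} \<subset> ?T" using y by (auto simp: N0_def)
      then have c: "card {U\<in>S. p U y \<noteq> 0} < card ?T" by (rule psubset_card_mono[OF T])
      have "\<exists>U2\<in>S. p U2 y \<noteq> 0"
        using sum[OF yN(2)] y(2) by (metis sum.neutral)
      then obtain U2 where U2: "U2 \<in> S" "p U2 y \<noteq> 0" by blast
      have U2T: "U2 \<in> ?T" using U2 y by (auto simp: N0_def)
      have "p U2 y \<in> N" using less.hyps[OF c yN(1) U2(1)] .
      then have U2N: "U2 \<subseteq> N"
        using irreducible_subset[OF irr[OF U2(1)] N pU[OF U2(1) yN(2)]] U2(2) by blast
      have px2: "p U2 x \<in> U2" using pU[OF U2(1) xV] .
      then have px2': "p U2 x \<in> N" "p U2 x \<in> V" using U2N N' by blast+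
      let ?x = "x - p U2 x"
      have comp: "p U' ?x = (if U' = U2 then 0 else p U' x)" if "U' \<in> S" for U'
        using pp[OF U2(1) that px2] equivariantD(6)[OF p[OF that] xV px2'(2)] by auto
      have "{U\<in>S. p U ?x \<noteq> 0} \<subseteq> ?T" using comp by (auto split: if_splits)
      moreover have "U2 \<notin> {U\<in>S. p U ?x \<noteq> 0}" using comp U2(1) by simp
      ultimately have "{U\<in>S. p U ?x \<noteq> 0} \<subset> ?T" using U2T by blast
      then have "card {U\<in>S. p U ?x \<noteq> 0} < card ?T" by (rule psubset_card_mono[OF T])
      moreover have "?x \<in> N" using less.prems px2' N' by blast
      ultimately have "p U ?x \<in> N" using less.hyps less.prems(2) by blast
      then show ?thesis using comp[OF less.prems(2)] px2' by (auto split: if_splits)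
    next
      case False
      have bij: "bij_betw (p U') N0 U'" if U': "U' \<in> ?T" for U'
      proof -
        have US: "U' \<in> S" using U' by blast
        have inj: "inj_on (p U') N0"
        proof (rule inj_onI)
          fix a b assume ab: "a \<in> N0" "b \<in> N0" "p U' a = p U' b"
          then have "a - b \<in> N0" using invariantD[OF N0] by blast
          moreover have "p U' (a - b) = 0"
            using ab invariantD(2)[OF N0] by (simp add: equivariantD[OF p[OF US]])
          ultimately show "a = b" using False U' by auto
        qed
        have "invariant (p U' ` N0)" by (rule invariant_image[OF p[OF US] N0])
        moreover have "p U' ` N0 \<subseteq> U'" using pU[OF US] invariantD(2)[OF N0] by blast
        moreover have "p U' ` N0 \<noteq> {0}" using xN0 U' by auto
        ultimately have "p U' ` N0 = U'" using irr[OF US] unfolding irreducible_def by blast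
        then show ?thesis using inj by (simp add: bij_betw_def)
      qed
      obtain U1 U2 where U12: "U1 \<in> ?T" "U2 \<in> ?T" "U1 \<noteq> U2"
        using \<open>\<not> card ?T \<le> 1\<close> card_le_Suc0_iff_eq[OF T] by force
      then have "isomorphic U1 U2"
        using isomorphic_via[OF p p N0 bij bij, of U1 U2] by blast
      then have False using noniso U12 by blast
      then show ?thesis ..
    qed
  qed
qed

text \<open>The projection onto \<open>N\<close> is the sum of the component projections belonging to the summands
  inside \<open>N\<close>.\<close>

lemma multiplicity_free_imp_strong_projections:
  assumes "multiplicity_free K module_of act"
  shows strong_projections
proof -
  have carrier: "carrier module_of = V" by (simp add: module_of_def)
  obtain S where fin: "finite S" and irr': "\<forall>U\<in>S. irreducible U"
    and noniso': "\<forall>U\<in>S. \<forall>U'\<in>S. isomorphic U U' \<longrightarrow> U = U'"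
    and dec': "\<forall>x\<in>V. \<exists>!f. f \<in> (\<Pi>\<^sub>E U\<in>S. U) \<and> x = finsum module_of f S"
    using assms[unfolded multiplicity_free_def irreducible_iff isomorphic_iff carrier]
    by (elim exE conjE)
  note irr = irr'[rule_format] and noniso = noniso'[rule_format] and dec = dec'[rule_format]
  have inv: "invariant U" if "U \<in> S" for U using irr[OF that] by (simp add: irreducible_def)
  have sub: "x \<in> V" if "x \<in> U" "U \<in> S" for x U using invariantD(2)[OF inv] that by blast
  define P where "P x f \<longleftrightarrow> f \<in> (\<Pi>\<^sub>E U\<in>S. U) \<and> x = (\<Sum>U\<in>S. f U)" for x f
  have ex1: "\<exists>!f. P x f" if x: "x \<in> V" for x
  proof -
    have "P x f \<longleftrightarrow> f \<in> (\<Pi>\<^sub>E U\<in>S. U) \<and> x = finsum module_of f S" for f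
    proof -
      have "finsum module_of f S = (\<Sum>U\<in>S. f U)" if "f \<in> (\<Pi>\<^sub>E U\<in>S. U)"
        by (rule finsum_module_of[OF fin]) (use that sub in \<open>auto simp: PiE_iff\<close>)
      then show ?thesis unfolding P_def by metis
    qed
    then show ?thesis using dec[OF x] by simp
  qed
  define p where "p U x = (THE f. P x f) U" for U x
  have P: "P x (\<lambda>U. p U x)" if "x \<in> V" for x
    unfolding p_def using theI'[OF ex1[OF that]] .
  have uniq: "p U x = f U" if "x \<in> V" "P x f" for x f U
    using ex1[OF that(1)] P[OF that(1)] that(2) by blast
  have pU: "p U x \<in> U" if "U \<in> S" "x \<in> V" for U x
    using P[OF that(2)] that(1) by (auto simp: P_def PiE_iff)
  have sum: "x = (\<Sum>U\<in>S. p U x)" if "x \<in> V" for x using P[OF that] by (simp add: P_def)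
  have uniq': "p U x = f U" if "x \<in> V" "\<And>U. U \<in> S \<Longrightarrow> f U \<in> U" "x = (\<Sum>U\<in>S. f U)" "U \<in> S" for x f U
    using uniq[of x "restrict f S" U] that by (auto simp: P_def)
  have p: "equivariant (p U)" if US: "U \<in> S" for U
    unfolding equivariant_def
  proof (intro conjI ballI allI)
    show "p U x \<in> V" if "x \<in> V" for x using pU[OF US that] sub US by blast
    show "p U (x + y) = p U x + p U y" if xy: "x \<in> V" "y \<in> V" for x y
    proof (rule uniq'[OF _ _ _ US])
      show "x + y = (\<Sum>U\<in>S. p U x + p U y)" using sum xy by (simp add: sum.distrib)
    qed (use xy subspace_add[OF subspace_V] invariantD[OF inv] pU in auto)
    show "p U (c *s x) = c *s p U x" if x: "x \<in> V" for c x
    proof (rule uniq'[OF _ _ _ US])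
      show "c *s x = (\<Sum>U\<in>S. c *s p U x)" using sum[OF x] by (metis scale_sum_right)
    qed (use x subspace_scale[OF subspace_V] invariantD[OF inv] pU in auto)
    show "p U (act g x) = act g (p U x)" if g: "g \<in> carrier K" and x: "x \<in> V" for g x
    proof (rule uniq'[OF _ _ _ US])
      have "act g (\<Sum>U\<in>S. p U x) = (\<Sum>U\<in>S. act g (p U x))"
        using pU x sub by (intro act_sum[OF g fin]) blast
      then show "act g x = (\<Sum>U\<in>S. act g (p U x))" using sum[OF x] by (simp only:)
    qed (use x g act_closed invariantD[OF inv] pU in auto)
  qed
  have pp: "p U' x = (if U' = U then x else 0)" if "U \<in> S" "U' \<in> S" "x \<in> U" for U U' x
  proof (rule uniq'[OF _ _ _ that(2)])
    show "x = (\<Sum>U'\<in>S. if U' = U then x else 0)" using fin that by simp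
  qed (use that sub invariantD[OF inv] in auto)
  have resp: "p U x \<in> N" if "invariant N" "x \<in> N" "U \<in> S" for N x U
    using decomposition_respects_invariant[OF fin irr noniso p pU sum pp that] .
  show ?thesis unfolding strong_projections_def
  proof (intro allI impI)
    fix N assume N: "invariant N"
    define S' where "S' = {U\<in>S. U \<subseteq> N}"
    have S': "finite S'" "S' \<subseteq> S" using fin by (auto simp: S'_def)
    define Q where "Q x = (\<Sum>U\<in>S'. p U x)" for x
    have QL: "Q ` L \<subseteq> L" if L: "invariant L" for L
      unfolding Q_def using resp[OF L] S' L by (auto simp: invariant_def intro!: subspace_sum)
    have "equivariant Q"
      unfolding equivariant_def
    proof (intro conjI ballI allI)
      show "Q x \<in> V" if "x \<in> V" for x using QL[OF invariant_V] that by blast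
      show "Q (x + y) = Q x + Q y" if "x \<in> V" "y \<in> V" for x y
        unfolding Q_def sum.distrib[symmetric] using that S' by (intro sum.cong) (auto simp: equivariantD[OF p])
      show "Q (c *s x) = c *s Q x" if "x \<in> V" for c x
        unfolding Q_def scale_sum_right using that S' by (intro sum.cong) (auto simp: equivariantD[OF p])
      show "Q (act g x) = act g (Q x)" if g: "g \<in> carrier K" and x: "x \<in> V" for g x
      proof -
        have "act g (\<Sum>U\<in>S'. p U x) = (\<Sum>U\<in>S'. act g (p U x))"
          using pU x sub S' by (intro act_sum[OF g]) blast+
        then show ?thesis unfolding Q_def using S' g x
          by (auto simp: equivariantD[OF p] intro!: sum.cong)
      qed
    qed
    moreover have "Q ` V \<subseteq> N"
      unfolding Q_def using pU N S' by (auto simp: invariant_def S'_def intro!: subspace_sum)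
    moreover have "Q x = x" if x: "x \<in> N" for x
    proof -
      have xV: "x \<in> V" using invariantD[OF N] x by blast
      have "p U x = 0" if "U \<in> S - S'" for U
        using irreducible_subset[OF irr N pU resp[OF N x]] that xV by (auto simp: S'_def)
      then have "Q x = (\<Sum>U\<in>S. p U x)"
        unfolding Q_def using S' fin by (intro sum.mono_neutral_left) auto
      then show ?thesis using sum[OF xV] by simp
    qed
    ultimately show "\<exists>Q. equivariant Q \<and> Q ` V \<subseteq> N \<and> (\<forall>x\<in>N. Q x = x) \<and> (\<forall>L. invariant L \<longrightarrow> Q ` L \<subseteq> L)"
      using QL by blast
  qed
qed

text \<open>Dimension is the measure for the inductions below.\<close>

lemma dim_strict_mono:
  assumes "subspace N" "subspace L" "N \<subset> L" "L \<subseteq> V"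
  shows "dim N < dim L"
proof -
  obtain T where T: "finite T" "V \<subseteq> span T" using finite_dim by blast
  obtain b where b: "b \<subseteq> N" "independent b" "N \<subseteq> span b"
    using maximal_independent_subset[of N] by blast
  have "b \<subseteq> L" using b assms by blast
  from maximal_independent_subset_extend[OF this b(2)]
  obtain b' where b': "b \<subseteq> b'" "b' \<subseteq> L" "independent b'" "L \<subseteq> span b'" by blast
  have sp: "span b = N" "span b' = L"
    using b b' assms span_mono span_eq_iff by (metis subset_antisym)+
  have "finite b'" using independent_span_bound[OF T(1) b'(3)] b'(2) assms T by blast
  moreover have "b \<subset> b'" using b'(1) sp assms by blast
  ultimately have "card b < card b'" by (rule psubset_card_mono)
  then show ?thesis using sp dim_span_eq_card_independent b b' by metis
qed

lemma exists_irreducible: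
  assumes "invariant N" "N \<noteq> {0}"
  shows "\<exists>U. irreducible U \<and> U \<subseteq> N"
  using assms
proof (induction "dim N" arbitrary: N rule: less_induct)
  case less
  show ?case
  proof (cases "irreducible N")
    case False
    then obtain L where L: "invariant L" "L \<subset> N" "L \<noteq> {0}"
      using less.prems unfolding irreducible_def by blast
    then have "dim L < dim N"
      using less.prems by (intro dim_strict_mono) (auto simp: invariant_def)
    then show ?thesis using less.hyps[of L] L by blast
  qed blast
qed

lemma strong_projectionsE:
  assumes strong_projections "invariant N"
  obtains Q where "equivariant Q" "\<And>x. x \<in> V \<Longrightarrow> Q x \<in> N" "\<And>x. x \<in> N \<Longrightarrow> Q x = x"
    "\<And>L x. invariant L \<Longrightarrow> x \<in> L \<Longrightarrow> Q x \<in> L"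
proof -
  obtain Q where "equivariant Q" "Q ` V \<subseteq> N" "\<forall>x\<in>N. Q x = x" "\<forall>L. invariant L \<longrightarrow> Q ` L \<subseteq> L"
    using assms(1)[unfolded strong_projections_def, rule_format, OF assms(2)] by blast
  then show ?thesis using that[of Q] by (simp add: image_subset_iff)
qed

text \<open>For an isomorphism \<open>f\<close> from \<open>U\<close> to another irreducible subspace \<open>U'\<close>, the projection onto \<open>U\<close>
  kills \<open>U'\<close> and preserves the graph \<open>{u + f u}\<close>; it would map \<open>u + f u\<close> to \<open>u\<close>, which is not in the graph.\<close>

lemma strong_projections_imp_noniso:
  assumes sp: strong_projections and U: "irreducible U" "irreducible U'" and iso: "isomorphic U U'"
  shows "U = U'"
proof (rule ccontr)
  assume ne: "U \<noteq> U'"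
  have inv: "invariant U" "invariant U'" using U by (auto simp: irreducible_def)
  note U1 = invariantD[OF inv(1)] and U2 = invariantD[OF inv(2)]
  have int: "x = 0" if "x \<in> U" "x \<in> U'" for x
  proof (rule ccontr)
    assume "x \<noteq> 0"
    then have "U \<subseteq> U'" "U' \<subseteq> U"
      using irreducible_subset U inv that by blast+
    then show False using ne by blast
  qed
  obtain f where f: "bij_betw f U U'" and f1: "\<And>u v. u \<in> U \<Longrightarrow> v \<in> U \<Longrightarrow> f (u + v) = f u + f v"
    and f2: "\<And>c u. u \<in> U \<Longrightarrow> f (c *s u) = c *s f u"
    and f3: "\<And>g u. g \<in> carrier K \<Longrightarrow> u \<in> U \<Longrightarrow> f (act g u) = act g (f u)"
    using iso unfolding isomorphic_def by blast
  have fU: "f u \<in> U'" if "u \<in> U" for u using f that by (auto simp: bij_betw_def)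
  have f0: "f 0 = 0" using f2[of 0 0] U1(1) by simp
  define L where "L = (\<lambda>u. u + f u) ` U"
  have "subspace L" unfolding subspace_def
  proof (intro conjI ballI allI)
    show "0 \<in> L" using U1(1) f0 by (force simp: L_def)
  next
    fix x y assume "x \<in> L" "y \<in> L"
    then obtain a b where "a \<in> U" "b \<in> U" "x = a + f a" "y = b + f b" by (auto simp: L_def)
    then show "x + y \<in> L" unfolding L_def using U1 f1[of a b]
      by (intro image_eqI[of _ _ "a + b"]) (auto simp: algebra_simps)
  next
    fix c x assume "x \<in> L"
    then obtain a where "a \<in> U" "x = a + f a" by (auto simp: L_def)
    then show "c *s x \<in> L" unfolding L_def using U1 f2[of a c]
      by (intro image_eqI[of _ _ "c *s a"]) (auto simp: scale_right_distrib)
  qed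
  moreover have "act g x \<in> L" if "x \<in> L" "g \<in> carrier K" for g x
  proof -
    obtain a where "a \<in> U" "x = a + f a" using \<open>x \<in> L\<close> by (auto simp: L_def)
    then show ?thesis unfolding L_def using U1 U2 f3[of g a] that(2) fU[of a]
      by (intro image_eqI[of _ _ "act g a"]) (auto simp: act_add)
  qed
  moreover have "L \<subseteq> V" using U1 U2 fU subspace_add[OF subspace_V] by (auto simp: L_def)
  ultimately have L: "invariant L" by (auto simp: invariant_def)
  obtain Q where Q: "equivariant Q" "\<And>x. x \<in> V \<Longrightarrow> Q x \<in> U" "\<And>x. x \<in> U \<Longrightarrow> Q x = x"
    "\<And>L x. invariant L \<Longrightarrow> x \<in> L \<Longrightarrow> Q x \<in> L"
    using strong_projectionsE[OF sp inv(1)] by metis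
  obtain u where u: "u \<in> U" "u \<noteq> 0" using U U1(1) by (auto simp: irreducible_def)
  have "Q (f u) \<in> U" "Q (f u) \<in> U'" using Q(2) Q(4)[OF inv(2)] fU[OF u(1)] U2 by auto
  then have "Q (f u) = 0" using int by blast
  then have "Q (u + f u) = u" using Q(3)[OF u(1)] equivariantD(2)[OF Q(1)] u fU U1 U2 by simp
  moreover have "u + f u \<in> L" using u by (simp add: L_def)
  ultimately have "u \<in> L" using Q(4)[OF L, of "u + f u"] by simp
  then obtain a where a: "a \<in> U" "u = a + f a" by (auto simp: L_def)
  then have "f a = u - a" by (simp add: eq_diff_eq add.commute)
  then have "f a \<in> U" using U1(4)[OF u(1) a(1)] by (simp only:)
  then have "f a = 0" using int fU[OF a(1)] by blast
  then have "a = 0" using f f0 a(1) U1(1) unfolding bij_betw_def by (metis inj_on_def)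
  then show False using a u \<open>f a = 0\<close> by simp
qed

text \<open>Split off an irreducible subspace \<open>U\<close> and continue with the kernel of the projection onto it.\<close>

lemma exists_decomposition:
  assumes sp: strong_projections and "invariant N"
  shows "\<exists>S. finite S \<and> (\<forall>U\<in>S. irreducible U) \<and> (\<forall>x\<in>N. \<exists>f. (\<forall>U\<in>S. f U \<in> U) \<and> x = (\<Sum>U\<in>S. f U)) \<and> (\<forall>U\<in>S. U \<subseteq> N)"
  using assms(2)
proof (induction "dim N" arbitrary: N rule: less_induct)
  case less
  note N = invariantD[OF less.prems]
  show ?case
  proof (cases "N = {0}")
    case False
    then obtain U where U: "irreducible U" "U \<subseteq> N" using exists_irreducible less.prems by blast
    have Ui: "invariant U" using U by (simp add: irreducible_def)
    obtain Q where Q: "equivariant Q" "\<And>x. x \<in> V \<Longrightarrow> Q x \<in> U" "\<And>x. x \<in> U \<Longrightarrow> Q x = x"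
      using strong_projectionsE[OF sp Ui] by metis
    let ?L = "{x \<in> N. Q x = 0}"
    have L: "invariant ?L" by (rule invariant_kernel[OF Q(1) less.prems])
    have "?L \<noteq> N"
    proof
      assume "?L = N"
      then have "\<forall>x\<in>U. x = 0" using U Q(3) by force
      then show False using U(1) invariantD(1)[OF Ui] by (auto simp: irreducible_def)
    qed
    then have "dim ?L < dim N"
      using L less.prems by (intro dim_strict_mono) (auto simp: invariant_def)
    from less.hyps[OF this L] obtain S where S: "finite S" "\<forall>U\<in>S. irreducible U"
      "\<forall>x\<in>?L. \<exists>f. (\<forall>U\<in>S. f U \<in> U) \<and> x = (\<Sum>U\<in>S. f U)" "\<forall>U\<in>S. U \<subseteq> ?L" by blast
    have "U \<notin> S"
    proof
      assume "U \<in> S"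
      then have "\<forall>x\<in>U. x = 0" using S(4) Q(3) by force
      then show False using U(1) invariantD(1)[OF Ui] by (auto simp: irreducible_def)
    qed
    have "\<exists>f. (\<forall>U\<in>insert U S. f U \<in> U) \<and> x = (\<Sum>U\<in>insert U S. f U)" if x: "x \<in> N" for x
    proof -
      have QU: "Q x \<in> U" using Q(2) N(2)[OF x] .
      then have QN: "Q x \<in> N" using U by blast
      have "Q (x - Q x) = 0" using QU Q(3) equivariantD(6)[OF Q(1)] x N QN by simp
      then have "x - Q x \<in> ?L" using x QN N by simp
      then obtain f where f: "\<forall>U\<in>S. f U \<in> U" "x - Q x = (\<Sum>U\<in>S. f U)" using S(3) by blast
      let ?f = "f(U := Q x)"
      have "(\<Sum>V\<in>S. ?f V) = (\<Sum>V\<in>S. f V)" using \<open>U \<notin> S\<close> by (intro sum.cong) auto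
      then have "(\<Sum>V\<in>insert U S. ?f V) = Q x + (x - Q x)"
        using S(1) \<open>U \<notin> S\<close> f(2) by (simp del: fun_upd_apply, simp)
      then have "x = (\<Sum>V\<in>insert U S. ?f V)" by simp
      moreover have "\<forall>V\<in>insert U S. ?f V \<in> V" using f(1) QU by simp
      ultimately show ?thesis by (intro exI[of _ ?f] conjI)
    qed
    moreover have "\<forall>V\<in>insert U S. V \<subseteq> N" using S(4) U(2) by blast
    moreover have "finite (insert U S)" "\<forall>V\<in>insert U S. irreducible V" using S(1,2) U(1) by simp_all
    ultimately show ?thesis by (intro exI[of _ "insert U S"] conjI ballI) blast+
  next
    case True
    then show ?thesis by (intro exI[of _ "{}"]) simp
  qed
qed

text \<open>Uniqueness of the decomposition is seen by projecting to a single summand \<open>U\<close>: the image of any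
  other summand lies in both summands, hence is zero.\<close>

lemma strong_projections_imp_multiplicity_free:
  assumes sp: strong_projections
  shows "multiplicity_free K module_of act"
proof -
  obtain S where S: "finite S" "\<forall>U\<in>S. irreducible U"
    and dec: "\<forall>x\<in>V. \<exists>f. (\<forall>U\<in>S. f U \<in> U) \<and> x = (\<Sum>U\<in>S. f U)"
    using exists_decomposition[OF sp invariant_V] by (elim exE conjE)
  have inv: "invariant U" if "U \<in> S" for U using S(2) that by (simp add: irreducible_def)
  have "\<exists>!f. f \<in> (\<Pi>\<^sub>E U\<in>S. U) \<and> x = finsum module_of f S" if x: "x \<in> V" for x
  proof -
    have fs: "finsum module_of f S = (\<Sum>U\<in>S. f U)" if "f \<in> (\<Pi>\<^sub>E U\<in>S. U)" for f
      using that finsum_module_of[OF S(1)] invariantD(2)[OF inv] by (auto simp: PiE_iff)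
    obtain f where f: "\<forall>U\<in>S. f U \<in> U" "x = (\<Sum>U\<in>S. f U)" using bspec[OF dec x] by (elim exE conjE)
    show ?thesis
    proof (rule ex1I[of _ "restrict f S"])
      have "restrict f S \<in> (\<Pi>\<^sub>E U\<in>S. U)" using f by auto
      then show "restrict f S \<in> (\<Pi>\<^sub>E U\<in>S. U) \<and> x = finsum module_of (restrict f S) S"
        using fs f by auto
    next
      fix h assume h: "h \<in> (\<Pi>\<^sub>E U\<in>S. U) \<and> x = finsum module_of h S"
      then have hU: "\<And>U. U \<in> S \<Longrightarrow> h U \<in> U" and hs: "x = (\<Sum>U\<in>S. h U)" using fs by auto
      have "h U = f U" if U: "U \<in> S" for U
      proof -
        obtain Q where Q: "equivariant Q" "\<And>x. x \<in> V \<Longrightarrow> Q x \<in> U" "\<And>x. x \<in> U \<Longrightarrow> Q x = x"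
          "\<And>L x. invariant L \<Longrightarrow> x \<in> L \<Longrightarrow> Q x \<in> L"
          using strong_projectionsE[OF sp inv[OF U]] by metis
        have "Q x = k U" if k: "\<And>U. U \<in> S \<Longrightarrow> k U \<in> U" "x = (\<Sum>U\<in>S. k U)" for k
        proof -
          have "Q (k U') = 0" if U': "U' \<in> S" "U' \<noteq> U" for U'
          proof (rule ccontr)
            assume nz: "Q (k U') \<noteq> 0"
            have "Q (k U') \<in> U" "Q (k U') \<in> U'"
              using Q(2) Q(4)[OF inv] U' k(1) invariantD(2)[OF inv] by simp_all
            then have "U \<subseteq> U'" "U' \<subseteq> U"
              using irreducible_subset[OF _ inv _ _ nz] S(2) U U' by simp_all
            then show False using U' by blast
          qed
          moreover have "Q x = (\<Sum>U\<in>S. Q (k U))"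
            unfolding k(2) using k(1) invariantD(2)[OF inv] S(1) by (intro equivariant_sum[OF Q(1)]) auto
          ultimately show ?thesis using U S(1) Q(3) k(1) by (simp add: sum.remove[of S U])
        qed
        from this[of h, OF hU hs] this[of f, OF bspec[OF f(1)] f(2)] show "h U = f U" by metis
      qed
      moreover have "h \<in> extensional S" using h by (auto simp: PiE_iff)
      ultimately show "h = restrict f S" by (auto simp: extensional_def fun_eq_iff)
    qed
  qed
  then have "\<forall>x\<in>carrier module_of. \<exists>!f. f \<in> (\<Pi>\<^sub>E U\<in>S. U) \<and> x = finsum module_of f S"
    by (simp add: module_of_def)
  moreover have "\<forall>U\<in>S. \<forall>U'\<in>S. isomorphic U U' \<longrightarrow> U = U'"
    using strong_projections_imp_noniso[OF sp] S(2) by blast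
  ultimately show ?thesis unfolding multiplicity_free_def irreducible_iff isomorphic_iff
    using S by (intro exI[of _ S] conjI)
qed

end

section \<open>Isomorphisms of modules\<close>

definition equivariant_iso ::
  "('g, 'm) monoid_scheme \<Rightarrow> (complex, 'v) module \<Rightarrow> ('g \<Rightarrow> 'v \<Rightarrow> 'v)
     \<Rightarrow> (complex, 'w) module \<Rightarrow> ('g \<Rightarrow> 'w \<Rightarrow> 'w) \<Rightarrow> ('v \<Rightarrow> 'w) \<Rightarrow> bool" where
  "equivariant_iso K M act M' act' \<psi> \<longleftrightarrow>
     abelian_group M \<and> abelian_group M' \<and> bij_betw \<psi> (carrier M) (carrier M') \<and>
     (\<forall>x\<in>carrier M. \<forall>y\<in>carrier M. \<psi> (x \<oplus>\<^bsub>M\<^esub> y) = \<psi> x \<oplus>\<^bsub>M'\<^esub> \<psi> y) \<and>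
     (\<forall>c. \<forall>x\<in>carrier M. c \<odot>\<^bsub>M\<^esub> x \<in> carrier M \<and> \<psi> (c \<odot>\<^bsub>M\<^esub> x) = c \<odot>\<^bsub>M'\<^esub> \<psi> x) \<and>
     (\<forall>g\<in>carrier K. \<forall>x\<in>carrier M. act g x \<in> carrier M \<and> \<psi> (act g x) = act' g (\<psi> x))"

lemma equivariant_iso_inverse:
  assumes "equivariant_iso K M act M' act' \<psi>"
  shows "equivariant_iso K M' act' M act (inv_into (carrier M) \<psi>)"
proof -
  have bij: "bij_betw \<psi> (carrier M) (carrier M')" and "abelian_group M" "abelian_group M'"
    and add: "\<And>x y. x \<in> carrier M \<Longrightarrow> y \<in> carrier M \<Longrightarrow> \<psi> (x \<oplus>\<^bsub>M\<^esub> y) = \<psi> x \<oplus>\<^bsub>M'\<^esub> \<psi> y"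
    and scl: "\<And>c x. x \<in> carrier M \<Longrightarrow> c \<odot>\<^bsub>M\<^esub> x \<in> carrier M" "\<And>c x. x \<in> carrier M \<Longrightarrow> \<psi> (c \<odot>\<^bsub>M\<^esub> x) = c \<odot>\<^bsub>M'\<^esub> \<psi> x"
    and act: "\<And>g x. g \<in> carrier K \<Longrightarrow> x \<in> carrier M \<Longrightarrow> act g x \<in> carrier M"
      "\<And>g x. g \<in> carrier K \<Longrightarrow> x \<in> carrier M \<Longrightarrow> \<psi> (act g x) = act' g (\<psi> x)"
    using assms unfolding equivariant_iso_def by auto
  let ?r = "inv_into (carrier M) \<psi>"
  interpret M: abelian_group M by fact
  have r: "?r y \<in> carrier M" "\<psi> (?r y) = y" if "y \<in> carrier M'" for y
    using that bij by (auto simp: bij_betw_def f_inv_into_f inv_into_into)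
  have r': "?r (\<psi> x) = x" if "x \<in> carrier M" for x using that bij by (auto simp: bij_betw_def)
  have im: "\<psi> x \<in> carrier M'" if "x \<in> carrier M" for x using that bij by (auto simp: bij_betw_def)
  have 1: "?r (x \<oplus>\<^bsub>M'\<^esub> y) = ?r x \<oplus>\<^bsub>M\<^esub> ?r y" if "x \<in> carrier M'" "y \<in> carrier M'" for x y
    using r'[of "?r x \<oplus>\<^bsub>M\<^esub> ?r y"] r[OF that(1)] r[OF that(2)] add by simp
  have 2: "c \<odot>\<^bsub>M'\<^esub> x \<in> carrier M' \<and> ?r (c \<odot>\<^bsub>M'\<^esub> x) = c \<odot>\<^bsub>M\<^esub> ?r x" if "x \<in> carrier M'" for c x
    using r'[of "c \<odot>\<^bsub>M\<^esub> ?r x"] im[of "c \<odot>\<^bsub>M\<^esub> ?r x"] r[OF that] scl by simp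
  have 3: "act' g x \<in> carrier M' \<and> ?r (act' g x) = act g (?r x)" if "x \<in> carrier M'" "g \<in> carrier K" for g x
    using r'[of "act g (?r x)"] im[of "act g (?r x)"] r[OF that(1)] act that(2) by simp
  show ?thesis unfolding equivariant_iso_def
    using 1 2 3 bij_betw_inv_into[OF bij] \<open>abelian_group M\<close> \<open>abelian_group M'\<close> by blast
qed

lemma G_submodule_image:
  assumes iso: "equivariant_iso K M act M' act' \<psi>" and U: "G_submodule K M act U"
  shows "G_submodule K M' act' (\<psi> ` U)"
proof -
  interpret M: abelian_group M using iso by (simp add: equivariant_iso_def)
  interpret M': abelian_group M' using iso by (simp add: equivariant_iso_def)
  interpret \<psi>: group_hom "add_monoid M" "add_monoid M'" \<psi>
    using iso by unfold_locales (auto simp: equivariant_iso_def hom_def bij_betw_def)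
  interpret U: Module.submodule U complex_ring M using U by (simp add: G_submodule_def)
  have sub: "U \<subseteq> carrier M" using U.subset by simp
  have "subgroup (\<psi> ` U) (add_monoid M')"
    by (rule \<psi>.subgroup_img_is_subgroup) (rule U.subgroup_axioms)
  moreover have "Module.submodule_axioms (\<psi> ` U) complex_ring M'"
  proof (unfold submodule_axioms_def, intro allI impI)
    fix c x assume "x \<in> \<psi> ` U"
    then obtain u where u: "u \<in> U" "x = \<psi> u" by blast
    then have "c \<odot>\<^bsub>M'\<^esub> x = \<psi> (c \<odot>\<^bsub>M\<^esub> u)" using iso sub unfolding equivariant_iso_def by auto
    moreover have "c \<odot>\<^bsub>M\<^esub> u \<in> U" using u U.smult_closed by simp
    ultimately show "c \<odot>\<^bsub>M'\<^esub> x \<in> \<psi> ` U" by blast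
  qed
  moreover have "act' g (\<psi> u) \<in> \<psi> ` U" if "g \<in> carrier K" "u \<in> U" for g u
  proof -
    have "act' g (\<psi> u) = \<psi> (act g u)" using iso that sub unfolding equivariant_iso_def by auto
    moreover have "act g u \<in> U" using U that unfolding G_submodule_def by blast
    ultimately show ?thesis by blast
  qed
  ultimately show ?thesis unfolding G_submodule_def
    by (auto intro: Module.submodule.intro)
qed

lemma G_submodule_subset: "G_submodule K M act U \<Longrightarrow> U \<subseteq> carrier M"
  unfolding G_submodule_def Module.submodule_def subgroup_def by auto

lemma irreducible_submodule_image:
  assumes iso: "equivariant_iso K M act M' act' \<psi>" and U: "irreducible_submodule K M act U"
  shows "irreducible_submodule K M' act' (\<psi> ` U)"
proof -
  interpret M: abelian_group M using iso by (simp add: equivariant_iso_def)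
  interpret M': abelian_group M' using iso by (simp add: equivariant_iso_def)
  interpret \<psi>: group_hom "add_monoid M" "add_monoid M'" \<psi>
    using iso by unfold_locales (auto simp: equivariant_iso_def hom_def bij_betw_def)
  have inj: "inj_on \<psi> (carrier M)" using iso by (simp add: equivariant_iso_def bij_betw_def)
  have zero: "\<psi> \<zero>\<^bsub>M\<^esub> = \<zero>\<^bsub>M'\<^esub>" using \<psi>.hom_one by simp
  have sub: "U \<subseteq> carrier M" using U G_submodule_subset unfolding irreducible_submodule_def by blast
  let ?r = "inv_into (carrier M) \<psi>"
  have "\<psi> ` U \<noteq> {\<zero>\<^bsub>M'\<^esub>}"
  proof
    assume "\<psi> ` U = {\<zero>\<^bsub>M'\<^esub>}"
    then have "\<psi> ` U = \<psi> ` {\<zero>\<^bsub>M\<^esub>}" using zero by simp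
    then have "U = {\<zero>\<^bsub>M\<^esub>}" using inj_on_image_eq_iff[OF inj sub, of "{\<zero>\<^bsub>M\<^esub>}"] by simp
    then show False using U by (simp add: irreducible_submodule_def)
  qed
  moreover have "N = {\<zero>\<^bsub>M'\<^esub>} \<or> N = \<psi> ` U" if N: "G_submodule K M' act' N" "N \<subseteq> \<psi> ` U" for N
  proof -
    have "G_submodule K M act (?r ` N)" by (rule G_submodule_image[OF equivariant_iso_inverse[OF iso] N(1)])
    moreover have "?r ` N \<subseteq> U" using N(2) sub inj by (auto simp: subset_iff)
    ultimately have "?r ` N = {\<zero>\<^bsub>M\<^esub>} \<or> ?r ` N = U" using U unfolding irreducible_submodule_def by blast
    moreover have "\<psi> ` ?r ` N = N" using N(2) sub inj by (force simp: image_image subset_iff)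
    ultimately show ?thesis using zero by force
  qed
  ultimately show ?thesis using U G_submodule_image[OF iso, of U] unfolding irreducible_submodule_def by blast
qed

lemma isomorphic_submodules_image:
  assumes iso: "equivariant_iso K M act M' act' \<psi>"
    and U: "G_submodule K M act U" "G_submodule K M act U'"
    and i: "isomorphic_submodules K M' act' (\<psi> ` U) (\<psi> ` U')"
  shows "isomorphic_submodules K M act U U'"
proof -
  obtain f where f: "bij_betw f (\<psi> ` U) (\<psi> ` U')"
    and f1': "\<forall>u\<in>\<psi> ` U. \<forall>v\<in>\<psi> ` U. f (u \<oplus>\<^bsub>M'\<^esub> v) = f u \<oplus>\<^bsub>M'\<^esub> f v"
    and f2': "\<forall>c. \<forall>u\<in>\<psi> ` U. f (c \<odot>\<^bsub>M'\<^esub> u) = c \<odot>\<^bsub>M'\<^esub> f u"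
    and f3': "\<forall>g\<in>carrier K. \<forall>u\<in>\<psi> ` U. f (act' g u) = act' g (f u)"
    using i unfolding isomorphic_submodules_def by (elim exE conjE)
  note f1 = f1'[rule_format] and f2 = f2'[rule_format] and f3 = f3'[rule_format]
  let ?r = "inv_into (carrier M) \<psi>"
  have iso': "equivariant_iso K M' act' M act ?r" by (rule equivariant_iso_inverse[OF iso])
  have sub: "U \<subseteq> carrier M" "U' \<subseteq> carrier M" using U by (auto dest: G_submodule_subset)
  have inj: "inj_on \<psi> (carrier M)" using iso by (simp add: equivariant_iso_def bij_betw_def)
  have bij1: "bij_betw \<psi> U (\<psi> ` U)" using inj sub by (auto simp: bij_betw_def intro: inj_on_subset)
  have "inj_on ?r (\<psi> ` U')" using sub by (auto intro!: inj_on_inv_into)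
  moreover have "?r ` \<psi> ` U' = U'" using sub inj by (force simp: image_image subset_iff)
  ultimately have bij2: "bij_betw ?r (\<psi> ` U') U'" by (simp add: bij_betw_def)
  have bij: "bij_betw (?r \<circ> (f \<circ> \<psi>)) U U'"
    by (intro bij_betw_trans[OF bij_betw_trans[OF bij1 f] bij2])
  have fU: "f (\<psi> u) \<in> carrier M'" if "u \<in> U" for u
  proof -
    have "f (\<psi> u) \<in> \<psi> ` U'" using f that by (auto simp: bij_betw_def)
    then show ?thesis using sub iso by (auto simp: equivariant_iso_def bij_betw_def)
  qed
  note d = iso[unfolded equivariant_iso_def] and d' = iso'[unfolded equivariant_iso_def]
  show ?thesis unfolding isomorphic_submodules_def
  proof (intro exI[of _ "?r \<circ> (f \<circ> \<psi>)"] conjI ballI allI bij)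
    fix u v assume uv: "u \<in> U" "v \<in> U"
    then have "\<psi> (u \<oplus>\<^bsub>M\<^esub> v) = \<psi> u \<oplus>\<^bsub>M'\<^esub> \<psi> v" using d sub by blast
    then show "(?r \<circ> (f \<circ> \<psi>)) (u \<oplus>\<^bsub>M\<^esub> v) = (?r \<circ> (f \<circ> \<psi>)) u \<oplus>\<^bsub>M\<^esub> (?r \<circ> (f \<circ> \<psi>)) v"
      using f1[of "\<psi> u" "\<psi> v"] uv fU d' by simp
  next
    fix c u assume u: "u \<in> U"
    then have "\<psi> (c \<odot>\<^bsub>M\<^esub> u) = c \<odot>\<^bsub>M'\<^esub> \<psi> u" using d sub by blast
    then show "(?r \<circ> (f \<circ> \<psi>)) (c \<odot>\<^bsub>M\<^esub> u) = c \<odot>\<^bsub>M\<^esub> (?r \<circ> (f \<circ> \<psi>)) u"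
      using f2[of "\<psi> u" c] u fU d' by simp
  next
    fix g u assume u: "g \<in> carrier K" "u \<in> U"
    then have "\<psi> (act g u) = act' g (\<psi> u)" using d sub by blast
    then show "(?r \<circ> (f \<circ> \<psi>)) (act g u) = act g ((?r \<circ> (f \<circ> \<psi>)) u)"
      using f3[of g "\<psi> u"] u fU d' by simp
  qed
qed

lemma finsum_image:
  assumes iso: "equivariant_iso K M act M' act' \<psi>"
    and "finite S" "\<And>s. s \<in> S \<Longrightarrow> f s \<in> carrier M"
  shows "\<psi> (finsum M f S) = finsum M' (\<lambda>s. \<psi> (f s)) S"
proof -
  interpret M: abelian_group M using iso by (simp add: equivariant_iso_def)
  interpret M': abelian_group M' using iso by (simp add: equivariant_iso_def)
  interpret \<psi>: group_hom "add_monoid M" "add_monoid M'" \<psi>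
    using iso by unfold_locales (auto simp: equivariant_iso_def hom_def bij_betw_def)
  have zero: "\<psi> \<zero>\<^bsub>M\<^esub> = \<zero>\<^bsub>M'\<^esub>" using \<psi>.hom_one by simp
  have im: "\<psi> x \<in> carrier M'" if "x \<in> carrier M" for x
    using that iso by (auto simp: equivariant_iso_def bij_betw_def)
  show ?thesis using assms(2,3)
  proof (induction S)
    case (insert s S)
    have 1: "finsum M f (insert s S) = f s \<oplus>\<^bsub>M\<^esub> finsum M f S"
      using insert by (intro M.finsum_insert) auto
    have 2: "finsum M' (\<lambda>s. \<psi> (f s)) (insert s S) = \<psi> (f s) \<oplus>\<^bsub>M'\<^esub> finsum M' (\<lambda>s. \<psi> (f s)) S"
      using insert im by (intro M'.finsum_insert) auto
    have 3: "finsum M f S \<in> carrier M" using insert by (intro M.finsum_closed) auto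
    show ?case unfolding 1 2 using insert 3 iso by (simp add: equivariant_iso_def)
  qed (simp add: zero)
qed

text \<open>All the data of a decomposition are carried along \<open>\<psi>\<close>. The summands become the index set of the
  new decomposition, so the families of components have to be reindexed as well.\<close>

lemma multiplicity_free_transport:
  assumes iso: "equivariant_iso K M act M' act' \<psi>" and mf: "multiplicity_free K M act"
  shows "multiplicity_free K M' act'"
proof -
  interpret M: abelian_group M using iso by (simp add: equivariant_iso_def)
  interpret M': abelian_group M' using iso by (simp add: equivariant_iso_def)
  have inj: "inj_on \<psi> (carrier M)" and surj: "\<psi> ` carrier M = carrier M'"
    using iso by (auto simp: equivariant_iso_def bij_betw_def)
  obtain S where S: "finite S" "\<forall>U\<in>S. irreducible_submodule K M act U"
    and noniso: "\<forall>U\<in>S. \<forall>U'\<in>S. isomorphic_submodules K M act U U' \<longrightarrow> U = U'"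
    and dec: "\<forall>m\<in>carrier M. \<exists>!f. f \<in> (\<Pi>\<^sub>E U\<in>S. U) \<and> m = finsum M f S"
    using mf unfolding multiplicity_free_def by (elim exE conjE)
  have G: "G_submodule K M act U" if "U \<in> S" for U using S(2) that by (simp add: irreducible_submodule_def)
  have sub: "U \<subseteq> carrier M" if "U \<in> S" for U using G_submodule_subset[OF G[OF that]] .
  let ?S = "(`) \<psi> ` S"
  have injS: "inj_on ((`) \<psi>) S" using inj sub by (auto simp: inj_on_def inj_on_image_eq_iff[OF inj])
  have sums: "finsum M' h ?S = \<psi> (finsum M f S)"
    if "\<And>U. U \<in> S \<Longrightarrow> f U \<in> U" "\<And>U. U \<in> S \<Longrightarrow> h (\<psi> ` U) = \<psi> (f U)" for f h
  proof -
    have im: "\<psi> (f U) \<in> carrier M'" if "U \<in> S" for U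
      using \<open>\<And>U. U \<in> S \<Longrightarrow> f U \<in> U\<close>[OF that] sub[OF that] surj by blast
    have "finsum M' h ?S = finsum M' (\<lambda>U. h (\<psi> ` U)) S"
      using injS im that by (intro M'.finsum_reindex) auto
    also have "\<dots> = finsum M' (\<lambda>U. \<psi> (f U)) S"
      using that im by (intro M'.finsum_cong') auto
    also have "\<dots> = \<psi> (finsum M f S)"
      using finsum_image[OF iso S(1), of f] sub that by (metis subsetD)
    finally show ?thesis .
  qed
  have closed: "finsum M f S \<in> carrier M" if "\<And>U. U \<in> S \<Longrightarrow> f U \<in> U" for f
    using that sub by (intro M.finsum_closed) blast
  have "\<forall>m'\<in>carrier M'. \<exists>!h. h \<in> (\<Pi>\<^sub>E U\<in>?S. U) \<and> m' = finsum M' h ?S"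
  proof
    fix m' assume m': "m' \<in> carrier M'"
    obtain m where m: "m \<in> carrier M" "m' = \<psi> m" using m' surj by blast
    obtain f where f: "f \<in> (\<Pi>\<^sub>E U\<in>S. U)" "m = finsum M f S" and uniq: "\<And>f'. f' \<in> (\<Pi>\<^sub>E U\<in>S. U) \<Longrightarrow> m = finsum M f' S \<Longrightarrow> f' = f"
      using bspec[OF dec m(1)] by (metis (no_types, lifting))
    have fU: "f U \<in> U" if "U \<in> S" for U using f that by (auto simp: PiE_iff)
    define h where "h = restrict (\<lambda>W. \<psi> (f (inv_into S ((`) \<psi>) W))) ?S"
    have hU: "h (\<psi> ` U) = \<psi> (f U)" if "U \<in> S" for U
      using that inv_into_f_f[OF injS that] by (simp add: h_def)
    show "\<exists>!h. h \<in> (\<Pi>\<^sub>E U\<in>?S. U) \<and> m' = finsum M' h ?S"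
    proof (rule ex1I[of _ h])
      have "h \<in> (\<Pi>\<^sub>E U\<in>?S. U)"
      proof (rule PiE_I)
        fix W assume "W \<in> ?S"
        then obtain U where "U \<in> S" "W = \<psi> ` U" by blast
        then show "h W \<in> W" using hU fU by blast
      next
        fix W assume "W \<notin> ?S"
        then show "h W = undefined" by (simp only: h_def restrict_def if_False)
      qed
      then show "h \<in> (\<Pi>\<^sub>E U\<in>?S. U) \<and> m' = finsum M' h ?S"
        using sums[of f h, OF fU hU] f(2) m(2) by simp
    next
      fix k assume k: "k \<in> (\<Pi>\<^sub>E U\<in>?S. U) \<and> m' = finsum M' k ?S"
      have "\<forall>U\<in>S. \<exists>u. u \<in> U \<and> k (\<psi> ` U) = \<psi> u" using k by (auto simp: PiE_iff)
      from bchoice[OF this] obtain f'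
        where f': "\<And>U. U \<in> S \<Longrightarrow> f' U \<in> U" "\<And>U. U \<in> S \<Longrightarrow> k (\<psi> ` U) = \<psi> (f' U)" by blast
      have "\<psi> (finsum M f' S) = \<psi> m" using sums[of f' k, OF f'] k m(2) by simp
      then have "m = finsum M f' S" using inj m(1) closed[of f', OF f'(1)] by (metis inj_on_def)
      also have "\<dots> = finsum M (restrict f' S) S"
        using f' sub by (intro M.finsum_cong') (auto simp: subset_iff)
      finally have "restrict f' S = f" using f' by (intro uniq) auto
      then have "f' U = f U" if "U \<in> S" for U using that by (metis restrict_apply')
      then have "k (\<psi> ` U) = h (\<psi> ` U)" if "U \<in> S" for U using that f' hU by simp
      moreover have "h \<in> extensional ?S" "k \<in> extensional ?S" using k by (auto simp: h_def PiE_iff)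
      ultimately show "k = h" by (intro extensionalityI[of _ ?S]) auto
    qed
  qed
  moreover have "\<forall>U\<in>?S. irreducible_submodule K M' act' U"
    using S(2) irreducible_submodule_image[OF iso] by blast
  moreover have "\<forall>U\<in>?S. \<forall>U'\<in>?S. isomorphic_submodules K M' act' U U' \<longrightarrow> U = U'"
    using noniso isomorphic_submodules_image[OF iso G G] by blast
  moreover have "finite ?S" using S(1) by simp
  ultimately show ?thesis unfolding multiplicity_free_def
    by (intro exI[of _ ?S] conjI)
qed

lemma multiplicity_free_iso:
  assumes "equivariant_iso K M act M' act' \<psi>"
  shows "multiplicity_free K M act \<longleftrightarrow> multiplicity_free K M' act'"
  using multiplicity_free_transport assms equivariant_iso_inverse by metis

section \<open>Words and alternating functions\<close>

interpretation fs: vector_space "(\<lambda>c v x. c * v x) :: complex \<Rightarrow> ('x \<Rightarrow> complex) \<Rightarrow> 'x \<Rightarrow> complex"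
  by unfold_locales (auto simp: fun_eq_iff algebra_simps)

lemma sum_fun_apply: "(\<Sum>i\<in>S. F i) x = (\<Sum>i\<in>S. (F i x :: complex))"
  by (induction S rule: infinite_finite_induct) auto

definition words :: "'b set \<Rightarrow> nat \<Rightarrow> 'b list set" where
  "words B n = {w. set w \<subseteq> B \<and> length w = n}"

lemma finite_words: "finite B \<Longrightarrow> finite (words B n)"
  unfolding words_def by (rule finite_lists_length_eq)

text \<open>The matrix entry between two words of the tensor power of the operator with matrix \<open>m\<close>.\<close>

definition word_entry :: "('b \<Rightarrow> 'b \<Rightarrow> complex) \<Rightarrow> 'b list \<Rightarrow> 'b list \<Rightarrow> complex" where
  "word_entry m xs ys = (\<Prod>p<length xs. m (xs ! p) (ys ! p))"

lemma tensor_map_words: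
  "tensor_map B m t xs = (if set xs \<subseteq> B then \<Sum>ys\<in>words B (length xs). word_entry m xs ys * t ys else 0)"
  by (simp add: tensor_map_def words_def word_entry_def)

text \<open>By this adjointness the induced operators preserve the annihilator of a stable space of functions;
  it is also what makes the sum over monomials in the partial trace invariant.\<close>

lemma sum_words_adjoint:
  "(\<Sum>w\<in>words B n. f w * tensor_map B m t w) = (\<Sum>w\<in>words B n. tensor_map B (\<lambda>x y. m y x) f w * t w)"
proof -
  have "(\<Sum>w\<in>words B n. f w * tensor_map B m t w) = (\<Sum>w\<in>words B n. \<Sum>v\<in>words B n. f w * (word_entry m w v * t v))"
    by (intro sum.cong) (auto simp: tensor_map_words words_def sum_distrib_left)
  also have "\<dots> = (\<Sum>v\<in>words B n. \<Sum>w\<in>words B n. f w * (word_entry m w v * t v))" by (rule sum.swap)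
  also have "\<dots> = (\<Sum>v\<in>words B n. tensor_map B (\<lambda>x y. m y x) f v * t v)"
    by (intro sum.cong) (auto simp: tensor_map_words words_def word_entry_def sum_distrib_right intro!: sum.cong)
  finally show ?thesis .
qed

lemma word_entry_permute:
  assumes "\<pi> permutes {..<n}" "length xs = n" "length ys = n"
  shows "word_entry m (permute_list \<pi> xs) (permute_list \<pi> ys) = word_entry m xs ys"
proof -
  have "word_entry m (permute_list \<pi> xs) (permute_list \<pi> ys) = (\<Prod>p<n. m (xs ! \<pi> p) (ys ! \<pi> p))"
    unfolding word_entry_def using assms by (intro prod.cong) (auto simp: permute_list_nth)
  also have "\<dots> = (\<Prod>p<n. m (xs ! p) (ys ! p))"
    using prod.permute[OF assms(1), of "\<lambda>p. m (xs ! p) (ys ! p)"] by (simp add: o_def)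
  finally show ?thesis using assms by (simp add: word_entry_def)
qed

text \<open>Permuting the positions permutes the words of a given length. Together with \<open>word_entry_permute\<close>
  it shows that induced operators commute with permutations of the tensor factors, hence preserve
  alternating and symmetric functions.\<close>

lemma sum_words_permute:
  fixes g :: "'b list \<Rightarrow> complex"
  assumes "\<pi> permutes {..<n}"
  shows "(\<Sum>ys\<in>words B n. g (permute_list \<pi> ys)) = (\<Sum>ys\<in>words B n. g ys)"
proof -
  have inv: "inv_into UNIV \<pi> permutes {..<n}" using assms by (rule permutes_inv)
  show ?thesis
    by (rule sum.reindex_bij_witness[where i="permute_list (inv_into UNIV \<pi>)" and j="permute_list \<pi>"])
      (use assms inv in \<open>auto simp: words_def set_permute_list permute_list_compose[symmetric] permutes_inv_o\<close>)
qed

lemma permute_list_swap: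
  "permute_list (Transposition.transpose (length u) (Suc (length u))) (u @ x # y # v) = u @ y # x # v"
proof (rule nth_equalityI)
  let ?t = "Transposition.transpose (length u) (Suc (length u))"
  have t: "?t permutes {..<length (u @ x # y # v)}" by (rule permutes_swap_id) auto
  fix i assume "i < length (permute_list ?t (u @ x # y # v))"
  then have i: "i < length (u @ x # y # v)" by simp
  show "permute_list ?t (u @ x # y # v) ! i = (u @ y # x # v) ! i"
    using i unfolding permute_list_nth[OF t i]
    by (auto simp: nth_append Transposition.transpose_def nth_Cons' )
qed simp

text \<open>Skew symmetric tensors. Since adjacent transpositions generate the symmetric group, they
  suffice to express this without signs of permutations.\<close>

definition alternating :: "'b set \<Rightarrow> ('b list \<Rightarrow> complex) set" where
  "alternating B = {f. (\<forall>w. f w \<noteq> 0 \<longrightarrow> set w \<subseteq> B) \<and> (\<forall>u x y v. f (u @ x # y # v) = - f (u @ y # x # v))}"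

lemma alternatingD:
  assumes "f \<in> alternating B"
  shows "f w \<noteq> 0 \<Longrightarrow> set w \<subseteq> B" "f (u @ x # y # v) = - f (u @ y # x # v)"
  using assms unfolding alternating_def by blast+

text \<open>Move the two equal letters next to each other.\<close>

lemma alternating_repeat:
  assumes "f \<in> alternating B"
  shows "f (p @ x # u @ x # v) = 0"
proof (induction u arbitrary: p)
  case Nil
  show ?case using alternatingD(2)[OF assms, of p x x v] by simp
next
  case (Cons y u)
  have "f (p @ x # y # (u @ x # v)) = - f (p @ y # x # (u @ x # v))" by (rule alternatingD(2)[OF assms])
  also have "f (p @ y # x # (u @ x # v)) = 0" using Cons[of "p @ [y]"] by simp
  finally show ?case by simp
qed

definition distinct_words :: "'b set \<Rightarrow> 'b list set" where
  "distinct_words B = {w. set w \<subseteq> B \<and> distinct w}"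

lemma finite_distinct_words: "finite B \<Longrightarrow> finite (distinct_words B)"
  unfolding distinct_words_def by (rule finite_subset_distinct)

lemma alternating_support:
  assumes "f \<in> alternating B" "f w \<noteq> 0"
  shows "w \<in> distinct_words B"
proof -
  have "distinct w"
  proof (rule ccontr)
    assume "\<not> distinct w"
    then obtain p u v x where "w = p @ [x] @ u @ [x] @ v" using not_distinct_decomp by blast
    then show False using alternating_repeat[OF assms(1), of p x u v] assms(2) by simp
  qed
  then show ?thesis using alternatingD(1)[OF assms] by (simp add: distinct_words_def)
qed

lemma alternating_length:
  assumes "finite B" "f \<in> alternating B" "f w \<noteq> 0"
  shows "length w \<le> card B"
  using alternating_support[OF assms(2,3)] assms(1)
  by (auto simp: distinct_words_def distinct_card[symmetric] intro: card_mono)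

lemma subspace_alternating: "fs.subspace (alternating B)"
  unfolding fs.subspace_def
proof (intro conjI ballI allI)
  show "0 \<in> alternating B" by (simp add: alternating_def)
next
  fix f g :: "'a list \<Rightarrow> complex" assume "f \<in> alternating B" "g \<in> alternating B"
  note f = alternatingD[OF this(1)] and g = alternatingD[OF this(2)]
  have "set w \<subseteq> B" if "(f + g) w \<noteq> 0" for w using that f(1)[of w] g(1)[of w] by (cases "f w = 0") auto
  moreover have "(f + g) (u @ x # y # v) = - (f + g) (u @ y # x # v)" for u x y v
    using f(2)[of u x y v] g(2)[of u x y v] by simp
  ultimately show "f + g \<in> alternating B" unfolding alternating_def by blast
next
  fix c and f :: "'a list \<Rightarrow> complex" assume "f \<in> alternating B"
  note f = alternatingD[OF this]
  have "c * f (u @ x # y # v) = - (c * f (u @ y # x # v))" for u x y v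
    using f(2)[of u x y v] by simp
  moreover have "set w \<subseteq> B" if "c * f w \<noteq> 0" for w using that f(1)[of w] by simp
  ultimately show "(\<lambda>w. c * f w) \<in> alternating B" unfolding alternating_def mem_Collect_eq by blast
qed

definition delta :: "'b list \<Rightarrow> 'b list \<Rightarrow> complex" where
  "delta w = (\<lambda>x. if x = w then 1 else 0)"

lemma finite_sum_delta:
  assumes "finite S" "\<And>w. t w \<noteq> 0 \<Longrightarrow> w \<in> S"
  shows "t = (\<Sum>w\<in>S. (\<lambda>x. t w * delta w x))"
proof
  fix x
  have "(\<Sum>w\<in>S. t w * delta w x) = (\<Sum>w\<in>S. if x = w then t w else 0)"
    by (intro sum.cong) (auto simp: delta_def)
  also have "\<dots> = t x" using assms by (auto simp: sum.delta')
  finally show "t x = (\<Sum>w\<in>S. (\<lambda>x. t w * delta w x)) x" by (simp add: sum_fun_apply)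
qed

text \<open>A word without repeated letters has bounded length, so alternating functions on a finite set
  form a finite dimensional space.\<close>

lemma alternating_subset_span:
  assumes "finite B"
  shows "alternating B \<subseteq> fs.span (delta ` distinct_words B)"
proof
  fix f assume f: "f \<in> alternating B"
  have "f = (\<Sum>w\<in>distinct_words B. (\<lambda>x. f w * delta w x))"
    by (rule finite_sum_delta[OF finite_distinct_words[OF assms] alternating_support[OF f]])
  also have "\<dots> \<in> fs.span (delta ` distinct_words B)"
    by (intro fs.span_sum fs.span_scale fs.span_base) auto
  finally show "f \<in> fs.span (delta ` distinct_words B)" .
qed

lemma alternating_closed:
  assumes "finite B" "f \<in> alternating B"
  shows "f \<in> carrier (tensor_algebra B)"
proof -
  have "{w. f w \<noteq> 0} \<subseteq> distinct_words B" using alternating_support[OF assms(2)] by blast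
  then have "finite {w. f w \<noteq> 0}" using finite_distinct_words[OF assms(1)] finite_subset by blast
  then show ?thesis using alternatingD(1)[OF assms(2)] by (simp add: tensor_algebra_def)
qed

lemma alternating_swap:
  assumes f: "f \<in> alternating B" and k: "Suc k < length w"
  shows "f (permute_list (Transposition.transpose k (Suc k)) w) = - f w"
proof -
  have "w = take k w @ w ! k # w ! Suc k # drop (k + 2) w"
    using k by (simp add: id_take_nth_drop Cons_nth_drop_Suc)
  moreover have "length (take k w) = k" using k by simp
  ultimately show ?thesis using permute_list_swap[of "take k w"] alternatingD(2)[OF f] by metis
qed

lemma tensor_map_alternating:
  assumes f: "f \<in> alternating B"
  shows "tensor_map B m f \<in> alternating B"
proof -
  have "tensor_map B m f (u @ x # y # v) = - tensor_map B m f (u @ y # x # v)" for u x y v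
  proof (cases "set (u @ x # y # v) \<subseteq> B")
    case True
    let ?w = "u @ x # y # v" and ?w' = "u @ y # x # v"
    let ?t = "Transposition.transpose (length u) (Suc (length u))"
    have t: "?t permutes {..<length ?w}" by (rule permutes_swap_id) auto
    have sw: "f (permute_list ?t ys) = - f ys" if "ys \<in> words B (length ?w)" for ys
      using alternating_swap[OF f, of "length u" ys] that by (simp add: words_def)
    have "tensor_map B m f ?w' = (\<Sum>ys\<in>words B (length ?w). word_entry m ?w' ys * f ys)"
      using True by (simp add: tensor_map_words)
    also have "\<dots> = (\<Sum>ys\<in>words B (length ?w). word_entry m ?w' (permute_list ?t ys) * f (permute_list ?t ys))"
      using sum_words_permute[OF t, of "\<lambda>ys. word_entry m ?w' ys * f ys" B] by simp
    also have "\<dots> = (\<Sum>ys\<in>words B (length ?w). - (word_entry m ?w ys * f ys))"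
    proof (rule sum.cong[OF refl])
      fix ys assume ys: "ys \<in> words B (length ?w)"
      have "word_entry m ?w' (permute_list ?t ys) = word_entry m ?w ys"
        using word_entry_permute[OF t refl, of ys m] ys unfolding permute_list_swap by (simp add: words_def)
      then show "word_entry m ?w' (permute_list ?t ys) * f (permute_list ?t ys) = - (word_entry m ?w ys * f ys)"
        using sw[OF ys] by simp
    qed
    also have "\<dots> = - tensor_map B m f ?w" using True by (simp add: tensor_map_words sum_negf)
    finally show ?thesis by simp
  qed (auto simp: tensor_map_def)
  moreover have "set w \<subseteq> B" if "tensor_map B m f w \<noteq> 0" for w
    using that by (auto simp: tensor_map_def split: if_splits)
  ultimately show ?thesis unfolding alternating_def by blast
qed

lemma tensor_map_add: "tensor_map B m (f + g) = tensor_map B m f + tensor_map B m g"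
  by (auto simp: tensor_map_words fun_eq_iff sum.distrib algebra_simps)

lemma tensor_map_scale: "tensor_map B m (\<lambda>x. c * f x) = (\<lambda>x. c * tensor_map B m f x)"
  by (auto simp: tensor_map_words fun_eq_iff sum_distrib_left algebra_simps)

lemma tensor_map_closed:
  assumes "finite B" "t \<in> carrier (tensor_algebra B)"
  shows "tensor_map B m t \<in> carrier (tensor_algebra B)"
proof -
  let ?L = "length ` {w. t w \<noteq> 0}"
  have fin: "finite (\<Union>n\<in>?L. words B n)" using assms finite_words by (auto simp: tensor_algebra_def)
  have "w \<in> (\<Union>n\<in>?L. words B n)" if nz: "tensor_map B m t w \<noteq> 0" for w
  proof -
    have w: "set w \<subseteq> B" using nz by (auto simp: tensor_map_def split: if_splits)
    then have "(\<Sum>ys\<in>words B (length w). word_entry m w ys * t ys) \<noteq> 0" using nz by (simp add: tensor_map_words)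
    then obtain ys where "ys \<in> words B (length w)" "t ys \<noteq> 0" by (metis (no_types, lifting) mult_zero_right sum.neutral)
    then show ?thesis using w by (force simp: words_def)
  qed
  then have "{w. tensor_map B m t w \<noteq> 0} \<subseteq> (\<Union>n\<in>?L. words B n)" by blast
  then have "finite {w. tensor_map B m t w \<noteq> 0}" using fin finite_subset by blast
  then show ?thesis by (auto simp: tensor_algebra_def tensor_map_def split: if_splits)
qed

section \<open>The exterior algebra as a space of alternating functions\<close>

lemma tensor_algebra_add: "x \<oplus>\<^bsub>tensor_algebra B\<^esub> y = x + y"
  by (simp add: tensor_algebra_def plus_fun_def)

lemma tensor_algebra_zero: "\<zero>\<^bsub>tensor_algebra B\<^esub> = 0"
  by (simp add: tensor_algebra_def zero_fun_def)

text \<open>The bilinear pairing of tensors. Its first argument will be alternating, so the words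
  without repetition carry the whole sum, which is finite even though there are infinitely many words.\<close>

definition pairing :: "'b set \<Rightarrow> ('b list \<Rightarrow> complex) \<Rightarrow> ('b list \<Rightarrow> complex) \<Rightarrow> complex" where
  "pairing B f t = (\<Sum>w\<in>distinct_words B. f w * t w)"

lemma alternating_append_left: 
  assumes f: "f \<in> alternating B"
  shows "(\<lambda>v. f (u @ v)) \<in> alternating B"
proof -
  have "set v \<subseteq> B" if "f (u @ v) \<noteq> 0" for v using alternatingD(1)[OF f that] by simp
  moreover have "f (u @ p @ x # y # q) = - f (u @ p @ y # x # q)" for p x y q
    using alternatingD(2)[OF f, of "u @ p" x y q] by simp
  ultimately show ?thesis unfolding alternating_def mem_Collect_eq by blast
qed

lemma alternating_append_right: 
  assumes f: "f \<in> alternating B"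
  shows "(\<lambda>v. f (v @ u)) \<in> alternating B"
proof -
  have "set v \<subseteq> B" if "f (v @ u) \<noteq> 0" for v using alternatingD(1)[OF f that] by simp
  moreover have "f ((p @ x # y # q) @ u) = - f ((p @ y # x # q) @ u)" for p x y q
    using alternatingD(2)[OF f, of p x y "q @ u"] by simp
  ultimately show ?thesis unfolding alternating_def mem_Collect_eq by blast
qed

text \<open>The product sums over all ways of cutting a word into two pieces.\<close>

lemma pairing_mult:
  assumes B: "finite B" and f: "f \<in> alternating B"
  shows "pairing B f (s \<otimes>\<^bsub>tensor_algebra B\<^esub> t)
    = (\<Sum>u\<in>distinct_words B. \<Sum>v\<in>distinct_words B. f (u @ v) * (s u * t v))"
proof -
  let ?D = "distinct_words B"
  have fin: "finite ?D" by (rule finite_distinct_words[OF B])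
  let ?P = "{(u, v). u \<in> ?D \<and> v \<in> ?D \<and> u @ v \<in> ?D}"
  have "pairing B f (s \<otimes>\<^bsub>tensor_algebra B\<^esub> t)
     = (\<Sum>w\<in>?D. \<Sum>p\<le>length w. f w * (s (take p w) * t (drop p w)))"
    by (simp add: pairing_def tensor_algebra_def sum_distrib_left)
  also have "\<dots> = (\<Sum>(w, p)\<in>(SIGMA w:?D. {..length w}). f w * (s (take p w) * t (drop p w)))"
    using fin by (intro sum.Sigma) auto
  also have "\<dots> = (\<Sum>(u, v)\<in>?P. f (u @ v) * (s u * t v))"
    by (rule sum.reindex_bij_witness[where i="\<lambda>(u, v). (u @ v, length u)" and j="\<lambda>(w, p). (take p w, drop p w)"])
      (use set_take_disj_set_drop_if_distinct in \<open>auto simp: distinct_words_def dest: in_set_takeD in_set_dropD\<close>)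
  also have "\<dots> = (\<Sum>(u, v)\<in>?D \<times> ?D. f (u @ v) * (s u * t v))"
    using fin alternating_support[OF f] by (intro sum.mono_neutral_left) auto
  also have "\<dots> = (\<Sum>u\<in>?D. \<Sum>v\<in>?D. f (u @ v) * (s u * t v))" by (rule sum.cartesian_product[symmetric])
  finally show ?thesis .
qed

text \<open>This turns out to be the exterior ideal (\<open>exterior_ideal_eq_annihilator\<close>).\<close>

definition annihilator :: "'b set \<Rightarrow> ('b list \<Rightarrow> complex) set" where
  "annihilator B = {t \<in> carrier (tensor_algebra B). \<forall>f\<in>alternating B. pairing B f t = 0}"

lemma minus_tensor_algebra:
  assumes "t \<in> carrier (tensor_algebra B)"
  shows "\<ominus>\<^bsub>tensor_algebra B\<^esub> t = (\<lambda>w. - t w)" "(\<lambda>w. - t w) \<in> carrier (tensor_algebra B)"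
proof -
  interpret ring "tensor_algebra B" by (rule ring_tensor_algebra)
  show c: "(\<lambda>w. - t w) \<in> carrier (tensor_algebra B)" using assms by (simp add: tensor_algebra_def)
  show "\<ominus>\<^bsub>tensor_algebra B\<^esub> t = (\<lambda>w. - t w)"
    by (rule minus_equality) (use assms c in \<open>auto simp: tensor_algebra_def\<close>)
qed

text \<open>Fixing a prefix or a suffix of the argument of an alternating function leaves an alternating
  function, so \<open>pairing_mult\<close> expresses the pairing with a product through pairings with the factors.\<close>

lemma ideal_annihilator:
  assumes B: "finite B"
  shows "ideal (annihilator B) (tensor_algebra B)"
proof -
  interpret T: ring "tensor_algebra B" by (rule ring_tensor_algebra)
  show ?thesis
  proof (rule idealI[OF T.ring_axioms])
    show "subgroup (annihilator B) (add_monoid (tensor_algebra B))"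
    proof (rule T.add.subgroupI)
      show "annihilator B \<subseteq> carrier (tensor_algebra B)" by (auto simp: annihilator_def)
      have "\<zero>\<^bsub>tensor_algebra B\<^esub> \<in> annihilator B"
        by (simp add: annihilator_def) (simp add: pairing_def tensor_algebra_def)
      then show "annihilator B \<noteq> {}" by blast
    next
      fix a assume a: "a \<in> annihilator B"
      then have "\<ominus>\<^bsub>tensor_algebra B\<^esub> a = (\<lambda>w. - a w)" "(\<lambda>w. - a w) \<in> carrier (tensor_algebra B)"
        by (auto simp: annihilator_def minus_tensor_algebra)
      then show "\<ominus>\<^bsub>tensor_algebra B\<^esub> a \<in> annihilator B"
        using a by (simp add: annihilator_def pairing_def sum_negf)
    next
      fix a b assume "a \<in> annihilator B" "b \<in> annihilator B"
      moreover have "pairing B f (a \<oplus>\<^bsub>tensor_algebra B\<^esub> b) = pairing B f a + pairing B f b" for f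
        by (simp add: pairing_def tensor_algebra_def sum.distrib algebra_simps)
      ultimately show "a \<oplus>\<^bsub>tensor_algebra B\<^esub> b \<in> annihilator B" by (auto simp: annihilator_def)
    qed
  next
    fix a x assume a: "a \<in> annihilator B" and x: "x \<in> carrier (tensor_algebra B)"
    have "pairing B f (x \<otimes>\<^bsub>tensor_algebra B\<^esub> a) = 0" if f: "f \<in> alternating B" for f
    proof -
      have "pairing B f (x \<otimes>\<^bsub>tensor_algebra B\<^esub> a)
         = (\<Sum>u\<in>distinct_words B. x u * pairing B (\<lambda>v. f (u @ v)) a)"
        unfolding pairing_mult[OF B f] by (simp add: pairing_def sum_distrib_left mult_ac)
      also have "\<dots> = 0" using a alternating_append_left[OF f] by (simp add: annihilator_def)
      finally show ?thesis .
    qed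
    then show "x \<otimes>\<^bsub>tensor_algebra B\<^esub> a \<in> annihilator B" using a x by (auto simp: annihilator_def)
    have "pairing B f (a \<otimes>\<^bsub>tensor_algebra B\<^esub> x) = 0" if f: "f \<in> alternating B" for f
    proof -
      have "pairing B f (a \<otimes>\<^bsub>tensor_algebra B\<^esub> x)
         = (\<Sum>v\<in>distinct_words B. x v * pairing B (\<lambda>u. f (u @ v)) a)"
        unfolding pairing_mult[OF B f] by (subst sum.swap) (simp add: pairing_def sum_distrib_left mult_ac)
      also have "\<dots> = 0" using a alternating_append_right[OF f] by (simp add: annihilator_def)
      finally show ?thesis .
    qed
    then show "a \<otimes>\<^bsub>tensor_algebra B\<^esub> x \<in> annihilator B" using a x by (auto simp: annihilator_def)
  qed
qed

text \<open>The pairing of an alternating function with a square changes sign when the two factors are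
  exchanged.\<close>

lemma exterior_ideal_subset_annihilator:
  assumes B: "finite B"
  shows "exterior_ideal B \<subseteq> annihilator B"
proof -
  interpret T: ring "tensor_algebra B" by (rule ring_tensor_algebra)
  show ?thesis unfolding exterior_ideal_def
  proof (rule T.genideal_minimal[OF ideal_annihilator[OF B]], rule image_subsetI)
    fix v assume v: "v \<in> carrier (coord_space B)"
    let ?q = "degree_one v \<otimes>\<^bsub>tensor_algebra B\<^esub> degree_one v"
    have "pairing B f ?q = 0" if f: "f \<in> alternating B" for f
    proof -
      \<comment> \<open>this form makes the double sum visibly equal to its own negative\<close>
      have anti: "f (u @ w) * (degree_one v u * degree_one v w) = - (f (w @ u) * (degree_one v w * degree_one v u))" for u w
      proof (cases "\<exists>x y. u = [x] \<and> w = [y]")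
        case True
        then obtain x y where uw: "u = [x]" "w = [y]" by blast
        have "f [x, y] = - f [y, x]" using alternatingD(2)[OF f, of "[]" x y "[]"] by simp
        then show ?thesis unfolding uw by (simp add: degree_one_def)
      next
        case False
        then have "degree_one v u * degree_one v w = 0" by (auto simp: degree_one_def split: list.splits)
        then show ?thesis by auto
      qed
      have "pairing B f ?q = - pairing B f ?q"
        unfolding pairing_mult[OF B f]
        by (subst (2) sum.swap) (simp only: sum_negf[symmetric] anti[symmetric])
      then show ?thesis by simp
    qed
    then show "?q \<in> annihilator B" using degree_one_closed[OF B v] by (auto simp: annihilator_def)
  qed
qed

text \<open>Pair \<open>f\<close> with its complex conjugate, which is again alternating: this is the sum of the squares
  of the absolute values of \<open>f\<close>.\<close>

lemma alternating_Int_annihilator: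
  assumes B: "finite B" and f: "f \<in> alternating B" "f \<in> annihilator B"
  shows "f = 0"
proof -
  have "cnj (f (u @ x # y # v)) = - cnj (f (u @ y # x # v))" for u x y v
    unfolding alternatingD(2)[OF f(1), of u x y v] by simp
  moreover have "set w \<subseteq> B" if "cnj (f w) \<noteq> 0" for w using that alternatingD(1)[OF f(1)] by simp
  ultimately have "(\<lambda>w. cnj (f w)) \<in> alternating B" unfolding alternating_def mem_Collect_eq by blast
  then have "pairing B (\<lambda>w. cnj (f w)) f = 0" using f(2) by (simp add: annihilator_def)
  then have "(\<Sum>w\<in>distinct_words B. complex_of_real ((cmod (f w))\<^sup>2)) = 0"
    by (simp only: complex_norm_square pairing_def mult.commute)
  then have "(\<Sum>w\<in>distinct_words B. (cmod (f w))\<^sup>2) = 0"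
    by (simp only: of_real_sum[symmetric] of_real_eq_0_iff)
  then have "f w = 0" if "w \<in> distinct_words B" for w
    using that finite_distinct_words[OF B] by (simp add: sum_nonneg_eq_0_iff)
  then show ?thesis using alternating_support[OF f(1)] by (auto simp: fun_eq_iff)
qed

text \<open>Extend a basis of \<open>W\<close> by \<open>t\<close>.\<close>

lemma exists_separating_functional:
  assumes W: "fs.subspace W" and t: "t \<notin> W"
  shows "\<exists>F :: ('x \<Rightarrow> complex) \<Rightarrow> complex. (\<forall>x y. F (x + y) = F x + F y) \<and> (\<forall>c x. F (\<lambda>w. c * x w) = c * F x)
     \<and> (\<forall>x\<in>W. F x = 0) \<and> F t \<noteq> 0"
proof -
  interpret vector_space_pair "(\<lambda>c v x. c * v x) :: complex \<Rightarrow> ('x \<Rightarrow> complex) \<Rightarrow> 'x \<Rightarrow> complex" "(*) :: complex \<Rightarrow> complex \<Rightarrow> complex"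
    by unfold_locales (auto simp: algebra_simps)
  obtain b where b: "b \<subseteq> W" "fs.independent b" "W \<subseteq> fs.span b"
    using fs.maximal_independent_subset[of W] by blast
  have "fs.span b \<subseteq> W" using b(1) W by (rule fs.span_minimal)
  then have tb: "t \<notin> fs.span b" using t by blast
  then have "fs.independent (insert t b)" using b(2) by (rule fs.independent_insertI)
  from linear_independent_extend[OF this, of "\<lambda>x. if x = t then 1 else 0"]
  obtain g where g: "Vector_Spaces.linear (\<lambda>c v x. c * v x) (*) g" "\<forall>x\<in>insert t b. g x = (if x = t then 1 else 0)" by blast
  have tnb: "t \<notin> b" using tb fs.span_base by blast
  have "g x = 0" if "x \<in> W" for x
  proof (rule linear_eq_0_on_span[OF g(1)])
    show "g y = 0" if "y \<in> b" for y using g(2) that tnb by auto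
    show "x \<in> fs.span b" using that b(3) by blast
  qed
  moreover have "g (x + y) = g x + g y" "g (\<lambda>w. c * x w) = c * g x" for c x y
    using linear_add[OF g(1)] linear_scale[OF g(1)] by blast+
  ultimately show ?thesis using g(2) by (intro exI[of _ g]) auto
qed

lemma delta_closed: "set w \<subseteq> B \<Longrightarrow> delta w \<in> carrier (tensor_algebra B)"
  by (auto simp: tensor_algebra_def delta_def)

lemma delta_mult: "delta u \<otimes>\<^bsub>tensor_algebra B\<^esub> delta v = delta (u @ v)"
proof
  fix w
  have "(\<Sum>p\<le>length w. delta u (take p w) * delta v (drop p w))
      = (\<Sum>p\<le>length w. if p = length u then (if w = u @ v then 1 else 0) else 0)"
  proof (rule sum.cong[OF refl])
    fix p assume "p \<in> {..length w}"
    then have eq: "take p w = u \<and> drop p w = v \<longleftrightarrow> p = length u \<and> w = u @ v"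
      by (metis append_eq_conv_conj append_take_drop_id atMost_iff length_take min.absorb2)
    have "delta u (take p w) * delta v (drop p w) = (if take p w = u \<and> drop p w = v then 1 else 0)"
      by (simp add: delta_def)
    also have "\<dots> = (if p = length u then (if w = u @ v then 1 else 0) else 0)" unfolding eq by simp
    finally show "delta u (take p w) * delta v (drop p w) = (if p = length u then (if w = u @ v then 1 else 0) else 0)" .
  qed
  then show "(delta u \<otimes>\<^bsub>tensor_algebra B\<^esub> delta v) w = delta (u @ v) w"
    by (auto simp: tensor_algebra_def delta_def)
qed

text \<open>Polarisation: \<open>xy + yx = (x + y)\<^sup>2 - x\<^sup>2 - y\<^sup>2\<close>.\<close>

lemma exterior_ideal_swap:
  assumes B: "finite B" and w: "set (u @ x # y # v) \<subseteq> B"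
  shows "delta (u @ x # y # v) + delta (u @ y # x # v) \<in> exterior_ideal B"
proof -
  let ?T = "tensor_algebra B"
  interpret I: ideal "exterior_ideal B" ?T by (rule ideal_exterior_ideal[OF B])
  define e where "e x = (\<lambda>z. if z = x then 1 else 0 :: complex)" for x :: 'a
  have e: "e z \<in> carrier (coord_space B)" if "z \<in> B" for z using that by (auto simp: e_def coord_space_def)
  have exy: "(\<lambda>z. e x z + e y z) \<in> carrier (coord_space B)" using w by (auto simp: e_def coord_space_def)
  have de: "degree_one (e z) = delta [z]" for z
    by (auto simp: degree_one_def e_def delta_def fun_eq_iff split: list.splits)
  have dexy: "degree_one (\<lambda>z. e x z + e y z) = delta [x] \<oplus>\<^bsub>?T\<^esub> delta [y]"
    by (auto simp: degree_one_def e_def delta_def fun_eq_iff tensor_algebra_def split: list.splits)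
  have c: "delta [x] \<in> carrier ?T" "delta [y] \<in> carrier ?T" "delta u \<in> carrier ?T" "delta v \<in> carrier ?T"
    using w by (auto intro: delta_closed)
  have sq: "degree_one z \<otimes>\<^bsub>?T\<^esub> degree_one z \<in> exterior_ideal B" if "z \<in> carrier (coord_space B)" for z
    unfolding exterior_ideal_def
    by (rule subsetD[OF I.genideal_self]) (use that degree_one_closed[OF B] in auto)
  have "x \<in> B" "y \<in> B" using w by auto
  then have sx: "delta [x] \<otimes>\<^bsub>?T\<^esub> delta [x] \<in> exterior_ideal B" and sy: "delta [y] \<otimes>\<^bsub>?T\<^esub> delta [y] \<in> exterior_ideal B"
    and sxy: "(delta [x] \<oplus>\<^bsub>?T\<^esub> delta [y]) \<otimes>\<^bsub>?T\<^esub> (delta [x] \<oplus>\<^bsub>?T\<^esub> delta [y]) \<in> exterior_ideal B"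
    using sq[OF e] sq[OF exy] unfolding de dexy by blast+
  let ?z = "delta [x] \<otimes>\<^bsub>?T\<^esub> delta [y] \<oplus>\<^bsub>?T\<^esub> delta [y] \<otimes>\<^bsub>?T\<^esub> delta [x]"
  have "?z = (delta [x] \<oplus>\<^bsub>?T\<^esub> delta [y]) \<otimes>\<^bsub>?T\<^esub> (delta [x] \<oplus>\<^bsub>?T\<^esub> delta [y])
      \<ominus>\<^bsub>?T\<^esub> (delta [x] \<otimes>\<^bsub>?T\<^esub> delta [x] \<oplus>\<^bsub>?T\<^esub> delta [y] \<otimes>\<^bsub>?T\<^esub> delta [y])"
    using c by (simp add: a_minus_def minus_tensor_algebra)
      (auto simp: tensor_algebra_def fun_eq_iff sum.distrib algebra_simps)
  also have "\<dots> \<in> exterior_ideal B" using sx sy sxy I.a_closed I.a_inv_closed by (auto simp: a_minus_def)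
  finally have z: "?z \<in> exterior_ideal B" .
  have "delta u \<otimes>\<^bsub>?T\<^esub> (?z \<otimes>\<^bsub>?T\<^esub> delta v) \<in> exterior_ideal B"
    using z c I.I_l_closed I.I_r_closed by blast
  also have "delta u \<otimes>\<^bsub>?T\<^esub> (?z \<otimes>\<^bsub>?T\<^esub> delta v)
      = delta (u @ x # y # v) \<oplus>\<^bsub>?T\<^esub> delta (u @ y # x # v)"
  proof -
    have "set [x, y] \<subseteq> B" "set [y, x] \<subseteq> B" "set (x # y # v) \<subseteq> B" "set (y # x # v) \<subseteq> B" using w by auto
    then show ?thesis using c by (simp add: I.l_distr I.r_distr delta_mult delta_closed)
  qed
  also have "\<dots> = delta (u @ x # y # v) + delta (u @ y # x # v)" by (rule tensor_algebra_add)
  finally show ?thesis .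
qed

lemma exterior_ideal_scale:
  assumes B: "finite B" and t: "t \<in> exterior_ideal B"
  shows "(\<lambda>w. c * t w) \<in> exterior_ideal B"
proof -
  interpret I: ideal "exterior_ideal B" "tensor_algebra B" by (rule ideal_exterior_ideal[OF B])
  let ?c = "\<lambda>w. if w = [] then c else 0"
  have "?c \<in> carrier (tensor_algebra B)" by (auto simp: tensor_algebra_def)
  then have "?c \<otimes>\<^bsub>tensor_algebra B\<^esub> t \<in> exterior_ideal B" using t I.I_l_closed by blast
  also have "?c \<otimes>\<^bsub>tensor_algebra B\<^esub> t = (\<lambda>w. c * t w)"
  proof
    fix w
    have "(\<Sum>p\<le>length w. (if take p w = [] then c else 0) * t (drop p w))
        = (\<Sum>p\<in>{0}. (if take p w = [] then c else 0) * t (drop p w))"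
      by (rule sum.mono_neutral_right) auto
    then show "(?c \<otimes>\<^bsub>tensor_algebra B\<^esub> t) w = c * t w" by (simp add: tensor_algebra_def)
  qed
  finally show ?thesis .
qed

lemma subspace_exterior_ideal:
  assumes B: "finite B"
  shows "fs.subspace (exterior_ideal B)"
proof -
  interpret I: additive_subgroup "exterior_ideal B" "tensor_algebra B"
    by (rule ideal.axioms(1)[OF ideal_exterior_ideal[OF B]])
  have "0 \<in> exterior_ideal B" using I.zero_closed by (simp add: tensor_algebra_zero)
  moreover have "x + y \<in> exterior_ideal B" if "x \<in> exterior_ideal B" "y \<in> exterior_ideal B" for x y
    using I.a_closed[OF that] by (simp add: tensor_algebra_add)
  ultimately show ?thesis using exterior_ideal_scale[OF B] by (simp add: fs.subspace_def)
qed

text \<open>Otherwise some linear functional \<open>\<Lambda>\<close> vanishes on the exterior ideal and on all alternating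
  functions, but not on \<open>t\<close>. Its values \<open>F\<close> on words form an alternating function, because \<open>\<Lambda>\<close> kills
  the exterior ideal, and \<open>F\<close> pairs to zero with all alternating functions. Hence \<open>F = 0\<close> and
  \<open>\<Lambda> t = 0\<close>.\<close>

lemma tensor_decomposition:
  assumes B: "finite B" and t: "t \<in> carrier (tensor_algebra B)"
  shows "\<exists>f\<in>alternating B. \<exists>i\<in>exterior_ideal B. t = f + i"
proof (rule ccontr)
  assume neg: "\<not> ?thesis"
  define W where "W = {f + i |f i. f \<in> alternating B \<and> i \<in> exterior_ideal B}"
  have W: "fs.subspace W" unfolding W_def
    by (rule fs.subspace_sums[OF subspace_alternating subspace_exterior_ideal[OF B]])
  have "t \<notin> W" using neg by (auto simp: W_def)
  from exists_separating_functional[OF W this] obtain \<Lambda> where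
    add: "\<And>x y. \<Lambda> (x + y) = \<Lambda> x + \<Lambda> y" and scl: "\<And>c x. \<Lambda> (\<lambda>w. c * x w) = c * \<Lambda> x"
    and zero: "\<And>x. x \<in> W \<Longrightarrow> \<Lambda> x = 0" and nz: "\<Lambda> t \<noteq> 0" by blast
  have zero_alt: "\<Lambda> f = 0" if "f \<in> alternating B" for f
    using zero[of f] that fs.subspace_0[OF subspace_exterior_ideal[OF B]] unfolding W_def by force
  have zero_id: "\<Lambda> i = 0" if "i \<in> exterior_ideal B" for i
    using zero[of i] that fs.subspace_0[OF subspace_alternating] unfolding W_def by force
  have expand: "\<Lambda> (\<Sum>w\<in>S. (\<lambda>x. h w * delta w x)) = (\<Sum>w\<in>S. h w * \<Lambda> (delta w))" if "finite S" for S h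
    using that
  proof (induction S)
    case empty
    show ?case using add[of 0 0] by (simp only: sum.empty add_0_right add_cancel_right_right)
  next
    case (insert w S)
    show ?case by (simp only: sum.insert[OF insert.hyps] add scl insert.IH)
  qed
  define F where "F w = (if set w \<subseteq> B then \<Lambda> (delta w) else 0)" for w
  have "F (u @ x # y # v) = - F (u @ y # x # v)" for u x y v
  proof (cases "set (u @ x # y # v) \<subseteq> B")
    case True
    then show ?thesis using zero_id[OF exterior_ideal_swap[OF B True]]
      by (simp add: F_def add add_eq_0_iff2 insert_commute)
  qed (auto simp: F_def)
  then have Fsw: "\<And>u x y v. F (u @ x # y # v) = - F (u @ y # x # v)" by blast
  have "set w \<subseteq> B" if "F w \<noteq> 0" for w using that by (auto simp: F_def split: if_splits)
  then have F: "F \<in> alternating B" using Fsw unfolding alternating_def by blast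
  have "F \<in> annihilator B"
  proof -
    have "pairing B f F = 0" if f: "f \<in> alternating B" for f
    proof -
      have "f = (\<Sum>w\<in>distinct_words B. (\<lambda>x. f w * delta w x))"
        by (rule finite_sum_delta[OF finite_distinct_words[OF B] alternating_support[OF f]])
      then have "0 = \<Lambda> (\<Sum>w\<in>distinct_words B. (\<lambda>x. f w * delta w x))" using zero_alt[OF f] by simp
      also have "\<dots> = (\<Sum>w\<in>distinct_words B. f w * \<Lambda> (delta w))"
        by (rule expand[OF finite_distinct_words[OF B]])
      also have "\<dots> = pairing B f F" by (simp add: pairing_def F_def distinct_words_def)
      finally show ?thesis by simp
    qed
    then show ?thesis using alternating_closed[OF B F] by (simp add: annihilator_def)
  qed
  then have F0: "F = 0" by (rule alternating_Int_annihilator[OF B F])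
  let ?S = "{w. t w \<noteq> 0}"
  have S: "finite ?S" "\<And>w. w \<in> ?S \<Longrightarrow> set w \<subseteq> B" using t by (auto simp: tensor_algebra_def)
  have "t = (\<Sum>w\<in>?S. (\<lambda>x. t w * delta w x))" by (rule finite_sum_delta[OF S(1)]) simp
  then have "\<Lambda> t = (\<Sum>w\<in>?S. t w * \<Lambda> (delta w))" using expand[OF S(1), of t] by simp
  also have "\<dots> = (\<Sum>w\<in>?S. t w * F w)" using S(2) by (intro sum.cong) (auto simp: F_def)
  finally show False using nz F0 by simp
qed

lemma exterior_ideal_eq_annihilator:
  assumes B: "finite B"
  shows "exterior_ideal B = annihilator B"
proof
  show "exterior_ideal B \<subseteq> annihilator B" by (rule exterior_ideal_subset_annihilator[OF B])
  show "annihilator B \<subseteq> exterior_ideal B"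
  proof
    fix t assume t: "t \<in> annihilator B"
    then obtain f i where fi: "f \<in> alternating B" "i \<in> exterior_ideal B" "t = f + i"
      using tensor_decomposition[OF B, of t] by (auto simp: annihilator_def)
    have i: "i \<in> annihilator B" using fi exterior_ideal_subset_annihilator[OF B] by blast
    have "pairing B g f = pairing B g t - pairing B g i" for g
      by (simp add: fi(3) pairing_def sum_subtractf[symmetric] algebra_simps)
    then have "f \<in> annihilator B" using t i alternating_closed[OF B fi(1)] by (simp add: annihilator_def)
    then have "f = 0" by (rule alternating_Int_annihilator[OF B fi(1)])
    then show "t \<in> exterior_ideal B" using fi by simp
  qed
qed

lemma pairing_tensor_map:
  assumes B: "finite B" and f: "f \<in> alternating B"
  shows "pairing B f (tensor_map B m t) = pairing B (tensor_map B (\<lambda>x y. m y x) f) t"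
proof -
  let ?N = "card B"
  let ?W = "\<Union>n\<le>?N. words B n"
  have fin: "finite ?W" using finite_words[OF B] by blast
  have sub: "distinct_words B \<subseteq> ?W"
    using B by (auto simp: distinct_words_def words_def distinct_card[symmetric] intro: card_mono)
  have ext: "pairing B h s = (\<Sum>n\<le>?N. \<Sum>w\<in>words B n. h w * s w)" if "h \<in> alternating B" for h s
  proof -
    have "pairing B h s = (\<Sum>w\<in>?W. h w * s w)" unfolding pairing_def
      using fin sub alternating_support[OF that] by (intro sum.mono_neutral_left) auto
    also have "\<dots> = (\<Sum>n\<le>?N. \<Sum>w\<in>words B n. h w * s w)"
      by (rule sum.UNION_disjoint) (auto simp: finite_words[OF B], auto simp: words_def)
    finally show ?thesis .
  qed
  show ?thesis unfolding ext[OF f] ext[OF tensor_map_alternating[OF f]] sum_words_adjoint ..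
qed

lemma tensor_map_exterior_ideal:
  assumes B: "finite B" and i: "i \<in> exterior_ideal B"
  shows "tensor_map B m i \<in> exterior_ideal B"
proof -
  have i': "i \<in> carrier (tensor_algebra B)" "\<And>f. f \<in> alternating B \<Longrightarrow> pairing B f i = 0"
    using i unfolding exterior_ideal_eq_annihilator[OF B] annihilator_def by blast+
  have "pairing B f (tensor_map B m i) = 0" if f: "f \<in> alternating B" for f
    unfolding pairing_tensor_map[OF B f] by (rule i'(2)[OF tensor_map_alternating[OF f]])
  then show ?thesis using tensor_map_closed[OF B i'(1)]
    unfolding exterior_ideal_eq_annihilator[OF B] annihilator_def by blast
qed

text \<open>Both the scalar multiplication and the induced maps of the exterior algebra are defined by taking
  the image of a coset and adding the ideal.\<close>

lemma coset_image:
  assumes B: "finite B" and f: "f \<in> carrier (tensor_algebra B)"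
    and L: "\<And>i. i \<in> exterior_ideal B \<Longrightarrow> L i \<in> exterior_ideal B" "\<And>i. L (i + f) = L i + L f"
  shows "set_add (tensor_algebra B) (exterior_ideal B) (L ` (exterior_ideal B +>\<^bsub>tensor_algebra B\<^esub> f))
     = exterior_ideal B +>\<^bsub>tensor_algebra B\<^esub> (L f)"
proof -
  note S = subspace_exterior_ideal[OF B]
  have "i + L (j + f) \<in> {h + L f |h. h \<in> exterior_ideal B}" if "i \<in> exterior_ideal B" "j \<in> exterior_ideal B" for i j
  proof -
    have "i + L (j + f) = (i + L j) + L f" by (simp add: L(2))
    then show ?thesis using that L(1) fs.subspace_add[OF S] by blast
  qed
  moreover have "h + L f \<in> {i + L (j + f) |i j. i \<in> exterior_ideal B \<and> j \<in> exterior_ideal B}"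
    if "h \<in> exterior_ideal B" for h
    using that fs.subspace_0[OF S] by (intro CollectI exI[of _ h] exI[of _ 0]) simp
  ultimately show ?thesis
    unfolding set_add_def set_mult_def a_r_coset_def r_coset_def by (auto simp: tensor_algebra_add) blast+
qed


text \<open>Alternating functions are a system of representatives of the cosets of the exterior ideal, and it is
  stable under the operations.\<close>

lemma equivariant_iso_exterior_algebra:
  assumes B: "finite B" and rep: "group_rep (\<lambda>c v x. c * v x) K (alternating B) (\<lambda>g. tensor_map B (m g))"
  shows "equivariant_iso K (group_rep.module_of (\<lambda>c v x. c * v x) (alternating B)) (\<lambda>g. tensor_map B (m g))
     (exterior_algebra B) (\<lambda>g. exterior_map B (m g)) (\<lambda>f. exterior_ideal B +>\<^bsub>tensor_algebra B\<^esub> f)"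
proof -
  let ?T = "tensor_algebra B" and ?I = "exterior_ideal B"
  interpret I: ideal ?I ?T by (rule ideal_exterior_ideal[OF B])
  interpret R: group_rep "\<lambda>c v x. c * v x" K "alternating B" "\<lambda>g. tensor_map B (m g)" by (rule rep)
  interpret Q: ring "?T Quot ?I" by (rule I.quotient_is_ring)
  note S = subspace_exterior_ideal[OF B]
  have M: "carrier R.module_of = alternating B" "x \<oplus>\<^bsub>R.module_of\<^esub> y = x + y" "c \<odot>\<^bsub>R.module_of\<^esub> x = (\<lambda>w. c * x w)" for x y c
    by (simp_all add: R.module_of_def)
  have E: "carrier (exterior_algebra B) = a_rcosets\<^bsub>?T\<^esub> ?I"
    "C \<oplus>\<^bsub>exterior_algebra B\<^esub> D = set_add ?T C D"
    "c \<odot>\<^bsub>exterior_algebra B\<^esub> C = set_add ?T ?I ((\<lambda>t. c \<odot>\<^bsub>?T\<^esub> t) ` C)" for C D c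
    by (simp_all add: exterior_algebra_def FactRing_def ring.defs module.defs)
  have EQ: "carrier (exterior_algebra B) = carrier (?T Quot ?I)"
    "C \<oplus>\<^bsub>exterior_algebra B\<^esub> D = C \<oplus>\<^bsub>?T Quot ?I\<^esub> D"
    "\<zero>\<^bsub>exterior_algebra B\<^esub> = \<zero>\<^bsub>?T Quot ?I\<^esub>" for C D
    by (simp_all add: exterior_algebra_def ring.defs module.defs)
  have "abelian_group (exterior_algebra B)"
  proof (rule abelian_groupI, unfold EQ)
    show "\<exists>y\<in>carrier (?T Quot ?I). y \<oplus>\<^bsub>?T Quot ?I\<^esub> x = \<zero>\<^bsub>?T Quot ?I\<^esub>"
      if "x \<in> carrier (?T Quot ?I)" for x using Q.l_neg[OF that] Q.a_inv_closed[OF that] by blast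
  qed (rule Q.a_closed Q.zero_closed Q.a_assoc Q.a_comm Q.l_zero; assumption)+
  moreover have "bij_betw (\<lambda>f. ?I +>\<^bsub>?T\<^esub> f) (alternating B) (a_rcosets\<^bsub>?T\<^esub> ?I)"
    unfolding bij_betw_def
  proof
    show "inj_on (\<lambda>f. ?I +>\<^bsub>?T\<^esub> f) (alternating B)"
    proof (rule inj_onI)
      fix f g assume fg: "f \<in> alternating B" "g \<in> alternating B" "?I +>\<^bsub>?T\<^esub> f = ?I +>\<^bsub>?T\<^esub> g"
      then have "f \<in> ?I +>\<^bsub>?T\<^esub> g" using I.a_rcos_self[OF alternating_closed[OF B fg(1)]] by simp
      then obtain i where i: "i \<in> ?I" "f = i + g"
        by (auto simp: a_r_coset_def r_coset_def tensor_algebra_add)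
      have "f - g \<in> alternating B" by (rule fs.subspace_diff[OF subspace_alternating fg(1,2)])
      moreover have "f - g \<in> annihilator B"
        using i exterior_ideal_subset_annihilator[OF B] by auto
      ultimately have "f - g = 0" by (rule alternating_Int_annihilator[OF B])
      then show "f = g" by simp
    qed
    show "(\<lambda>f. ?I +>\<^bsub>?T\<^esub> f) ` alternating B = a_rcosets\<^bsub>?T\<^esub> ?I"
    proof
      show "(\<lambda>f. ?I +>\<^bsub>?T\<^esub> f) ` alternating B \<subseteq> a_rcosets\<^bsub>?T\<^esub> ?I"
        using alternating_closed[OF B] by (auto simp: A_RCOSETS_def')
      show "a_rcosets\<^bsub>?T\<^esub> ?I \<subseteq> (\<lambda>f. ?I +>\<^bsub>?T\<^esub> f) ` alternating B"
      proof
        fix C assume "C \<in> a_rcosets\<^bsub>?T\<^esub> ?I"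
        then obtain t where t: "t \<in> carrier ?T" "C = ?I +>\<^bsub>?T\<^esub> t" by (auto simp: A_RCOSETS_def')
        obtain f i where fi: "f \<in> alternating B" "i \<in> ?I" "t = f + i" using tensor_decomposition[OF B t(1)] by blast
        have "t \<in> ?I +>\<^bsub>?T\<^esub> f"
          using fi by (auto simp: a_r_coset_def r_coset_def tensor_algebra_add add.commute)
        then have "?I +>\<^bsub>?T\<^esub> f = C"
          unfolding t(2) by (rule I.a_repr_independence[OF _ alternating_closed[OF B fi(1)] I.a_subgroup])
        then show "C \<in> (\<lambda>f. ?I +>\<^bsub>?T\<^esub> f) ` alternating B" using fi by blast
      qed
    qed
  qed
  moreover have "set_add ?T (?I +>\<^bsub>?T\<^esub> f) (?I +>\<^bsub>?T\<^esub> g) = ?I +>\<^bsub>?T\<^esub> (f + g)"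
    if "f \<in> alternating B" "g \<in> alternating B" for f g
    using I.a_rcos_sum[OF alternating_closed[OF B that(1)] alternating_closed[OF B that(2)]]
    by (simp add: tensor_algebra_add)
  moreover have "set_add ?T ?I ((\<lambda>t. c \<odot>\<^bsub>?T\<^esub> t) ` (?I +>\<^bsub>?T\<^esub> f)) = ?I +>\<^bsub>?T\<^esub> (\<lambda>w. c * f w)"
    if "f \<in> alternating B" for c f
  proof -
    have smult: "c \<odot>\<^bsub>?T\<^esub> t = (\<lambda>w. c * t w)" for t by (simp add: tensor_algebra_def)
    show ?thesis unfolding smult
      by (rule coset_image[where L="\<lambda>t w. c * t w", OF B alternating_closed[OF B that] exterior_ideal_scale[OF B]])
        (simp_all add: fun_eq_iff distrib_left)
  qed
  moreover have "exterior_map B (m g) (?I +>\<^bsub>?T\<^esub> f) = ?I +>\<^bsub>?T\<^esub> tensor_map B (m g) f"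
    if "f \<in> alternating B" for g f
    unfolding exterior_map_def
    by (rule coset_image[where L="tensor_map B (m g)", OF B alternating_closed[OF B that]
          tensor_map_exterior_ideal[OF B] tensor_map_add])
  moreover have "(\<lambda>w. c * f w) \<in> alternating B" if "f \<in> alternating B" for c f
    using fs.subspace_scale[OF subspace_alternating that] .
  moreover have "tensor_map B (m g) f \<in> alternating B" if "f \<in> alternating B" for g f
    by (rule tensor_map_alternating[OF that])
  ultimately show ?thesis
    unfolding equivariant_iso_def M E using R.abelian_group_module_of by blast
qed

lemma group_rep_alternating:
  assumes "finite B"
  shows "group_rep (\<lambda>c v x. c * v x) K (alternating B) (\<lambda>g. tensor_map B (m g))"
proof
  show "fs.subspace (alternating B)" by (rule subspace_alternating)
  show "\<exists>T. finite T \<and> alternating B \<subseteq> fs.span T"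
    using alternating_subset_span[OF assms] finite_distinct_words[OF assms] by blast
qed (rule tensor_map_alternating tensor_map_add tensor_map_scale, assumption?)+

theorem skew_multiplicity_free_iff_strong_projections:
  assumes "finite B"
  shows "skew_multiplicity_free K B m \<longleftrightarrow>
     group_rep.strong_projections (\<lambda>c v x. c * v x) K (alternating B) (\<lambda>g. tensor_map B (m g))"
proof -
  interpret R: group_rep "\<lambda>c v x. c * v x" K "alternating B" "\<lambda>g. tensor_map B (m g)"
    by (rule group_rep_alternating[OF assms])
  show ?thesis
    unfolding skew_multiplicity_free_def
    using multiplicity_free_iso[OF equivariant_iso_exterior_algebra[OF assms R.group_rep_axioms]]
      R.multiplicity_free_imp_strong_projections R.strong_projections_imp_multiplicity_free
    by blast
qed

section \<open>Symmetric functions on words\<close>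

lemma word_entry_Cons: "word_entry m (x # xs) (y # ys) = m x y * word_entry m xs ys"
  by (simp add: word_entry_def prod.lessThan_Suc_shift del: prod.lessThan_Suc)

lemma word_entry_eq_0: "p < length xs \<Longrightarrow> m (xs ! p) (ys ! p) = 0 \<Longrightarrow> word_entry m xs ys = 0"
  unfolding word_entry_def by (rule prod_zero) auto

lemma word_entry_transpose: "length xs = length ys \<Longrightarrow> word_entry (\<lambda>x y. m y x) xs ys = word_entry m ys xs"
  by (simp add: word_entry_def)

lemma sum_words_Suc:
  assumes "finite A"
  shows "(\<Sum>w\<in>words A (Suc n). g w) = (\<Sum>y\<in>A. \<Sum>w\<in>words A n. (g (y # w) :: complex))"
proof -
  have "(\<Sum>w\<in>words A (Suc n). g w) = (\<Sum>(y, w)\<in>A \<times> words A n. g (y # w))"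
    by (rule sum.reindex_bij_witness[where i="\<lambda>(y, w). y # w" and j="\<lambda>w. (hd w, tl w)"])
      (auto simp: words_def length_Suc_conv)
  then show ?thesis by (simp add: sum.cartesian_product)
qed

text \<open>Tensor powers are multiplicative.\<close>

lemma word_entry_inverse:
  assumes A: "finite A" and inv: "\<And>x z. x \<in> A \<Longrightarrow> z \<in> A \<Longrightarrow> (\<Sum>y\<in>A. u x y * v y z) = (if x = z then 1 else 0)"
    and "a \<in> words A n" "c \<in> words A n"
  shows "(\<Sum>b\<in>words A n. word_entry u a b * word_entry v b c) = (if a = c then 1 else 0)"
  using assms(3,4)
proof (induction n arbitrary: a c)
  case 0
  have "words A 0 = {[]}" by (auto simp: words_def)
  then show ?case using 0 by (simp add: word_entry_def)
next
  case (Suc n)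
  obtain x a' where a: "a = x # a'" "x \<in> A" "a' \<in> words A n" using Suc.prems by (auto simp: words_def length_Suc_conv)
  obtain z c' where c: "c = z # c'" "z \<in> A" "c' \<in> words A n" using Suc.prems by (auto simp: words_def length_Suc_conv)
  have "(\<Sum>b\<in>words A (Suc n). word_entry u a b * word_entry v b c)
      = (\<Sum>y\<in>A. \<Sum>b\<in>words A n. (u x y * v y z) * (word_entry u a' b * word_entry v b c'))"
    unfolding sum_words_Suc[OF A] a c by (simp add: word_entry_Cons mult_ac)
  also have "\<dots> = (\<Sum>y\<in>A. u x y * v y z) * (\<Sum>b\<in>words A n. word_entry u a' b * word_entry v b c')"
    by (rule sum_product[symmetric])
  also have "\<dots> = (if a = c then 1 else 0)" unfolding inv[OF a(2) c(2)] Suc.IH[OF a(3) c(3)] using a c by simp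
  finally show ?case .
qed

lemma tensor_map_inverse:
  assumes A: "finite A" and inv: "\<And>x z. x \<in> A \<Longrightarrow> z \<in> A \<Longrightarrow> (\<Sum>y\<in>A. u x y * v y z) = (if x = z then 1 else 0)"
    and s: "\<And>a. s a \<noteq> 0 \<Longrightarrow> set a \<subseteq> A"
  shows "tensor_map A u (tensor_map A v s) = s"
proof
  fix a
  show "tensor_map A u (tensor_map A v s) a = s a"
  proof (cases "set a \<subseteq> A")
    case True
    let ?W = "words A (length a)"
    have a: "a \<in> ?W" using True by (simp add: words_def)
    have "tensor_map A u (tensor_map A v s) a = (\<Sum>b\<in>?W. word_entry u a b * (\<Sum>c\<in>?W. word_entry v b c * s c))"
      using True by (auto simp: tensor_map_words words_def intro!: sum.cong)
    also have "\<dots> = (\<Sum>b\<in>?W. \<Sum>c\<in>?W. (word_entry u a b * word_entry v b c) * s c)"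
      by (simp add: sum_distrib_left mult_ac)
    also have "\<dots> = (\<Sum>c\<in>?W. \<Sum>b\<in>?W. (word_entry u a b * word_entry v b c) * s c)" by (rule sum.swap)
    also have "\<dots> = (\<Sum>c\<in>?W. if a = c then s c else 0)"
    proof (rule sum.cong[OF refl])
      fix c assume "c \<in> ?W"
      from word_entry_inverse[OF A inv a this]
      show "(\<Sum>b\<in>?W. (word_entry u a b * word_entry v b c) * s c) = (if a = c then s c else 0)"
        by (simp add: sum_distrib_right[symmetric])
    qed
    also have "\<dots> = s a" using a finite_words[OF A] by simp
    finally show ?thesis .
  qed (use s in \<open>auto simp: tensor_map_def\<close>)
qed

lemma linear_combination:
  assumes V: "fs.subspace V"
    and add: "\<And>x y. x \<in> V \<Longrightarrow> y \<in> V \<Longrightarrow> L (x + y) = L x + L y"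
    and scl: "\<And>c x. x \<in> V \<Longrightarrow> L (\<lambda>a. c * x a) = (\<lambda>v. c * L x v :: complex)"
    and "finite S" "\<And>\<beta>. \<beta> \<in> S \<Longrightarrow> x \<beta> \<in> V"
  shows "L (\<Sum>\<beta>\<in>S. (\<lambda>a. c \<beta> * x \<beta> a)) = (\<Sum>\<beta>\<in>S. (\<lambda>v. c \<beta> * L (x \<beta>) v))"
  using assms(4,5)
proof (induction S)
  case empty
  have "L 0 = 0" using add[of 0 0] fs.subspace_0[OF V] by (simp only: add_0_right add_cancel_right_right)
  then show ?case by (simp only: sum.empty)
next
  case (insert b S)
  have "(\<Sum>\<beta>\<in>S. (\<lambda>a. c \<beta> * x \<beta> a)) \<in> V" "(\<lambda>a. c b * x b a) \<in> V"
    using insert.prems fs.subspace_scale[OF V] by (auto intro!: fs.subspace_sum[OF V])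
  then show ?case using insert.IH insert.prems
    by (simp only: sum.insert[OF insert.hyps] add scl insertI1 insertI2)
qed

text \<open>For the coordinate space \<open>X\<close> with basis \<open>A\<close> this is a copy of the symmetric algebra of \<open>X\<close>, truncated at degree \<open>D\<close>
  to keep it finite dimensional.\<close>

definition symmetric_functions :: "'a set \<Rightarrow> nat \<Rightarrow> ('a list \<Rightarrow> complex) set" where
  "symmetric_functions A D = {s. (\<forall>a. s a \<noteq> 0 \<longrightarrow> set a \<subseteq> A \<and> length a \<le> D) \<and> (\<forall>a b. mset a = mset b \<longrightarrow> s a = s b)}"

lemma symmetricD:
  assumes "s \<in> symmetric_functions A D"
  shows "s a \<noteq> 0 \<Longrightarrow> set a \<subseteq> A" "s a \<noteq> 0 \<Longrightarrow> length a \<le> D" "mset a = mset b \<Longrightarrow> s a = s b"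
  using assms unfolding symmetric_functions_def by blast+

lemma subspace_symmetric: "fs.subspace (symmetric_functions A D)"
  unfolding fs.subspace_def
proof (intro conjI ballI allI)
  show "0 \<in> symmetric_functions A D" by (simp add: symmetric_functions_def)
next
  fix f g :: "'a list \<Rightarrow> complex" assume f: "f \<in> symmetric_functions A D" and g: "g \<in> symmetric_functions A D"
  have "set a \<subseteq> A \<and> length a \<le> D" if "(f + g) a \<noteq> 0" for a
    using that symmetricD(1,2)[OF f, of a] symmetricD(1,2)[OF g, of a] by (cases "f a = 0") auto
  moreover have "(f + g) a = (f + g) b" if "mset a = mset b" for a b
    using symmetricD(3)[OF f that] symmetricD(3)[OF g that] by simp
  ultimately show "f + g \<in> symmetric_functions A D" unfolding symmetric_functions_def by blast
next
  fix c and f :: "'a list \<Rightarrow> complex" assume f: "f \<in> symmetric_functions A D"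
  have "set a \<subseteq> A \<and> length a \<le> D" if "c * f a \<noteq> 0" for a
    using that symmetricD(1,2)[OF f, of a] by auto
  moreover have "c * f a = c * f b" if "mset a = mset b" for a b
    using symmetricD(3)[OF f that] by simp
  ultimately show "(\<lambda>a. c * f a) \<in> symmetric_functions A D" unfolding symmetric_functions_def mem_Collect_eq by blast
qed

lemma tensor_map_symmetric:
  assumes s: "s \<in> symmetric_functions A D"
  shows "tensor_map A u s \<in> symmetric_functions A D"
proof -
  have "set a \<subseteq> A \<and> length a \<le> D" if nz: "tensor_map A u s a \<noteq> 0" for a
  proof -
    have a: "set a \<subseteq> A" using nz by (auto simp: tensor_map_def split: if_splits)
    then have "(\<Sum>b\<in>words A (length a). word_entry u a b * s b) \<noteq> 0" using nz by (simp add: tensor_map_words)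
    then obtain b where "b \<in> words A (length a)" "s b \<noteq> 0" by (metis (no_types, lifting) mult_zero_right sum.neutral)
    then show ?thesis using a symmetricD(2)[OF s, of b] by (auto simp: words_def)
  qed
  moreover have "tensor_map A u s a = tensor_map A u s b" if ab: "mset a = mset b" for a b
  proof -
    obtain \<pi> where \<pi>: "\<pi> permutes {..<length b}" "permute_list \<pi> b = a"
      using mset_eq_permutation[OF ab] by blast
    have len: "length a = length b" and set: "set a = set b" using ab mset_eq_length mset_eq_setD by blast+
    have "(\<Sum>c\<in>words A (length b). word_entry u a c * s c)
        = (\<Sum>c\<in>words A (length b). word_entry u a (permute_list \<pi> c) * s (permute_list \<pi> c))"
      by (rule sum_words_permute[OF \<pi>(1), symmetric])
    also have "\<dots> = (\<Sum>c\<in>words A (length b). word_entry u b c * s c)"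
    proof (rule sum.cong[OF refl])
      fix c assume c: "c \<in> words A (length b)"
      then have "mset (permute_list \<pi> c) = mset c" using \<pi>(1) by (simp add: words_def)
      then have "s (permute_list \<pi> c) = s c" by (rule symmetricD(3)[OF s])
      moreover have "word_entry u a (permute_list \<pi> c) = word_entry u b c"
        using word_entry_permute[OF \<pi>(1), of b c u] c \<pi>(2) by (simp add: words_def)
      ultimately show "word_entry u a (permute_list \<pi> c) * s (permute_list \<pi> c) = word_entry u b c * s c" by simp
    qed
    finally show ?thesis by (simp add: tensor_map_words len set)
  qed
  ultimately show ?thesis unfolding symmetric_functions_def by blast
qed

definition short_words :: "'a set \<Rightarrow> nat \<Rightarrow> 'a list set" where
  "short_words A D = (\<Union>n\<le>D. words A n)"

lemma mem_short_words: "a \<in> short_words A D \<longleftrightarrow> set a \<subseteq> A \<and> length a \<le> D"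
  by (auto simp: short_words_def words_def)

lemma finite_short_words: "finite A \<Longrightarrow> finite (short_words A D)"
  unfolding short_words_def using finite_words by blast

definition word_pairing :: "'a set \<Rightarrow> nat \<Rightarrow> ('a list \<Rightarrow> complex) \<Rightarrow> ('a list \<Rightarrow> complex) \<Rightarrow> complex" where
  "word_pairing A D s t = (\<Sum>a\<in>short_words A D. s a * t a)"

lemma word_pairing_commute: "word_pairing A D s t = word_pairing A D t s"
  by (simp add: word_pairing_def mult.commute)

lemma word_pairing_tensor_map:
  assumes A: "finite A"
  shows "word_pairing A D s (tensor_map A u t) = word_pairing A D (tensor_map A (\<lambda>x y. u y x) s) t"
proof -
  have ext: "word_pairing A D s t = (\<Sum>n\<le>D. \<Sum>w\<in>words A n. s w * t w)" for s t
    unfolding word_pairing_def short_words_def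
    by (rule sum.UNION_disjoint) (auto simp: finite_words[OF A], auto simp: words_def)
  show ?thesis unfolding ext sum_words_adjoint ..
qed

text \<open>The monomials form an orthogonal basis of the symmetric functions for \<open>word_pairing\<close>; their squared
  lengths \<open>weight\<close> are the multinomial coefficients. Their exponents are multisets, collected in
  \<open>contents\<close>.\<close>

definition monomial :: "'a set \<Rightarrow> 'a multiset \<Rightarrow> 'a list \<Rightarrow> complex" where
  "monomial A \<alpha> = (\<lambda>a. if set a \<subseteq> A \<and> mset a = \<alpha> then 1 else 0)"

definition contents :: "'a set \<Rightarrow> nat \<Rightarrow> 'a multiset set" where
  "contents A D = mset ` short_words A D"

definition weight :: "'a set \<Rightarrow> nat \<Rightarrow> 'a multiset \<Rightarrow> complex" where
  "weight A D \<alpha> = word_pairing A D (monomial A \<alpha>) (monomial A \<alpha>)"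

lemma finite_contents: "finite A \<Longrightarrow> finite (contents A D)"
  by (simp add: contents_def finite_short_words)

lemma monomial_symmetric:
  assumes "\<alpha> \<in> contents A D"
  shows "monomial A \<alpha> \<in> symmetric_functions A D"
proof -
  obtain a where a: "a \<in> short_words A D" "\<alpha> = mset a" using assms by (auto simp: contents_def)
  then show ?thesis
    unfolding symmetric_functions_def monomial_def by (auto simp: mem_short_words dest: mset_eq_length mset_eq_setD split: if_splits)
qed

lemma weight_of_nat:
  assumes A: "finite A" and "\<alpha> \<in> contents A D"
  shows "\<exists>n>0. weight A D \<alpha> = of_nat n"
proof -
  obtain a where a: "a \<in> short_words A D" "\<alpha> = mset a" using assms by (auto simp: contents_def)
  have "weight A D \<alpha> = (\<Sum>b\<in>short_words A D. of_nat (if mset b = \<alpha> then 1 else 0))"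
    unfolding weight_def word_pairing_def by (intro sum.cong) (auto simp: monomial_def mem_short_words)
  also have "\<dots> = of_nat (\<Sum>b\<in>short_words A D. if mset b = \<alpha> then 1 else 0)" by simp
  finally have "weight A D \<alpha> = of_nat (\<Sum>b\<in>short_words A D. if mset b = \<alpha> then 1 else 0)" .
  moreover have "(\<Sum>b\<in>short_words A D. if mset b = \<alpha> then 1 else 0 :: nat) > 0"
    using a finite_short_words[OF A] by (intro sum_pos2[where i=a]) auto
  ultimately show ?thesis by blast
qed

text \<open>The usual formula for the coefficients in an orthogonal basis.\<close>

lemma symmetric_expansion:
  assumes A: "finite A" and s: "s \<in> symmetric_functions A D"
  shows "s = (\<Sum>\<alpha>\<in>contents A D. (\<lambda>a. word_pairing A D s (monomial A \<alpha>) / weight A D \<alpha> * monomial A \<alpha> a))"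
proof
  fix a
  have coef: "word_pairing A D s (monomial A (mset a)) = s a * weight A D (mset a)"
    unfolding word_pairing_def weight_def sum_distrib_left
    by (intro sum.cong) (auto simp: monomial_def intro: symmetricD(3)[OF s])
  show "s a = (\<Sum>\<alpha>\<in>contents A D. (\<lambda>a. word_pairing A D s (monomial A \<alpha>) / weight A D \<alpha> * monomial A \<alpha> a)) a"
  proof (cases "a \<in> short_words A D")
    case True
    then have c: "mset a \<in> contents A D" by (simp add: contents_def)
    have "(\<Sum>\<alpha>\<in>contents A D. word_pairing A D s (monomial A \<alpha>) / weight A D \<alpha> * monomial A \<alpha> a)
       = (\<Sum>\<alpha>\<in>contents A D. if \<alpha> = mset a then s a else 0)"
      using coef weight_of_nat[OF A c] True
      by (intro sum.cong) (auto simp: monomial_def mem_short_words)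
    then show ?thesis using c finite_contents[OF A] by (simp add: sum_fun_apply)
  next
    case False
    then have "s a = 0" using symmetricD(1,2)[OF s, of a] by (auto simp: mem_short_words)
    moreover have "monomial A \<alpha> a = 0" if "\<alpha> \<in> contents A D" for \<alpha>
      using symmetricD(1,2)[OF monomial_symmetric[OF that], of a] False by (auto simp: mem_short_words)
    ultimately show ?thesis by (simp add: sum_fun_apply)
  qed
qed

section \<open>Splitting off a tensor factor\<close>

text \<open>If \<open>v\<close> is inverse to \<open>u\<close>, then \<open>u\<close> transposed on the left and \<open>v\<close> on the right cancel in the
  sum over an orthogonal basis: move \<open>u\<close> to the other side by adjointness, where it meets \<open>v\<close>. It is
  this lemma that makes the partial trace over the symmetric algebra equivariant.\<close>

lemma casimir_invariance:
  fixes \<Phi> :: "('a list \<Rightarrow> complex) \<Rightarrow> ('a list \<Rightarrow> complex) \<Rightarrow> 'v \<Rightarrow> complex"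
  assumes A: "finite A"
    and left: "\<And>t. t \<in> symmetric_functions A D \<Longrightarrow> (\<forall>x\<in>symmetric_functions A D. \<forall>y\<in>symmetric_functions A D. \<Phi> (x + y) t = \<Phi> x t + \<Phi> y t) \<and>
       (\<forall>c. \<forall>x\<in>symmetric_functions A D. \<Phi> (\<lambda>a. c * x a) t = (\<lambda>v. c * \<Phi> x t v))"
    and right: "\<And>s. s \<in> symmetric_functions A D \<Longrightarrow> (\<forall>x\<in>symmetric_functions A D. \<forall>y\<in>symmetric_functions A D. \<Phi> s (x + y) = \<Phi> s x + \<Phi> s y) \<and>
       (\<forall>c. \<forall>x\<in>symmetric_functions A D. \<Phi> s (\<lambda>a. c * x a) = (\<lambda>v. c * \<Phi> s x v))"
    and inv: "\<And>x z. x \<in> A \<Longrightarrow> z \<in> A \<Longrightarrow> (\<Sum>y\<in>A. v x y * u y z) = (if x = z then 1 else 0)"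
  shows "(\<Sum>\<alpha>\<in>contents A D. \<Phi> (tensor_map A (\<lambda>x y. u y x) (monomial A \<alpha>)) (tensor_map A v (monomial A \<alpha>)) p / weight A D \<alpha>)
       = (\<Sum>\<alpha>\<in>contents A D. \<Phi> (monomial A \<alpha>) (monomial A \<alpha>) p / weight A D \<alpha>)"
proof -
  let ?C = "contents A D" and ?S = "symmetric_functions A D"
  let ?U = "tensor_map A u" and ?Ut = "tensor_map A (\<lambda>x y. u y x)" and ?V = "tensor_map A v"
  let ?I = "monomial A" and ?w = "weight A D"
  \<comment> \<open>the matrix coefficients of \<open>u\<close>, up to the squared lengths of the monomials\<close>
  define k where "k \<alpha> \<beta> = word_pairing A D (?U (?I \<beta>)) (?I \<alpha>)" for \<alpha> \<beta>
  have fin: "finite ?C" by (rule finite_contents[OF A])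
  have sym: "?I \<alpha> \<in> ?S" if "\<alpha> \<in> ?C" for \<alpha> by (rule monomial_symmetric[OF that])
  note tsym = tensor_map_symmetric[OF sym]
  have Ut: "?Ut (?I \<alpha>) = (\<Sum>\<beta>\<in>?C. (\<lambda>a. k \<alpha> \<beta> / ?w \<beta> * ?I \<beta> a))" if "\<alpha> \<in> ?C" for \<alpha>
  proof -
    have "word_pairing A D (?Ut (?I \<alpha>)) (?I \<beta>) = k \<alpha> \<beta>" for \<beta>
      unfolding k_def word_pairing_commute[of A D "?Ut (?I \<alpha>)"] by (rule word_pairing_tensor_map[OF A])
    then show ?thesis using symmetric_expansion[OF A tsym[OF that], of "\<lambda>x y. u y x"] by simp
  qed
  have U: "?U (?I \<beta>) = (\<Sum>\<alpha>\<in>?C. (\<lambda>a. k \<alpha> \<beta> / ?w \<alpha> * ?I \<alpha> a))" if "\<beta> \<in> ?C" for \<beta>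
    using symmetric_expansion[OF A tsym[OF that], of u] by (simp add: k_def)
  have VU: "?I \<beta> = (\<Sum>\<alpha>\<in>?C. (\<lambda>a. k \<alpha> \<beta> / ?w \<alpha> * ?V (?I \<alpha>) a))" if "\<beta> \<in> ?C" for \<beta>
  proof -
    have "?I \<beta> = ?V (?U (?I \<beta>))"
      by (rule tensor_map_inverse[OF A inv, symmetric]) (auto simp: monomial_def split: if_splits)
    also have "\<dots> = (\<Sum>\<alpha>\<in>?C. (\<lambda>a. k \<alpha> \<beta> / ?w \<alpha> * ?V (?I \<alpha>) a))"
      unfolding U[OF that]
      by (rule linear_combination[OF subspace_symmetric[of A D] tensor_map_add tensor_map_scale fin sym])
    finally show ?thesis .
  qed
  have L: "\<Phi> (\<Sum>\<beta>\<in>?C. (\<lambda>a. c \<beta> * ?I \<beta> a)) t p = (\<Sum>\<beta>\<in>?C. c \<beta> * \<Phi> (?I \<beta>) t p)" if "t \<in> ?S" for c t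
    using linear_combination[OF subspace_symmetric[of A D], where L="\<lambda>s. \<Phi> s t" and c=c and x="?I" and S="?C"]
      left[OF that] fin sym by (simp add: sum_fun_apply)
  have R: "\<Phi> s (\<Sum>\<beta>\<in>?C. (\<lambda>a. c \<beta> * ?V (?I \<beta>) a)) p = (\<Sum>\<beta>\<in>?C. c \<beta> * \<Phi> s (?V (?I \<beta>)) p)" if "s \<in> ?S" for c s
    using linear_combination[OF subspace_symmetric[of A D], where L="\<lambda>t. \<Phi> s t" and c=c and x="\<lambda>\<beta>. ?V (?I \<beta>)" and S="?C"]
      right[OF that] fin tsym by (simp add: sum_fun_apply)
  have "(\<Sum>\<alpha>\<in>?C. \<Phi> (?Ut (?I \<alpha>)) (?V (?I \<alpha>)) p / ?w \<alpha>)
      = (\<Sum>\<alpha>\<in>?C. \<Sum>\<beta>\<in>?C. k \<alpha> \<beta> / ?w \<beta> * \<Phi> (?I \<beta>) (?V (?I \<alpha>)) p / ?w \<alpha>)"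
    by (intro sum.cong refl) (simp only: Ut L tsym sum_divide_distrib)
  also have "\<dots> = (\<Sum>\<beta>\<in>?C. \<Sum>\<alpha>\<in>?C. k \<alpha> \<beta> / ?w \<beta> * \<Phi> (?I \<beta>) (?V (?I \<alpha>)) p / ?w \<alpha>)"
    by (rule sum.swap)
  also have "\<dots> = (\<Sum>\<beta>\<in>?C. \<Phi> (?I \<beta>) (\<Sum>\<alpha>\<in>?C. (\<lambda>a. k \<alpha> \<beta> / ?w \<alpha> * ?V (?I \<alpha>) a)) p / ?w \<beta>)"
  proof (intro sum.cong refl)
    fix \<beta> assume "\<beta> \<in> ?C"
    from R[OF sym[OF this], of "\<lambda>\<alpha>. k \<alpha> \<beta> / ?w \<alpha>"]
    show "(\<Sum>\<alpha>\<in>?C. k \<alpha> \<beta> / ?w \<beta> * \<Phi> (?I \<beta>) (?V (?I \<alpha>)) p / ?w \<alpha>)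
        = \<Phi> (?I \<beta>) (\<Sum>\<alpha>\<in>?C. (\<lambda>a. k \<alpha> \<beta> / ?w \<alpha> * ?V (?I \<alpha>) a)) p / ?w \<beta>"
      by (simp only: sum_divide_distrib) (simp add: mult_ac)
  qed
  also have "\<dots> = (\<Sum>\<beta>\<in>?C. \<Phi> (?I \<beta>) (?I \<beta>) p / ?w \<beta>)"
    by (intro sum.cong refl) (simp only: VU[symmetric])
  finally show ?thesis .
qed

text \<open>In the application \<open>B\<close>, \<open>A\<close> and \<open>B'\<close> index bases of \<open>V\<close>, of the direct sum of the lost factors \<open>X\<^sub>i\<close> and of
  \<open>V' = \<Oplus> V\<^sub>i'\<close>. An index \<open>b\<close> of \<open>V\<close> is a pair of an index \<open>lost b\<close> and an index \<open>kept b\<close> of the same type,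
  the type being the number \<open>i\<close> of the summand. Indices \<open>b\<close> with \<open>kept b\<close> outside \<open>B'\<close> belong to summands
  that the subgraph omits.\<close>

locale word_factorisation =
  fixes B :: "'b set" and B' :: "'c set" and A :: "'a set"
    and lost :: "'b \<Rightarrow> 'a" and kept :: "'b \<Rightarrow> 'c" and tyA :: "'a \<Rightarrow> 'i" and ty :: "'c \<Rightarrow> 'i"
  assumes finite_B: "finite B" and finite_B': "finite B'" and finite_A: "finite A"
    and lost: "b \<in> B \<Longrightarrow> kept b \<in> B' \<Longrightarrow> lost b \<in> A" "b \<in> B \<Longrightarrow> kept b \<in> B' \<Longrightarrow> tyA (lost b) = ty (kept b)"
    and ex1: "x \<in> A \<Longrightarrow> c \<in> B' \<Longrightarrow> tyA x = ty c \<Longrightarrow> \<exists>!b. b \<in> B \<and> lost b = x \<and> kept b = c"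
    and nonempty: "c \<in> B' \<Longrightarrow> \<exists>x\<in>A. tyA x = ty c"
begin

lemma word_bij:
  "bij_betw (\<lambda>w. (map lost w, map kept w)) {w \<in> words B n. map kept w \<in> words B' n}
     {(a, c). a \<in> words A n \<and> c \<in> words B' n \<and> map tyA a = map ty c}"
  (is "bij_betw ?f ?X ?Y")
  unfolding bij_betw_def
proof
  show "inj_on ?f ?X"
  proof (rule inj_onI)
    fix w w' assume w: "w \<in> ?X" "w' \<in> ?X" "?f w = ?f w'"
    show "w = w'"
    proof (rule nth_equalityI)
      show len: "length w = length w'" using w by (auto simp: words_def)
      fix p assume p: "p < length w"
      have in_B: "w ! p \<in> B" "w' ! p \<in> B" "kept (w ! p) \<in> B'" using w p len by (auto simp: words_def subset_iff)
      have "lost (w ! p) = lost (w' ! p)" "kept (w ! p) = kept (w' ! p)"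
        using w(3) p len by (metis nth_map prod.inject)+
      then show "w ! p = w' ! p" using ex1[OF lost(1)[OF in_B(1,3)] in_B(3) lost(2)[OF in_B(1,3)]] in_B by metis
    qed
  qed
  show "?f ` ?X = ?Y"
  proof
    show "?f ` ?X \<subseteq> ?Y"
      using lost by (auto simp: words_def subset_iff)
    show "?Y \<subseteq> ?f ` ?X"
    proof
      fix y assume "y \<in> ?Y"
      then obtain a c where y: "y = (a, c)" and a: "a \<in> words A n" and c: "c \<in> words B' n" and ty: "map tyA a = map ty c" by blast
      have "\<forall>p<n. \<exists>b. b \<in> B \<and> lost b = a ! p \<and> kept b = c ! p"
      proof (intro allI impI)
        fix p assume p: "p < n"
        have "a ! p \<in> A" "c ! p \<in> B'" using a c p by (auto simp: words_def subset_iff)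
        moreover have "tyA (a ! p) = ty (c ! p)" using ty a c p by (metis (mono_tags, lifting) words_def mem_Collect_eq nth_map)
        ultimately show "\<exists>b. b \<in> B \<and> lost b = a ! p \<and> kept b = c ! p" using ex1 by blast
      qed
      then obtain h where h: "\<And>p. p < n \<Longrightarrow> h p \<in> B \<and> lost (h p) = a ! p \<and> kept (h p) = c ! p" by metis
      let ?w = "map h [0..<n]"
      have len: "length a = n" "length c = n" using a c by (auto simp: words_def)
      have "map lost ?w = a" "map kept ?w = c" using h len by (auto intro!: nth_equalityI)
      moreover have "?w \<in> words B n" using h by (auto simp: words_def)
      ultimately show "y \<in> ?f ` ?X" using y c by (intro image_eqI[of _ _ ?w]) auto
    qed
  qed
qed

lemma sum_words_split:
  fixes G :: "'a list \<Rightarrow> 'c list \<Rightarrow> complex"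
  shows "(\<Sum>w\<in>words B n. if map kept w \<in> words B' n then G (map lost w) (map kept w) else 0)
     = (\<Sum>a\<in>words A n. \<Sum>c\<in>words B' n. if map tyA a = map ty c then G a c else 0)"
proof -
  let ?Y = "{(a, c). a \<in> words A n \<and> c \<in> words B' n \<and> map tyA a = map ty c}"
  have "(\<Sum>w\<in>words B n. if map kept w \<in> words B' n then G (map lost w) (map kept w) else 0)
      = (\<Sum>w\<in>{w \<in> words B n. map kept w \<in> words B' n}. G (map lost w) (map kept w))"
    by (rule sum.inter_filter[symmetric]) (rule finite_words[OF finite_B])
  also have "\<dots> = (\<Sum>(a, c)\<in>?Y. G a c)"
    using sum.reindex_bij_betw[OF word_bij, of "\<lambda>(a, c). G a c" n] by simp
  also have "\<dots> = (\<Sum>(a, c)\<in>words A n \<times> words B' n. if map tyA a = map ty c then G a c else 0)"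
    by (rule sum.mono_neutral_cong_left) (auto simp: finite_words finite_A finite_B' split: if_splits)
  also have "\<dots> = (\<Sum>a\<in>words A n. \<Sum>c\<in>words B' n. if map tyA a = map ty c then G a c else 0)"
    by (rule sum.cartesian_product[symmetric])
  finally show ?thesis .
qed

text \<open>A matrix \<open>m\<close> on \<open>V\<close> is block diagonal and restricts on the block \<open>i\<close> to the tensor product of the blocks
  of \<open>u\<close> and \<open>m'\<close>; the omitted summands are separated from the others. The condition is invariant under
  transposition, which gives \<open>contract_tensor_map\<close> from \<open>lift_tensor_map\<close>.\<close>

definition compatible :: "('b \<Rightarrow> 'b \<Rightarrow> complex) \<Rightarrow> ('a \<Rightarrow> 'a \<Rightarrow> complex) \<Rightarrow> ('c \<Rightarrow> 'c \<Rightarrow> complex) \<Rightarrow> bool" where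
  "compatible m u m' \<longleftrightarrow>
     (\<forall>b\<in>B. \<forall>c\<in>B. kept b \<in> B' \<longrightarrow> kept c \<in> B' \<longrightarrow> m b c = u (lost b) (lost c) * m' (kept b) (kept c)) \<and>
     (\<forall>b\<in>B. \<forall>c\<in>B. (kept b \<in> B') \<noteq> (kept c \<in> B') \<longrightarrow> m b c = 0) \<and>
     (\<forall>x\<in>A. \<forall>y\<in>A. tyA x \<noteq> tyA y \<longrightarrow> u x y = 0) \<and> (\<forall>x\<in>B'. \<forall>y\<in>B'. ty x \<noteq> ty y \<longrightarrow> m' x y = 0)"

lemma compatible_transpose:
  assumes "compatible m u m'"
  shows "compatible (\<lambda>x y. m y x) (\<lambda>x y. u y x) (\<lambda>x y. m' y x)"
  using assms unfolding compatible_def by (elim conjE, intro conjI ballI impI) simp_all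

text \<open>The product of a symmetric function of the lost indices with a function of the kept indices: the
  embedding of \<open>S(X) \<otimes> \<Lambda>(V')\<close> into \<open>\<Lambda>(V)\<close>, one vector of \<open>S(X)\<close> at a time.\<close>

definition lift :: "('a list \<Rightarrow> complex) \<Rightarrow> ('c list \<Rightarrow> complex) \<Rightarrow> 'b list \<Rightarrow> complex" where
  "lift s f w = (if set w \<subseteq> B then s (map lost w) * f (map kept w) else 0)"

text \<open>Equivariance of \<open>lift\<close>. Terms whose words have different types vanish on both sides, by the block
  structure.\<close>

lemma lift_tensor_map:
  assumes comp: "compatible m u m'" and f: "\<And>v. f v \<noteq> 0 \<Longrightarrow> set v \<subseteq> B'"
  shows "tensor_map B m (lift s f) = lift (tensor_map A u s) (tensor_map B' m' f)"
proof
  fix w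
  show "tensor_map B m (lift s f) w = lift (tensor_map A u s) (tensor_map B' m' f) w"
  proof (cases "set w \<subseteq> B")
    case wB: True
    let ?n = "length w"
    have lhs: "tensor_map B m (lift s f) w = (\<Sum>v\<in>words B ?n. word_entry m w v * (s (map lost v) * f (map kept v)))"
      using wB by (auto simp: tensor_map_words lift_def words_def intro!: sum.cong)
    have f0: "f (map kept v) = 0" if "v \<in> words B ?n" "map kept v \<notin> words B' ?n" for v
      using f[of "map kept v"] that by (auto simp: words_def)
    show ?thesis
    proof (cases "map kept w \<in> words B' ?n")
      case True
      have wA: "set (map lost w) \<subseteq> A" "map tyA (map lost w) = map ty (map kept w)"
        using True wB lost by (auto simp: words_def subset_iff)
      let ?G = "\<lambda>a c. word_entry u (map lost w) a * word_entry m' (map kept w) c * (s a * f c)"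
      have ker: "word_entry m w v = word_entry u (map lost w) (map lost v) * word_entry m' (map kept w) (map kept v)"
        if v: "v \<in> words B ?n" "map kept v \<in> words B' ?n" for v
      proof -
        have "m (w ! p) (v ! p) = u (lost (w ! p)) (lost (v ! p)) * m' (kept (w ! p)) (kept (v ! p))" if p: "p < ?n" for p
        proof -
          have "w ! p \<in> B" "kept (w ! p) \<in> B'" "v ! p \<in> B" "kept (v ! p) \<in> B'"
            using v wB True p by (auto simp: words_def subset_iff)
          then show ?thesis using comp unfolding compatible_def by blast
        qed
        then have "word_entry m w v = (\<Prod>p<?n. u (lost (w ! p)) (lost (v ! p)) * m' (kept (w ! p)) (kept (v ! p)))"
          unfolding word_entry_def by (intro prod.cong) auto
        also have "\<dots> = word_entry u (map lost w) (map lost v) * word_entry m' (map kept w) (map kept v)"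
          using v(1) by (simp add: word_entry_def prod.distrib words_def)
        finally show ?thesis .
      qed
      have zero: "?G a c = 0" if a: "a \<in> words A ?n" and c: "c \<in> words B' ?n" and ne: "map tyA a \<noteq> map ty c" for a c
      proof -
        have len: "length a = ?n" "length c = ?n" using a c by (auto simp: words_def)
        then obtain p where p: "p < ?n" "tyA (a ! p) \<noteq> ty (c ! p)"
          using ne by (metis length_map nth_equalityI nth_map)
        have m: "lost (w ! p) \<in> A" "kept (w ! p) \<in> B'" "a ! p \<in> A" "c ! p \<in> B'"
          using a c True wA p by (auto simp: words_def subset_iff)
        have "tyA (lost (w ! p)) = ty (kept (w ! p))" using wA(2) p by (metis length_map nth_map)
        then have "tyA (lost (w ! p)) \<noteq> tyA (a ! p) \<or> ty (kept (w ! p)) \<noteq> ty (c ! p)" using p by metis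
        then have "u (lost (w ! p)) (a ! p) = 0 \<or> m' (kept (w ! p)) (c ! p) = 0"
          using comp m unfolding compatible_def by blast
        then have "word_entry u (map lost w) a = 0 \<or> word_entry m' (map kept w) c = 0"
          using word_entry_eq_0[of p "map lost w" u a] word_entry_eq_0[of p "map kept w" m' c] p by auto
        then show ?thesis by auto
      qed
      have "tensor_map B m (lift s f) w = (\<Sum>v\<in>words B ?n. if map kept v \<in> words B' ?n then ?G (map lost v) (map kept v) else 0)"
        unfolding lhs using f0 ker by (intro sum.cong) auto
      also have "\<dots> = (\<Sum>a\<in>words A ?n. \<Sum>c\<in>words B' ?n. ?G a c)"
        by (subst sum_words_split[of _ ?G]) (use zero in \<open>auto intro!: sum.cong\<close>)
      also have "\<dots> = (\<Sum>a\<in>words A ?n. word_entry u (map lost w) a * s a) * (\<Sum>c\<in>words B' ?n. word_entry m' (map kept w) c * f c)"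
        unfolding sum_product by (simp add: mult_ac)
      also have "\<dots> = lift (tensor_map A u s) (tensor_map B' m' f) w"
        using wB wA True by (simp add: lift_def tensor_map_words words_def)
      finally show ?thesis .
    next
      case False
      then obtain p where p: "p < ?n" "kept (w ! p) \<notin> B'" by (auto simp: words_def subset_iff in_set_conv_nth)
      have "word_entry m w v * (s (map lost v) * f (map kept v)) = 0" if v: "v \<in> words B ?n" for v
      proof (cases "map kept v \<in> words B' ?n")
        case True
        then have "m (w ! p) (v ! p) = 0"
          using comp p v wB unfolding compatible_def by (auto simp: words_def subset_iff)
        then show ?thesis using word_entry_eq_0[of p w m v] p by simp
      qed (use f0[OF v] in simp)
      then have "tensor_map B m (lift s f) w = 0" unfolding lhs by simp
      moreover have "tensor_map B' m' f (map kept w) = 0" using False by (auto simp: tensor_map_def words_def)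
      ultimately show ?thesis by (simp add: lift_def)
    qed
  qed (simp add: tensor_map_def lift_def)
qed

lemma lift_alternating:
  assumes s: "s \<in> symmetric_functions A D" and f: "f \<in> alternating B'"
  shows "lift s f \<in> alternating B"
proof -
  have "lift s f (u @ x # y # v) = - lift s f (u @ y # x # v)" for u x y v
  proof -
    have "s (map lost (u @ x # y # v)) = s (map lost (u @ y # x # v))" by (rule symmetricD(3)[OF s]) simp
    then show ?thesis using alternatingD(2)[OF f, of "map kept u" "kept x" "kept y" "map kept v"]
      by (simp add: lift_def insert_commute)
  qed
  moreover have "set w \<subseteq> B" if "lift s f w \<noteq> 0" for w using that by (auto simp: lift_def split: if_splits)
  ultimately show ?thesis unfolding alternating_def by blast
qed

text \<open>The transpose of \<open>lift s\<close>, from \<open>\<Lambda>(V)\<close> to \<open>\<Lambda>(V')\<close>.\<close>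

definition contract :: "('a list \<Rightarrow> complex) \<Rightarrow> ('b list \<Rightarrow> complex) \<Rightarrow> 'c list \<Rightarrow> complex" where
  "contract s \<omega> v = (if set v \<subseteq> B' then \<Sum>w\<in>words B (length v). lift s (delta v) w * \<omega> w else 0)"

lemma contract_tensor_map:
  assumes comp: "compatible m u m'"
  shows "contract s (tensor_map B m \<omega>) = tensor_map B' m' (contract (tensor_map A (\<lambda>x y. u y x) s) \<omega>)"
proof
  fix v
  show "contract s (tensor_map B m \<omega>) v = tensor_map B' m' (contract (tensor_map A (\<lambda>x y. u y x) s) \<omega>) v"
  proof (cases "set v \<subseteq> B'")
    case v: True
    let ?n = "length v"
    let ?s = "tensor_map A (\<lambda>x y. u y x) s"
    have "contract s (tensor_map B m \<omega>) v
        = (\<Sum>w\<in>words B ?n. \<Sum>y\<in>words B ?n. lift s (delta v) w * (word_entry m w y * \<omega> y))"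
      using v by (auto simp: contract_def tensor_map_words words_def sum_distrib_left intro!: sum.cong)
    also have "\<dots> = (\<Sum>y\<in>words B ?n. \<Sum>w\<in>words B ?n. lift s (delta v) w * (word_entry m w y * \<omega> y))" by (rule sum.swap)
    also have "\<dots> = (\<Sum>y\<in>words B ?n. tensor_map B (\<lambda>x y. m y x) (lift s (delta v)) y * \<omega> y)"
    proof (rule sum.cong[OF refl])
      fix y assume y: "y \<in> words B ?n"
      then have ylen: "length y = ?n" "set y \<subseteq> B" by (auto simp: words_def)
      have "tensor_map B (\<lambda>x y. m y x) (lift s (delta v)) y
          = (\<Sum>w\<in>words B ?n. word_entry (\<lambda>x y. m y x) y w * lift s (delta v) w)"
        using ylen by (simp add: tensor_map_words)
      also have "\<dots> = (\<Sum>w\<in>words B ?n. word_entry m w y * lift s (delta v) w)"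
      proof (rule sum.cong[OF refl])
        fix w assume "w \<in> words B ?n"
        then have "word_entry (\<lambda>x y. m y x) y w = word_entry m w y" using ylen by (intro word_entry_transpose) (simp add: words_def)
        then show "word_entry (\<lambda>x y. m y x) y w * lift s (delta v) w = word_entry m w y * lift s (delta v) w" by simp
      qed
      finally have "tensor_map B (\<lambda>x y. m y x) (lift s (delta v)) y = (\<Sum>w\<in>words B ?n. word_entry m w y * lift s (delta v) w)" .
      then show "(\<Sum>w\<in>words B ?n. lift s (delta v) w * (word_entry m w y * \<omega> y)) = tensor_map B (\<lambda>x y. m y x) (lift s (delta v)) y * \<omega> y"
        by (simp add: sum_distrib_left mult_ac)
    qed
    also have "\<dots> = (\<Sum>y\<in>words B ?n. lift ?s (tensor_map B' (\<lambda>x y. m' y x) (delta v)) y * \<omega> y)"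
      using v by (subst lift_tensor_map[OF compatible_transpose[OF comp]]) (auto simp: delta_def split: if_splits)
    also have "\<dots> = (\<Sum>y\<in>words B ?n. \<Sum>z\<in>words B' ?n. word_entry m' v z * (lift ?s (delta z) y * \<omega> y))"
    proof (rule sum.cong[OF refl])
      fix y assume y: "y \<in> words B ?n"
      have "(\<Sum>z\<in>words B' ?n. word_entry m' v z * lift ?s (delta z) y)
          = (\<Sum>z\<in>words B' ?n. if map kept y = z then word_entry m' v z * ?s (map lost y) else 0)"
        using y by (intro sum.cong) (auto simp: lift_def words_def delta_def)
      also have "\<dots> = (if map kept y \<in> words B' ?n then word_entry m' v (map kept y) * ?s (map lost y) else 0)"
        by (simp add: finite_words[OF finite_B'])
      also have "\<dots> = lift ?s (tensor_map B' (\<lambda>x y. m' y x) (delta v)) y"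
      proof (cases "map kept y \<in> words B' ?n")
        case True
        have "tensor_map B' (\<lambda>x y. m' y x) (delta v) (map kept y)
            = (\<Sum>z\<in>words B' ?n. if z = v then word_entry (\<lambda>x y. m' y x) (map kept y) z else 0)"
          using True by (auto simp: tensor_map_words words_def delta_def intro!: sum.cong)
        also have "\<dots> = word_entry (\<lambda>x y. m' y x) (map kept y) v"
          using v by (simp add: finite_words[OF finite_B']) (simp add: words_def)
        also have "\<dots> = word_entry m' v (map kept y)" using y by (intro word_entry_transpose) (simp add: words_def)
        finally show ?thesis using True y by (simp add: lift_def words_def)
      next
        case False
        then show ?thesis using y by (auto simp: lift_def words_def tensor_map_def)
      qed
      finally have "lift ?s (tensor_map B' (\<lambda>x y. m' y x) (delta v)) y = (\<Sum>z\<in>words B' ?n. word_entry m' v z * lift ?s (delta z) y)" by simp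
      then show "lift ?s (tensor_map B' (\<lambda>x y. m' y x) (delta v)) y * \<omega> y
          = (\<Sum>z\<in>words B' ?n. word_entry m' v z * (lift ?s (delta z) y * \<omega> y))"
        by (simp only: sum_distrib_right mult.assoc)
    qed
    also have "\<dots> = (\<Sum>z\<in>words B' ?n. \<Sum>y\<in>words B ?n. word_entry m' v z * (lift ?s (delta z) y * \<omega> y))" by (rule sum.swap)
    also have "\<dots> = tensor_map B' m' (contract ?s \<omega>) v"
      using v by (auto simp: tensor_map_words contract_def words_def sum_distrib_left intro!: sum.cong)
    finally show ?thesis .
  qed (simp add: contract_def tensor_map_def)
qed

lemma lift_add_left: "lift (s + t) f = lift s f + lift t f"
  by (rule ext) (simp add: lift_def distrib_right)

lemma lift_scale_left: "lift (\<lambda>a. c * s a) f = (\<lambda>w. c * lift s f w)"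
  by (rule ext) (simp add: lift_def)

lemma lift_add: "lift s (f + g) = lift s f + lift s g"
  by (rule ext) (simp add: lift_def distrib_left)

lemma lift_scale: "lift s (\<lambda>v. c * f v) = (\<lambda>w. c * lift s f w)"
  by (rule ext) (simp add: lift_def)

lemma contract_add_left: "contract (s + t) \<omega> = contract s \<omega> + contract t \<omega>"
  by (rule ext) (simp add: contract_def lift_add_left distrib_right sum.distrib)

lemma contract_scale_left: "contract (\<lambda>a. c * s a) \<omega> = (\<lambda>v. c * contract s \<omega> v)"
  by (rule ext) (simp add: contract_def lift_scale_left sum_distrib_left mult.assoc)

lemma contract_add: "contract s (\<omega> + \<eta>) = contract s \<omega> + contract s \<eta>"
  by (rule ext) (simp add: contract_def distrib_left sum.distrib)

lemma contract_scale: "contract s (\<lambda>w. c * \<omega> w) = (\<lambda>v. c * contract s \<omega> v)"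
  by (rule ext) (simp add: contract_def sum_distrib_left mult.left_commute)

text \<open>The scalar by which \<open>contract s\<close> after \<open>lift t\<close> acts on the words of type \<open>\<tau>\<close>.\<close>

definition fibre_sum :: "('a list \<Rightarrow> complex) \<Rightarrow> ('a list \<Rightarrow> complex) \<Rightarrow> 'i list \<Rightarrow> complex" where
  "fibre_sum s t \<tau> = (\<Sum>a\<in>words A (length \<tau>). if map tyA a = \<tau> then s a * t a else 0)"

lemma contract_lift:
  assumes f: "\<And>v. f v \<noteq> 0 \<Longrightarrow> set v \<subseteq> B'"
  shows "contract s (lift t f) = (\<lambda>v. fibre_sum s t (map ty v) * f v)"
proof
  fix v
  show "contract s (lift t f) v = fibre_sum s t (map ty v) * f v"
  proof (cases "set v \<subseteq> B'")
    case True
    let ?n = "length v"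
    have "contract s (lift t f) v
        = (\<Sum>w\<in>words B ?n. if map kept w \<in> words B' ?n then (if map kept w = v then s (map lost w) * t (map lost w) * f v else 0) else 0)"
    proof -
      have "lift s (delta v) w * lift t f w
          = (if map kept w \<in> words B' ?n then (if map kept w = v then s (map lost w) * t (map lost w) * f v else 0) else 0)"
        if "w \<in> words B ?n" for w
      proof (cases "map kept w = v")
        case kept: True
        have "set w \<subseteq> B" using that by (simp add: words_def)
        moreover have "map kept w \<in> words B' ?n" using kept True by (simp add: words_def)
        ultimately show ?thesis by (simp only: lift_def delta_def kept if_True simp_thms) simp
      qed (simp add: lift_def delta_def)
      then show ?thesis using True by (simp add: contract_def)
    qed
    also have "\<dots> = (\<Sum>a\<in>words A ?n. \<Sum>c\<in>words B' ?n. if map tyA a = map ty c then (if c = v then s a * t a * f v else 0) else 0)"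
      by (rule sum_words_split[of ?n "\<lambda>a c. if c = v then s a * t a * f v else 0"])
    also have "\<dots> = (\<Sum>a\<in>words A ?n. \<Sum>c\<in>words B' ?n. if c = v then (if map tyA a = map ty v then s a * t a * f v else 0) else 0)"
      by (intro sum.cong) auto
    also have "\<dots> = (\<Sum>a\<in>words A ?n. if map tyA a = map ty v then s a * t a * f v else 0)"
      using True by (intro sum.cong refl) (simp add: finite_words[OF finite_B'], simp add: words_def)
    also have "\<dots> = fibre_sum s t (map ty v) * f v"
      by (auto simp: fibre_sum_def sum_distrib_right intro!: sum.cong)
    finally show ?thesis .
  next
    case False
    then have "f v = 0" using f by blast
    then show ?thesis using False by (simp add: contract_def)
  qed
qed

lemma fibre_sum_mset:
  assumes s: "s \<in> symmetric_functions A D" and t: "t \<in> symmetric_functions A D" and \<tau>: "mset \<tau> = mset \<sigma>"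
  shows "fibre_sum s t \<tau> = fibre_sum s t \<sigma>"
proof -
  obtain \<pi> where \<pi>: "\<pi> permutes {..<length \<sigma>}" "permute_list \<pi> \<sigma> = \<tau>"
    using mset_eq_permutation[OF \<tau>] by blast
  have inv: "inv_into UNIV \<pi> permutes {..<length \<sigma>}" using \<pi>(1) by (rule permutes_inv)
  have inj: "permute_list \<pi> a = permute_list \<pi> b \<longleftrightarrow> a = b" if "length a = length \<sigma>" "length b = length \<sigma>" for a b :: "'i list"
  proof
    assume "permute_list \<pi> a = permute_list \<pi> b"
    then have "permute_list (inv_into UNIV \<pi>) (permute_list \<pi> a) = permute_list (inv_into UNIV \<pi>) (permute_list \<pi> b)" by simp
    moreover have "permute_list (inv_into UNIV \<pi>) (permute_list \<pi> c) = c" if "length c = length \<sigma>" for c :: "'i list"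
      using inv that \<pi>(1) permute_list_compose[of "inv_into UNIV \<pi>" c \<pi>] by (simp add: permutes_inv_o)
    ultimately show "a = b" using that by simp
  qed simp
  have len: "length \<tau> = length \<sigma>" using \<tau> mset_eq_length by blast
  have "fibre_sum s t \<tau> = (\<Sum>a\<in>words A (length \<sigma>). if map tyA (permute_list \<pi> a) = \<tau> then s (permute_list \<pi> a) * t (permute_list \<pi> a) else 0)"
    unfolding fibre_sum_def len
    by (rule sum_words_permute[OF \<pi>(1), of "\<lambda>a. if map tyA a = \<tau> then s a * t a else 0" A, symmetric])
  also have "\<dots> = fibre_sum s t \<sigma>"
    unfolding fibre_sum_def
  proof (rule sum.cong[OF refl])
    fix a assume "a \<in> words A (length \<sigma>)"
    then have a: "\<pi> permutes {..<length a}" "length a = length \<sigma>" using \<pi>(1) by (auto simp: words_def)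
    have "s (permute_list \<pi> a) = s a" "t (permute_list \<pi> a) = t a"
      using symmetricD(3)[OF s] symmetricD(3)[OF t] mset_permute_list[OF a(1)] by blast+
    moreover have "map tyA (permute_list \<pi> a) = \<tau> \<longleftrightarrow> map tyA a = \<sigma>"
      unfolding \<pi>(2)[symmetric] using inj[of "map tyA a" \<sigma>] a by (simp add: permute_list_map[OF a(1), symmetric])
    ultimately show "(if map tyA (permute_list \<pi> a) = \<tau> then s (permute_list \<pi> a) * t (permute_list \<pi> a) else 0) = (if map tyA a = \<sigma> then s a * t a else 0)"
      by simp
  qed
  finally show ?thesis .
qed

end

lemma tensor_map_weighted_sum:
  "tensor_map Y m (\<lambda>p. \<Sum>\<alpha>\<in>S. x \<alpha> p / w \<alpha>) = (\<lambda>p. \<Sum>\<alpha>\<in>S. tensor_map Y m (x \<alpha>) p / w \<alpha>)"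
proof
  fix p
  show "tensor_map Y m (\<lambda>p. \<Sum>\<alpha>\<in>S. x \<alpha> p / w \<alpha>) p = (\<Sum>\<alpha>\<in>S. tensor_map Y m (x \<alpha>) p / w \<alpha>)"
  proof (cases "set p \<subseteq> Y")
    case True
    have "tensor_map Y m (\<lambda>p. \<Sum>\<alpha>\<in>S. x \<alpha> p / w \<alpha>) p
        = (\<Sum>ys\<in>words Y (length p). \<Sum>\<alpha>\<in>S. word_entry m p ys * x \<alpha> ys / w \<alpha>)"
      using True by (simp add: tensor_map_words sum_distrib_left)
    also have "\<dots> = (\<Sum>\<alpha>\<in>S. \<Sum>ys\<in>words Y (length p). word_entry m p ys * x \<alpha> ys / w \<alpha>)" by (rule sum.swap)
    also have "\<dots> = (\<Sum>\<alpha>\<in>S. tensor_map Y m (x \<alpha>) p / w \<alpha>)"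
      using True by (simp add: tensor_map_words sum_divide_distrib)
    finally show ?thesis .
  qed (simp add: tensor_map_def)
qed

context word_factorisation begin

text \<open>An entry of a block diagonal matrix between words of different types is zero.\<close>

lemma tensor_map_grading:
  assumes comp: "compatible m u m'"
  shows "tensor_map B' m' (\<lambda>v. h (mset (map ty v)) * x v) = (\<lambda>v. h (mset (map ty v)) * tensor_map B' m' x v)"
proof
  fix v
  show "tensor_map B' m' (\<lambda>v. h (mset (map ty v)) * x v) v = h (mset (map ty v)) * tensor_map B' m' x v"
  proof (cases "set v \<subseteq> B'")
    case v: True
    have "word_entry m' v y * (h (mset (map ty y)) * x y) = h (mset (map ty v)) * (word_entry m' v y * x y)"
      if y: "y \<in> words B' (length v)" for y
    proof (cases "map ty v = map ty y")
      case False
      have len: "length y = length v" using y by (simp add: words_def)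
      then obtain p where p: "p < length v" "ty (v ! p) \<noteq> ty (y ! p)"
        using False by (metis length_map nth_equalityI nth_map)
      have "v ! p \<in> B'" "y ! p \<in> B'" using p v y len by (auto simp: words_def subset_iff)
      then have "m' (v ! p) (y ! p) = 0" using comp p unfolding compatible_def by blast
      then show ?thesis using word_entry_eq_0[of p v m' y] p by simp
    qed simp
    then have "(\<Sum>y\<in>words B' (length v). word_entry m' v y * (h (mset (map ty y)) * x y))
        = (\<Sum>y\<in>words B' (length v). h (mset (map ty v)) * (word_entry m' v y * x y))"
      by (rule sum.cong[OF refl])
    then show ?thesis using v by (simp only: tensor_map_words sum_distrib_left if_True)
  qed (simp add: tensor_map_def)
qed

text \<open>The partial trace. For an invariant subspace \<open>N\<close> of \<open>\<Lambda>(V')\<close> let \<open>\<Lambda> N\<close> be the set of all \<open>\<omega>\<close> whose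
  contractions lie in \<open>N\<close>; it plays the role of \<open>X \<otimes> N\<close>. It is invariant and contains the lifts of \<open>N\<close>.
  From a projection \<open>Q\<close> onto \<open>\<Lambda> N\<close> one obtains \<open>P\<close> by lifting, applying \<open>Q\<close> and contracting, summed over
  the monomials. \<open>P\<close> maps into \<open>N\<close>, preserves every invariant subspace because \<open>Q\<close> does, and is
  multiplication by \<open>\<kappa>\<close> on \<open>N\<close>, where \<open>\<kappa>\<close> depends on the multidegree only. The hypothesis \<open>graded\<close> allows
  to divide by \<open>\<kappa>\<close>.\<close>

theorem strong_projections_transfer:
  fixes K :: "('g, 'k) monoid_scheme" and K' :: "('h, 'l) monoid_scheme"
  assumes sp: "group_rep.strong_projections (\<lambda>c v x. c * v x) K (alternating B) (\<lambda>g. tensor_map B (m g))"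
    and down: "\<And>g. g \<in> carrier K \<Longrightarrow> \<exists>u. \<exists>h\<in>carrier K'. compatible (m g) u (m' h)"
    and up: "\<And>h. h \<in> carrier K' \<Longrightarrow> \<exists>g\<in>carrier K. \<exists>u v. compatible (m g) u (m' h) \<and>
      (\<forall>x\<in>A. \<forall>z\<in>A. (\<Sum>y\<in>A. u x y * v y z) = (if x = z then 1 else 0)) \<and>
      (\<forall>x\<in>A. \<forall>z\<in>A. (\<Sum>y\<in>A. v x y * u y z) = (if x = z then 1 else 0))"
    and graded: "\<And>N h f. group_rep.invariant (\<lambda>c v x. c * v x) K' (alternating B') (\<lambda>g. tensor_map B' (m' g)) N \<Longrightarrow>
      f \<in> N \<Longrightarrow> (\<lambda>v. h (mset (map ty v)) * f v) \<in> N"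
  shows "group_rep.strong_projections (\<lambda>c v x. c * v x) K' (alternating B') (\<lambda>g. tensor_map B' (m' g))"
proof -
  interpret R: group_rep "\<lambda>c v x. c * v x" K "alternating B" "\<lambda>g. tensor_map B (m g)"
    by (rule group_rep_alternating[OF finite_B])
  interpret R': group_rep "\<lambda>c v x. c * v x" K' "alternating B'" "\<lambda>g. tensor_map B' (m' g)"
    by (rule group_rep_alternating[OF finite_B'])
  define D where "D = card B'"
  let ?S = "symmetric_functions A D" and ?C = "contents A D"
  let ?I = "monomial A" and ?w = "weight A D"
  have finC: "finite ?C" by (rule finite_contents[OF finite_A])
  have I: "?I \<alpha> \<in> ?S" if "\<alpha> \<in> ?C" for \<alpha> by (rule monomial_symmetric[OF that])
  have supp: "set v \<subseteq> B'" if "f \<in> alternating B'" "f v \<noteq> 0" for f v by (rule alternatingD(1)[OF that])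
  define \<Lambda> where "\<Lambda> N = {\<omega> \<in> alternating B. \<forall>s\<in>?S. contract s \<omega> \<in> N}" for N
  have \<Lambda>: "R.invariant (\<Lambda> N)" if N: "R'.invariant N" for N
  proof -
    note N' = R'.invariantD[OF N]
    have "fs.subspace (\<Lambda> N)"
      unfolding fs.subspace_def
    proof (intro conjI ballI allI)
      have "contract s 0 = 0" for s by (rule ext) (simp add: contract_def)
      then show "0 \<in> \<Lambda> N" using N'(1) fs.subspace_0[OF subspace_alternating] by (simp add: \<Lambda>_def)
    next
      fix x y assume "x \<in> \<Lambda> N" "y \<in> \<Lambda> N"
      then show "x + y \<in> \<Lambda> N"
        by (auto simp: \<Lambda>_def contract_add intro: N'(3) fs.subspace_add[OF subspace_alternating])
    next
      fix c x assume "x \<in> \<Lambda> N"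
      then show "(\<lambda>w. c * x w) \<in> \<Lambda> N"
        by (auto simp: \<Lambda>_def contract_scale intro: N'(5) fs.subspace_scale[OF subspace_alternating])
    qed
    moreover have "tensor_map B (m g) \<omega> \<in> \<Lambda> N" if g: "g \<in> carrier K" and \<omega>: "\<omega> \<in> \<Lambda> N" for g \<omega>
    proof -
      obtain u h where h: "h \<in> carrier K'" "compatible (m g) u (m' h)" using down[OF g] by blast
      have "contract s (tensor_map B (m g) \<omega>) \<in> N" if s: "s \<in> ?S" for s
        unfolding contract_tensor_map[OF h(2)]
        using N'(6)[OF _ h(1)] \<omega> tensor_map_symmetric[OF s] by (simp add: \<Lambda>_def)
      then show ?thesis using \<omega> tensor_map_alternating by (auto simp: \<Lambda>_def)
    qed
    ultimately show ?thesis unfolding R.invariant_def by (auto simp: \<Lambda>_def image_subset_iff)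
  qed
  have lift_\<Lambda>: "lift t f \<in> \<Lambda> N" if N: "R'.invariant N" and f: "f \<in> N" and t: "t \<in> ?S" for N f t
  proof -
    have fa: "f \<in> alternating B'" using R'.invariantD(2)[OF N f] .
    have "contract s (lift t f) \<in> N" if s: "s \<in> ?S" for s
    proof -
      define h where "h T = fibre_sum s t (SOME \<tau>. mset \<tau> = T)" for T
      have h: "h (mset \<tau>) = fibre_sum s t \<tau>" for \<tau>
        unfolding h_def by (rule fibre_sum_mset[OF s t]) (rule someI[of _ \<tau>], rule refl)
      have "contract s (lift t f) = (\<lambda>v. h (mset (map ty v)) * f v)"
        unfolding h by (rule contract_lift) (rule supp[OF fa])
      then show ?thesis using graded[OF N f] by simp
    qed
    then show ?thesis using lift_alternating[OF t fa] by (simp add: \<Lambda>_def)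
  qed

  \<comment> \<open>The partial trace of the identity, as a function of the word of types.\<close>
  define \<kappa> where "\<kappa> \<tau> = (\<Sum>\<alpha>\<in>?C. fibre_sum (?I \<alpha>) (?I \<alpha>) \<tau> / ?w \<alpha>)" for \<tau>
  have \<kappa>_mset: "\<kappa> \<tau> = \<kappa> \<sigma>" if "mset \<tau> = mset \<sigma>" for \<tau> \<sigma>
    unfolding \<kappa>_def using fibre_sum_mset[OF I I that] by (intro sum.cong) auto
  have \<kappa>_nz: "\<kappa> (map ty v) \<noteq> 0" if v: "v \<in> short_words B' D" for v
  proof -
    \<comment> \<open>Counting words shows that \<open>\<kappa>\<close> is a nonnegative real number; a word of lost indices of the
      right types gives a positive contribution.\<close>
    define k where "k \<alpha> = (\<Sum>a\<in>words A (length v). if map tyA a = map ty v \<and> mset a = \<alpha> then 1 else 0 :: nat)" for \<alpha>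
    have k: "fibre_sum (?I \<alpha>) (?I \<alpha>) (map ty v) = of_nat (k \<alpha>)" for \<alpha>
      unfolding fibre_sum_def k_def of_nat_sum
      by (intro sum.cong) (auto simp: monomial_def words_def)
    have "\<forall>\<alpha>\<in>?C. \<exists>n. n > 0 \<and> ?w \<alpha> = of_nat n" using weight_of_nat[OF finite_A] by blast
    from bchoice[OF this] obtain n where n: "\<And>\<alpha>. \<alpha> \<in> ?C \<Longrightarrow> n \<alpha> > 0 \<and> ?w \<alpha> = of_nat (n \<alpha>)" by blast
    have "\<forall>p<length v. \<exists>x. x \<in> A \<and> tyA x = ty (v ! p)"
      using v nonempty by (auto simp: mem_short_words subset_iff Bex_def)
    then obtain e where e: "\<And>p. p < length v \<Longrightarrow> e p \<in> A \<and> tyA (e p) = ty (v ! p)" by metis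
    let ?a = "map e [0..<length v]"
    have a: "?a \<in> words A (length v)" "map tyA ?a = map ty v"
      using e by (auto simp: words_def intro!: nth_equalityI)
    then have "?a \<in> short_words A D" using v by (auto simp: words_def mem_short_words)
    then have aC: "mset ?a \<in> ?C" unfolding contents_def by (rule imageI)
    have "k (mset ?a) > 0" unfolding k_def
      by (rule sum_pos2[OF finite_words[OF finite_A] a(1)]) (use a in auto)
    then have pos: "(\<Sum>\<alpha>\<in>?C. real (k \<alpha>) / real (n \<alpha>)) > 0"
      using n[OF aC] by (intro sum_pos2[OF finC aC]) auto
    have "\<kappa> (map ty v) = of_real (\<Sum>\<alpha>\<in>?C. real (k \<alpha>) / real (n \<alpha>))"
      unfolding \<kappa>_def of_real_sum using n by (intro sum.cong) (auto simp: k)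
    then show ?thesis using pos by (metis less_irrefl of_real_eq_0_iff)
  qed
  \<comment> \<open>\<open>\<kappa>\<close> is invariant under permutations, so its inverse is a function of the multiset of types.\<close>
  define h where "h T = inverse (\<kappa> (SOME \<tau>. mset \<tau> = T))" for T
  have h: "h (mset \<tau>) = inverse (\<kappa> \<tau>)" for \<tau>
  proof -
    have "mset (SOME \<sigma>. mset \<sigma> = mset \<tau>) = mset \<tau>" by (rule someI[of _ \<tau>]) (rule refl)
    then show ?thesis unfolding h_def using \<kappa>_mset by metis
  qed

  show ?thesis
    unfolding R'.strong_projections_def
  proof (intro allI impI)
    fix N assume N: "R'.invariant N"
    obtain Q where Q1: "R.equivariant Q" and Q2: "Q ` alternating B \<subseteq> \<Lambda> N"
      and Q3: "\<forall>x\<in>\<Lambda> N. Q x = x" and Q4: "\<forall>L. R.invariant L \<longrightarrow> Q ` L \<subseteq> L"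
      using sp[unfolded R.strong_projections_def, THEN spec, THEN mp, OF \<Lambda>[OF N]]
      by (elim exE conjE)
    have Q: "R.equivariant Q" "\<And>x. x \<in> alternating B \<Longrightarrow> Q x \<in> \<Lambda> N"
      "\<And>x. x \<in> \<Lambda> N \<Longrightarrow> Q x = x" "\<And>L x. R.invariant L \<Longrightarrow> x \<in> L \<Longrightarrow> Q x \<in> L"
      using Q1 Q2 Q3 Q4 by (simp_all add: image_subset_iff)
    note Qe = R.equivariantD[OF Q(1)]
    \<comment> \<open>bilinear in \<open>s\<close> and \<open>t\<close>; the partial trace evaluates it on pairs of equal monomials\<close>
    define \<Phi> where "\<Phi> f s t = contract s (Q (lift t f))" for f s t
    define P where "P f = (\<lambda>p. \<Sum>\<alpha>\<in>?C. \<Phi> f (?I \<alpha>) (?I \<alpha>) p / ?w \<alpha>)" for f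
    have lift_alt: "lift t f \<in> alternating B" if "f \<in> alternating B'" "t \<in> ?S" for f t
      by (rule lift_alternating[OF that(2,1)])
    have P_in: "P f \<in> L" if L: "R'.invariant L" and \<Phi>L: "\<And>s t. s \<in> ?S \<Longrightarrow> t \<in> ?S \<Longrightarrow> \<Phi> f s t \<in> L" for f L
    proof -
      have "P f = (\<Sum>\<alpha>\<in>?C. (\<lambda>p. inverse (?w \<alpha>) * \<Phi> f (?I \<alpha>) (?I \<alpha>) p))"
        unfolding P_def by (rule ext) (simp add: sum_fun_apply divide_inverse mult.commute)
      also have "\<dots> \<in> L"
        using L I \<Phi>L R'.invariantD(5)[OF L] by (intro fs.subspace_sum) (auto simp: R'.invariant_def)
      finally show ?thesis .
    qed
    have \<Phi>L: "\<Phi> f s t \<in> L" if "R'.invariant L" "f \<in> L" "s \<in> ?S" "t \<in> ?S" for L f s t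
      using Q(4)[OF \<Lambda>[OF that(1)] lift_\<Lambda>[OF that(1,2,4)]] that(3) by (simp add: \<Phi>_def \<Lambda>_def)
    have \<Phi>N: "\<Phi> f s t \<in> N" if "f \<in> alternating B'" "s \<in> ?S" "t \<in> ?S" for f s t
      using Q(2)[OF lift_alt[OF that(1,3)]] that(2) by (simp add: \<Phi>_def \<Lambda>_def)
    have P_add: "P (f + g) = P f + P g" if f: "f \<in> alternating B'" and g: "g \<in> alternating B'" for f g
    proof -
      have "\<Phi> (f + g) (?I \<alpha>) (?I \<alpha>) = \<Phi> f (?I \<alpha>) (?I \<alpha>) + \<Phi> g (?I \<alpha>) (?I \<alpha>)" if "\<alpha> \<in> ?C" for \<alpha>
        unfolding \<Phi>_def lift_add Qe(2)[OF lift_alt[OF f I[OF that]] lift_alt[OF g I[OF that]]] by (rule contract_add)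
      then show ?thesis unfolding P_def by (intro ext) (simp add: add_divide_distrib sum.distrib)
    qed
    have P_scale: "P (\<lambda>v. c * f v) = (\<lambda>v. c * P f v)" if f: "f \<in> alternating B'" for c f
    proof -
      have "\<Phi> (\<lambda>v. c * f v) (?I \<alpha>) (?I \<alpha>) = (\<lambda>v. c * \<Phi> f (?I \<alpha>) (?I \<alpha>) v)" if "\<alpha> \<in> ?C" for \<alpha>
        unfolding \<Phi>_def lift_scale Qe(3)[OF lift_alt[OF f I[OF that]]] by (rule contract_scale)
      then show ?thesis unfolding P_def by (intro ext) (simp add: sum_distrib_left)
    qed
    have P_equi: "P (tensor_map B' (m' k) f) = tensor_map B' (m' k) (P f)"
      if k: "k \<in> carrier K'" and f: "f \<in> alternating B'" for k f
    proof -
      obtain g u v where g: "g \<in> carrier K" and comp: "compatible (m g) u (m' k)"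
        and uv': "\<forall>x\<in>A. \<forall>z\<in>A. (\<Sum>y\<in>A. u x y * v y z) = (if x = z then 1 else 0)"
        and vu': "\<forall>x\<in>A. \<forall>z\<in>A. (\<Sum>y\<in>A. v x y * u y z) = (if x = z then 1 else 0)"
        using up[OF k] by (elim bexE exE conjE)
      note uv = uv'[rule_format] and vu = vu'[rule_format]
      let ?Ut = "tensor_map A (\<lambda>x y. u y x)" and ?V = "tensor_map A v"
      \<comment> \<open>One factor moves through \<open>lift\<close> and \<open>Q\<close>, the other through \<open>contract\<close>.\<close>
      have shift: "\<Phi> (tensor_map B' (m' k) f) (?I \<alpha>) (?I \<alpha>) = tensor_map B' (m' k) (\<Phi> f (?Ut (?I \<alpha>)) (?V (?I \<alpha>)))"
        if \<alpha>: "\<alpha> \<in> ?C" for \<alpha>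
      proof -
        have UV: "tensor_map A u (?V (?I \<alpha>)) = ?I \<alpha>"
          by (rule tensor_map_inverse[OF finite_A uv]) (auto simp: monomial_def split: if_splits)
        have "lift (?I \<alpha>) (tensor_map B' (m' k) f) = tensor_map B (m g) (lift (?V (?I \<alpha>)) f)"
          using lift_tensor_map[OF comp supp[OF f], where s="?V (?I \<alpha>)"] unfolding UV by simp
        then have "Q (lift (?I \<alpha>) (tensor_map B' (m' k) f)) = tensor_map B (m g) (Q (lift (?V (?I \<alpha>)) f))"
          using Qe(4)[OF g lift_alt[OF f tensor_map_symmetric[OF I[OF \<alpha>]]]] by simp
        then show ?thesis unfolding \<Phi>_def using contract_tensor_map[OF comp] by simp
      qed
      have "(\<Sum>\<alpha>\<in>?C. \<Phi> f (?Ut (?I \<alpha>)) (?V (?I \<alpha>)) p / ?w \<alpha>) = (\<Sum>\<alpha>\<in>?C. \<Phi> f (?I \<alpha>) (?I \<alpha>) p / ?w \<alpha>)" for p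
      proof (rule casimir_invariance[OF finite_A _ _ vu])
        fix t assume t: "t \<in> ?S"
        show "(\<forall>x\<in>?S. \<forall>y\<in>?S. \<Phi> f (x + y) t = \<Phi> f x t + \<Phi> f y t) \<and> (\<forall>c. \<forall>x\<in>?S. \<Phi> f (\<lambda>a. c * x a) t = (\<lambda>v. c * \<Phi> f x t v))"
          by (simp add: \<Phi>_def contract_add_left contract_scale_left)
        show "(\<forall>x\<in>?S. \<forall>y\<in>?S. \<Phi> f t (x + y) = \<Phi> f t x + \<Phi> f t y) \<and> (\<forall>c. \<forall>x\<in>?S. \<Phi> f t (\<lambda>a. c * x a) = (\<lambda>v. c * \<Phi> f t x v))"
          using lift_alt[OF f] by (simp add: \<Phi>_def lift_add_left lift_scale_left Qe contract_add contract_scale)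
      qed
      then have "P f = (\<lambda>p. \<Sum>\<alpha>\<in>?C. \<Phi> f (?Ut (?I \<alpha>)) (?V (?I \<alpha>)) p / ?w \<alpha>)" unfolding P_def by simp
      then have "tensor_map B' (m' k) (P f)
          = (\<lambda>p. \<Sum>\<alpha>\<in>?C. tensor_map B' (m' k) (\<Phi> f (?Ut (?I \<alpha>)) (?V (?I \<alpha>))) p / ?w \<alpha>)"
        using tensor_map_weighted_sum by simp
      also have "\<dots> = P (tensor_map B' (m' k) f)"
        unfolding P_def using shift by (intro ext sum.cong) auto
      finally show ?thesis by simp
    qed
    have P_N: "P f = (\<lambda>v. \<kappa> (map ty v) * f v)" if f: "f \<in> N" for f
    proof
      fix v
      have fa: "f \<in> alternating B'" using R'.invariantD(2)[OF N f] .
      have "\<Phi> f (?I \<alpha>) (?I \<alpha>) v = fibre_sum (?I \<alpha>) (?I \<alpha>) (map ty v) * f v" if "\<alpha> \<in> ?C" for \<alpha>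
        unfolding \<Phi>_def Q(3)[OF lift_\<Lambda>[OF N f I[OF that]]] by (subst contract_lift) (use supp[OF fa] in auto)
      then show "P f v = \<kappa> (map ty v) * f v"
        unfolding P_def \<kappa>_def sum_distrib_right by (intro sum.cong) auto
    qed
    define Q' where "Q' f = (\<lambda>v. h (mset (map ty v)) * P f v)" for f
    have Q'L: "Q' f \<in> L" if "R'.invariant L" "f \<in> L" for L f
      unfolding Q'_def by (rule graded[OF that(1) P_in[OF that(1)]]) (rule \<Phi>L[OF that])
    have "R'.equivariant Q'"
      unfolding R'.equivariant_def
    proof (intro conjI ballI allI)
      show "Q' f \<in> alternating B'" if "f \<in> alternating B'" for f by (rule Q'L[OF R'.invariant_V that])
      show "Q' (f + g) = Q' f + Q' g" if "f \<in> alternating B'" "g \<in> alternating B'" for f g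
        unfolding Q'_def P_add[OF that] by (rule ext) (simp add: distrib_left)
      show "Q' (\<lambda>v. c * f v) = (\<lambda>v. c * Q' f v)" if "f \<in> alternating B'" for c f
        unfolding Q'_def P_scale[OF that] by (rule ext) simp
      show "Q' (tensor_map B' (m' k) f) = tensor_map B' (m' k) (Q' f)" if k: "k \<in> carrier K'" and f: "f \<in> alternating B'" for k f
      proof -
        obtain g u where "compatible (m g) u (m' k)" using up[OF k] by blast
        then show ?thesis unfolding Q'_def P_equi[OF k f] by (rule tensor_map_grading[symmetric])
      qed
    qed
    moreover have "Q' ` alternating B' \<subseteq> N"
    proof
      fix y assume "y \<in> Q' ` alternating B'"
      then obtain f where f: "f \<in> alternating B'" "y = Q' f" by blast
      have "P f \<in> N" by (rule P_in[OF N \<Phi>N[OF f(1)]])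
      then show "y \<in> N" unfolding f(2) Q'_def by (rule graded[OF N])
    qed
    moreover have "Q' f = f" if f: "f \<in> N" for f
    proof
      fix v
      have fa: "f \<in> alternating B'" using R'.invariantD(2)[OF N f] .
      show "Q' f v = f v"
      proof (cases "f v = 0")
        case False
        then have "v \<in> short_words B' D"
          using supp[OF fa False] alternating_length[OF finite_B' fa False] by (simp add: mem_short_words D_def)
        then have "h (mset (map ty v)) * \<kappa> (map ty v) = 1" using \<kappa>_nz unfolding h by simp
        then show ?thesis by (simp only: Q'_def P_N[OF f] mult.assoc[symmetric] mult_1_left)
      qed (simp add: Q'_def P_N[OF f])
    qed
    ultimately show "\<exists>Q. R'.equivariant Q \<and> Q ` alternating B' \<subseteq> N \<and> (\<forall>x\<in>N. Q x = x) \<and> (\<forall>L. R'.invariant L \<longrightarrow> Q ` L \<subseteq> L)"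
      using Q'L by (intro exI[of _ Q']) blast
  qed
qed

end

section \<open>Saturated representations\<close>

text \<open>Lagrange interpolation of \<open>h\<close> at the finitely many eigenvalues that occur.\<close>

lemma eigencomponent_in_subspace:
  assumes N: "fs.subspace N" and c: "\<And>f. f \<in> N \<Longrightarrow> (\<lambda>v. c v * f v) \<in> N"
    and f: "f \<in> N" and fin: "finite {v. f v \<noteq> 0}"
  shows "(\<lambda>v. h (c v) * f v) \<in> N"
proof -
  \<comment> \<open>the numerators in the interpolation formula\<close>
  have poly: "(\<lambda>v. (\<Prod>\<zeta>\<in>Z. c v - \<zeta>) * f v) \<in> N" if "finite Z" for Z
    using that
  proof (induction Z)
    case empty
    then show ?case using f by simp
  next
    case (insert \<zeta> Z)
    let ?g = "\<lambda>v. (\<Prod>\<zeta>\<in>Z. c v - \<zeta>) * f v"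
    have "(\<lambda>v. c v * ?g v) - (\<lambda>v. \<zeta> * ?g v) \<in> N"
      by (rule fs.subspace_diff[OF N c[OF insert.IH] fs.subspace_scale[OF N insert.IH]])
    also have "(\<lambda>v. c v * ?g v) - (\<lambda>v. \<zeta> * ?g v) = (\<lambda>v. (\<Prod>\<zeta>\<in>insert \<zeta> Z. c v - \<zeta>) * f v)"
      using insert.hyps by (auto simp: fun_eq_iff left_diff_distrib mult.assoc)
    finally show ?case .
  qed
  let ?Z = "c ` {v. f v \<noteq> 0}"
  have finZ: "finite ?Z" using fin by simp
  define k where "k \<zeta> = h \<zeta> / (\<Prod>\<xi>\<in>?Z - {\<zeta>}. \<zeta> - \<xi>)" for \<zeta>
  have "(\<lambda>v. h (c v) * f v) = (\<Sum>\<zeta>\<in>?Z. (\<lambda>v. k \<zeta> * ((\<Prod>\<xi>\<in>?Z - {\<zeta>}. c v - \<xi>) * f v)))"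
  proof
    fix v
    show "h (c v) * f v = (\<Sum>\<zeta>\<in>?Z. (\<lambda>v. k \<zeta> * ((\<Prod>\<xi>\<in>?Z - {\<zeta>}. c v - \<xi>) * f v))) v"
    proof (cases "f v = 0")
      case False
      then have cv: "c v \<in> ?Z" by blast
      have "(\<Sum>\<zeta>\<in>?Z. k \<zeta> * ((\<Prod>\<xi>\<in>?Z - {\<zeta>}. c v - \<xi>) * f v))
          = (\<Sum>\<zeta>\<in>?Z. if \<zeta> = c v then h (c v) * f v else 0)"
      proof (rule sum.cong[OF refl])
        fix \<zeta> assume "\<zeta> \<in> ?Z"
        show "k \<zeta> * ((\<Prod>\<xi>\<in>?Z - {\<zeta>}. c v - \<xi>) * f v) = (if \<zeta> = c v then h (c v) * f v else 0)"
        proof (cases "\<zeta> = c v")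
          case True
          have "(\<Prod>\<xi>\<in>?Z - {c v}. c v - \<xi>) \<noteq> 0" using finZ by simp
          then show ?thesis using True by (simp add: k_def)
        next
          case False
          then have "(\<Prod>\<xi>\<in>?Z - {\<zeta>}. c v - \<xi>) = 0" using cv finZ by (intro prod_zero) auto
          then show ?thesis using False by simp
        qed
      qed
      also have "\<dots> = h (c v) * f v" using cv finZ by simp
      finally show ?thesis by (simp add: sum_fun_apply)
    qed (simp add: sum_fun_apply)
  qed
  also have "\<dots> \<in> N"
    using poly finZ by (intro fs.subspace_sum[OF N] fs.subspace_scale[OF N]) blast
  finally show ?thesis .
qed

lemma sat_matrix_apply:
  "sat_matrix D N zg (i, a) (i', b)
     = (if i = i' then fst zg i * (\<Prod>j\<in>N i. factor D i j (snd zg j) $$ (a j, b j)) else 0)"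
  by (simp add: sat_matrix_def split: prod.split)

lemma group_GL: "group (GL n)"
proof -
  interpret R: ring "ring_mat TYPE(complex) n ()" by (rule ring_mat)
  show ?thesis unfolding GL_def by (rule R.units_group)
qed

lemma mult_GL: "x \<otimes>\<^bsub>GL n\<^esub> y = x * y" and one_GL: "\<one>\<^bsub>GL n\<^esub> = 1\<^sub>m n"
  by (simp_all add: GL_def units_of_def ring_mat_simps)

lemma rational_rep_one:
  assumes "subgroup G (GL n)" "rational_rep n G d \<rho>"
  shows "\<rho> (1\<^sub>m n) = 1\<^sub>m d"
proof -
  interpret GL: group "GL n" by (rule group_GL)
  have "group_hom (matrix_group n G) (GL d) \<rho>"
    using GL.subgroup_imp_group[OF assms(1)] group_GL assms(2)
    by (simp add: group_hom_def group_hom_axioms_def rational_rep_def)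
  from group_hom.hom_one[OF this] show ?thesis by (simp add: one_GL)
qed

lemma rational_rep_mult:
  assumes "rational_rep n G d \<rho>" "g \<in> G" "g' \<in> G" "g * g' = 1\<^sub>m n" and one: "\<rho> (1\<^sub>m n) = 1\<^sub>m d"
    and "a < d" "b < d"
  shows "(\<Sum>c<d. \<rho> g $$ (a, c) * \<rho> g' $$ (c, b)) = (if a = b then 1 else 0)"
proof -
  have hom: "\<rho> \<in> hom (matrix_group n G) (GL d)" using assms(1) by (simp add: rational_rep_def)
  have "\<rho> g \<in> carrier_mat d d" "\<rho> g' \<in> carrier_mat d d"
    using hom assms(2,3) by (auto simp: hom_def carrier_GL)
  then have "(\<rho> g * \<rho> g') $$ (a, b) = (\<Sum>c<d. \<rho> g $$ (a, c) * \<rho> g' $$ (c, b))"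
    using assms(6,7) by (simp add: scalar_prod_def lessThan_atLeast0)
  moreover have "\<rho> g * \<rho> g' = \<rho> (g * g')"
    using hom_mult[OF hom, of g g'] assms(2,3) by (simp add: mult_GL)
  ultimately show ?thesis using assms(4,6,7) one by simp
qed

text \<open>Sum over the index families first: by distributivity the entry of the product is the product over
  the edges of the entries of \<open>\<rho>(g) \<rho>(g')\<close>.\<close>

lemma sat_matrix_inverse:
  assumes I: "finite I" and N: "\<And>i. i \<in> I \<Longrightarrow> finite (N i)"
    and z: "\<And>i. i \<in> I \<Longrightarrow> fst g i * fst g' i = 1"
    and inv: "\<And>i j a b. i \<in> I \<Longrightarrow> j \<in> N i \<Longrightarrow> a < fdim D i j \<Longrightarrow> b < fdim D i j \<Longrightarrow>
      (\<Sum>c<fdim D i j. factor D i j (snd g j) $$ (a, c) * factor D i j (snd g' j) $$ (c, b)) = (if a = b then 1 else 0)"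
    and x: "x \<in> sat_basis D I N" and y: "y \<in> sat_basis D I N"
  shows "(\<Sum>w\<in>sat_basis D I N. sat_matrix D N g x w * sat_matrix D N g' w y) = (if x = y then 1 else 0)"
proof -
  let ?P = "\<lambda>i. \<Pi>\<^sub>E j\<in>N i. {..<fdim D i j}"
  obtain i a where xa: "x = (i, a)" "i \<in> I" "a \<in> ?P i" using x by (auto simp: sat_basis_def)
  obtain i' b where yb: "y = (i', b)" "i' \<in> I" "b \<in> ?P i'" using y by (auto simp: sat_basis_def)
  have finP: "finite (?P k)" if "k \<in> I" for k using N[OF that] by (intro finite_PiE) auto
  have "(\<Sum>w\<in>sat_basis D I N. sat_matrix D N g x w * sat_matrix D N g' w y)
      = (\<Sum>k\<in>I. \<Sum>c\<in>?P k. sat_matrix D N g x (k, c) * sat_matrix D N g' (k, c) y)"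
    unfolding sat_basis_def using I finP by (subst sum.Sigma) auto
  also have "\<dots> = (\<Sum>k\<in>I. if k = i then (\<Sum>c\<in>?P i. sat_matrix D N g x (i, c) * sat_matrix D N g' (i, c) y) else 0)"
    by (intro sum.cong refl) (auto simp: xa sat_matrix_apply)
  also have "\<dots> = (\<Sum>c\<in>?P i. sat_matrix D N g x (i, c) * sat_matrix D N g' (i, c) y)"
    using xa I by simp
  also have "\<dots> = (if x = y then 1 else 0)"
  proof (cases "i = i'")
    case True
    have ab: "a j < fdim D i j" "b j < fdim D i j" if "j \<in> N i" for j
      using xa yb True that by (auto simp: PiE_iff)
    have "(\<Sum>c\<in>?P i. sat_matrix D N g x (i, c) * sat_matrix D N g' (i, c) y)
        = (\<Sum>c\<in>?P i. (fst g i * fst g' i) *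
            (\<Prod>j\<in>N i. factor D i j (snd g j) $$ (a j, c j) * factor D i j (snd g' j) $$ (c j, b j)))"
      by (intro sum.cong refl) (simp add: xa yb True[symmetric] sat_matrix_apply prod.distrib mult_ac)
    also have "\<dots> = (\<Sum>c\<in>?P i. \<Prod>j\<in>N i. factor D i j (snd g j) $$ (a j, c j) * factor D i j (snd g' j) $$ (c j, b j))"
      using z xa by simp
    also have "\<dots> = (\<Prod>j\<in>N i. \<Sum>c<fdim D i j. factor D i j (snd g j) $$ (a j, c) * factor D i j (snd g' j) $$ (c, b j))"
      using N[OF xa(2)] by (intro prod_sum_PiE[symmetric]) auto
    also have "\<dots> = (\<Prod>j\<in>N i. if a j = b j then 1 else 0)"
      using inv xa ab by (intro prod.cong) auto
    also have "\<dots> = (if \<forall>j\<in>N i. a j = b j then 1 else 0)"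
      using N[OF xa(2)] by auto
    also have "(\<forall>j\<in>N i. a j = b j) \<longleftrightarrow> a = b"
      using xa(3) yb(3) True by (auto intro: PiE_ext)
    finally show ?thesis using xa yb True by simp
  qed (simp add: xa yb sat_matrix_apply)
  finally show ?thesis .
qed

lemma sat_matrix_diagonal:
  assumes N: "\<And>i. i \<in> I \<Longrightarrow> finite (N i)"
    and one: "\<And>i j. i \<in> I \<Longrightarrow> j \<in> N i \<Longrightarrow> factor D i j (snd g j) = 1\<^sub>m (fdim D i j)"
    and x: "x \<in> sat_basis D I N" and y: "y \<in> sat_basis D I N"
  shows "sat_matrix D N g x y = (if x = y then fst g (fst x) else 0)"
proof -
  obtain i a where xa: "x = (i, a)" "i \<in> I" "a \<in> (\<Pi>\<^sub>E j\<in>N i. {..<fdim D i j})" using x by (auto simp: sat_basis_def)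
  obtain i' b where yb: "y = (i', b)" "i' \<in> I" "b \<in> (\<Pi>\<^sub>E j\<in>N i'. {..<fdim D i' j})" using y by (auto simp: sat_basis_def)
  show ?thesis
  proof (cases "i = i'")
    case True
    have "(\<Prod>j\<in>N i. factor D i j (snd g j) $$ (a j, b j)) = (\<Prod>j\<in>N i. if a j = b j then 1 else 0)"
      using one xa yb True by (intro prod.cong) (auto simp: PiE_iff)
    also have "\<dots> = (if \<forall>j\<in>N i. a j = b j then 1 else 0)" using N[OF xa(2)] by auto
    also have "(\<forall>j\<in>N i. a j = b j) \<longleftrightarrow> a = b"
      using xa(3) yb(3) True by (auto intro: PiE_ext)
    finally show ?thesis using True by (simp add: xa yb sat_matrix_apply)
  qed (simp add: xa yb sat_matrix_apply)
qed

lemma tensor_map_diagonal: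
  assumes X: "finite Y" and diag: "\<And>x y. x \<in> Y \<Longrightarrow> y \<in> Y \<Longrightarrow> m x y = (if x = y then c x else 0)"
    and f: "\<And>w. f w \<noteq> 0 \<Longrightarrow> set w \<subseteq> Y"
  shows "tensor_map Y m f = (\<lambda>w. prod_list (map c w) * f w)"
proof
  fix w
  show "tensor_map Y m f w = prod_list (map c w) * f w"
  proof (cases "set w \<subseteq> Y")
    case True
    have ker: "word_entry m w v = (if v = w then prod_list (map c w) else 0)" if v: "v \<in> words Y (length w)" for v
      using v True
    proof (induction w arbitrary: v)
      case Nil
      then show ?case by (simp add: words_def word_entry_def)
    next
      case (Cons x w)
      obtain y v' where v: "v = y # v'" "y \<in> Y" "v' \<in> words Y (length w)"
        using Cons.prems(1) by (auto simp: words_def length_Suc_conv)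
      then show ?case using Cons.IH[OF v(3)] Cons.prems(2) by (simp add: word_entry_Cons diag)
    qed
    have "tensor_map Y m f w = (\<Sum>v\<in>words Y (length w). if v = w then prod_list (map c w) * f w else 0)"
      unfolding tensor_map_words using True ker by (auto intro!: sum.cong)
    also have "\<dots> = prod_list (map c w) * f w"
      using True by (simp add: finite_words[OF X]) (simp add: words_def)
    finally show ?thesis .
  next
    case False
    then have "f w = 0" using f by blast
    then show ?thesis using False by (simp add: tensor_map_def)
  qed
qed

text \<open>The part of a subgraph that determines its representation: its bottom vertices, its top vertices, and
  for each bottom vertex the set of its neighbours.\<close>

definition subdiagram :: "saturated_data \<Rightarrow> nat set \<Rightarrow> nat set \<Rightarrow> (nat \<Rightarrow> nat set) \<Rightarrow> bool" where
  "subdiagram D I J N \<longleftrightarrow> saturated D \<and> I \<subseteq> {..<num_summands D} \<and> J \<subseteq> {..<num_groups D} \<and> (\<forall>i\<in>I. N i \<subseteq> J)"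

lemma saturatedD:
  assumes "saturated D" "j < num_groups D"
  shows "subgroup (simple_group D j) (GL (msize D j))"
    "i < num_summands D \<Longrightarrow> rational_rep (msize D j) (simple_group D j) (fdim D i j) (factor D i j)"
    "i < num_summands D \<Longrightarrow> fdim D i j > 0"
proof -
  show "subgroup (simple_group D j) (GL (msize D j))"
    using assms by (auto simp: saturated_def simple_algebraic_group_def closed_subgroup_def)
  assume i: "i < num_summands D"
  have irr: "irreducible_rational_rep (msize D j) (simple_group D j) (fdim D i j) (factor D i j)"
    using assms i by (auto simp: saturated_def)
  then show "rational_rep (msize D j) (simple_group D j) (fdim D i j) (factor D i j)"
    by (simp add: irreducible_rational_rep_def)
  show "fdim D i j > 0"
  proof (rule ccontr)
    assume "\<not> fdim D i j > 0"
    then have "carrier (coord_space {..<fdim D i j}) = {\<zero>\<^bsub>coord_space {..<fdim D i j}\<^esub>}"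
      by (auto simp: coord_space_def)
    then show False using irr by (simp add: irreducible_rational_rep_def irreducible_submodule_def)
  qed
qed

lemma one_mem_simple_group:
  assumes "saturated D" "j < num_groups D"
  shows "1\<^sub>m (msize D j) \<in> simple_group D j"
  using subgroup.one_closed[OF saturatedD(1)[OF assms]] by (simp add: one_GL)

lemma carrier_sat_group:
  "carrier (sat_group D I J) = (\<Pi>\<^sub>E i\<in>I. - {0}) \<times> (\<Pi>\<^sub>E j\<in>J. simple_group D j)"
  by (simp add: sat_group_def carrier_Cstar)

text \<open>A basis index of \<open>V\<^sub>i\<close> is a family over all groups, and it is cut into its restrictions to the
  missing and to the present edges at \<open>i\<close>.\<close>

lemma word_factorisation_sat_basis:
  assumes "subdiagram D I J N"
  shows "word_factorisation (sat_basis D {..<num_summands D} (\<lambda>i. {..<num_groups D})) (sat_basis D I N)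
     (sat_basis D I (\<lambda>i. {..<num_groups D} - N i))
     (\<lambda>(i, a). (i, restrict a ({..<num_groups D} - N i))) (\<lambda>(i, a). (i, restrict a (N i))) fst fst"
proof
  let ?J = "{..<num_groups D}" and ?L = "{..<num_summands D}"
  have D: "saturated D" and I: "I \<subseteq> ?L" and N: "\<And>i. i \<in> I \<Longrightarrow> N i \<subseteq> ?J"
    using assms by (auto simp: subdiagram_def)
  have finI: "finite I" using I finite_subset by blast
  have finN: "finite (N i)" if "i \<in> I" for i using N[OF that] finite_subset by blast
  show "finite (sat_basis D ?L (\<lambda>i. ?J))" unfolding sat_basis_def by (intro finite_SigmaI finite_PiE) auto
  show "finite (sat_basis D I N)" unfolding sat_basis_def using finI finN by (intro finite_SigmaI finite_PiE) auto
  show "finite (sat_basis D I (\<lambda>i. ?J - N i))" unfolding sat_basis_def using finI by (intro finite_SigmaI finite_PiE) auto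
  fix b assume "b \<in> sat_basis D ?L (\<lambda>i. ?J)" "(case b of (i, a) \<Rightarrow> (i, restrict a (N i))) \<in> sat_basis D I N"
  then show "(case b of (i, a) \<Rightarrow> (i, restrict a (?J - N i))) \<in> sat_basis D I (\<lambda>i. ?J - N i)"
    "fst (case b of (i, a) \<Rightarrow> (i, restrict a (?J - N i))) = fst (case b of (i, a) \<Rightarrow> (i, restrict a (N i)))"
    by (auto simp: sat_basis_def PiE_iff)
next
  let ?J = "{..<num_groups D}" and ?L = "{..<num_summands D}"
  have I: "I \<subseteq> ?L" and N: "\<And>i. i \<in> I \<Longrightarrow> N i \<subseteq> ?J" using assms by (auto simp: subdiagram_def)
  fix x c assume x: "x \<in> sat_basis D I (\<lambda>i. ?J - N i)" and c: "c \<in> sat_basis D I N" and eq: "fst x = fst c"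
  obtain i a b where xa: "x = (i, a)" and cb: "c = (i, b)" and i: "i \<in> I"
    and a: "a \<in> (\<Pi>\<^sub>E j\<in>?J - N i. {..<fdim D i j})" and b: "b \<in> (\<Pi>\<^sub>E j\<in>N i. {..<fdim D i j})"
    using x c eq by (auto simp: sat_basis_def)
  let ?e = "\<lambda>j. if j \<in> N i then b j else a j"
  show "\<exists>!e. e \<in> sat_basis D ?L (\<lambda>i. ?J) \<and> (case e of (i, a) \<Rightarrow> (i, restrict a (?J - N i))) = x
      \<and> (case e of (i, a) \<Rightarrow> (i, restrict a (N i))) = c"
  proof (rule ex1I[of _ "(i, ?e)"])
    have "?e \<in> (\<Pi>\<^sub>E j\<in>?J. {..<fdim D i j})"
      using a b N[OF i] by (auto simp: PiE_iff extensional_def)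
    moreover have "restrict ?e (?J - N i) = a" using a by (auto simp: fun_eq_iff PiE_iff extensional_def)
    moreover have "restrict ?e (N i) = b" using b by (auto simp: fun_eq_iff PiE_iff extensional_def)
    ultimately show "(i, ?e) \<in> sat_basis D ?L (\<lambda>i. ?J) \<and> (case (i, ?e) of (i, a) \<Rightarrow> (i, restrict a (?J - N i))) = x
      \<and> (case (i, ?e) of (i, a) \<Rightarrow> (i, restrict a (N i))) = c"
      using i I xa cb by (auto simp: sat_basis_def)
  next
    fix e assume e: "e \<in> sat_basis D ?L (\<lambda>i. ?J) \<and> (case e of (i, a) \<Rightarrow> (i, restrict a (?J - N i))) = x
      \<and> (case e of (i, a) \<Rightarrow> (i, restrict a (N i))) = c"
    then obtain k where k: "e = (i, k)" "k \<in> (\<Pi>\<^sub>E j\<in>?J. {..<fdim D i j})"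
      "restrict k (?J - N i) = a" "restrict k (N i) = b"
      using xa cb by (auto simp: sat_basis_def)
    have "k j = ?e j" for j
    proof (cases "j \<in> ?J")
      case True
      then show ?thesis using k(3,4) by (metis DiffI restrict_apply')
    next
      case False
      then have "k j = undefined" "j \<notin> N i" "a j = undefined" using k(2) a N[OF i] by (auto simp: PiE_iff extensional_def)
      then show ?thesis by simp
    qed
    then show "e = (i, ?e)" using k(1) by (simp add: fun_eq_iff)
  qed
next
  let ?J = "{..<num_groups D}"
  fix c assume "c \<in> sat_basis D I N"
  then obtain i b where c: "c = (i, b)" "i \<in> I" by (auto simp: sat_basis_def)
  have D: "saturated D" and I: "i < num_summands D" using assms c by (auto simp: subdiagram_def)
  have "(\<lambda>j\<in>?J - N i. 0) \<in> (\<Pi>\<^sub>E j\<in>?J - N i. {..<fdim D i j})"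
    using saturatedD(3)[OF D _ I] by auto
  then show "\<exists>x\<in>sat_basis D I (\<lambda>i. ?J - N i). fst x = fst c"
    using c by (intro bexI[of _ "(i, \<lambda>j\<in>?J - N i. 0)"]) (auto simp: sat_basis_def)
qed

lemma exists_simple_group_inverse:
  assumes D: "saturated D" and j: "j < num_groups D" and g: "g \<in> simple_group D j"
  shows "\<exists>g'\<in>simple_group D j. g * g' = 1\<^sub>m (msize D j) \<and> g' * g = 1\<^sub>m (msize D j)"
proof -
  interpret GL: group "GL (msize D j)" by (rule group_GL)
  interpret S: subgroup "simple_group D j" "GL (msize D j)" by (rule saturatedD(1)[OF D j])
  have "g \<in> carrier (GL (msize D j))" using g S.subset by blast
  then have "inv\<^bsub>GL (msize D j)\<^esub> g \<in> simple_group D j" "g * inv\<^bsub>GL (msize D j)\<^esub> g = 1\<^sub>m (msize D j)"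
    "inv\<^bsub>GL (msize D j)\<^esub> g * g = 1\<^sub>m (msize D j)"
    using g GL.r_inv[of g] GL.l_inv[of g] by (auto simp: mult_GL one_GL)
  then show ?thesis by blast
qed

text \<open>The torus acts entirely on the kept factor, so that the lost factors are modules of the semisimple
  part alone.\<close>

lemma sat_matrix_compatible:
  assumes sub: "subdiagram D I J N"
    and z: "\<And>i. i \<in> I \<Longrightarrow> fst h i = fst g i" and gj: "\<And>i j. i \<in> I \<Longrightarrow> j \<in> N i \<Longrightarrow> snd h j = snd g j"
  shows "word_factorisation.compatible (sat_basis D {..<num_summands D} (\<lambda>i. {..<num_groups D})) (sat_basis D I N)
     (sat_basis D I (\<lambda>i. {..<num_groups D} - N i))
     (\<lambda>(i, a). (i, restrict a ({..<num_groups D} - N i))) (\<lambda>(i, a). (i, restrict a (N i))) fst fst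
     (sat_matrix D (\<lambda>i. {..<num_groups D}) g) (sat_matrix D (\<lambda>i. {..<num_groups D} - N i) (\<lambda>i. 1, snd g)) (sat_matrix D N h)"
proof -
  let ?J = "{..<num_groups D}" and ?L = "{..<num_summands D}"
  interpret F: word_factorisation "sat_basis D ?L (\<lambda>i. ?J)" "sat_basis D I N" "sat_basis D I (\<lambda>i. ?J - N i)"
    "\<lambda>(i, a). (i, restrict a (?J - N i))" "\<lambda>(i, a). (i, restrict a (N i))" fst fst
    by (rule word_factorisation_sat_basis[OF sub])
  have N: "\<And>i. i \<in> I \<Longrightarrow> N i \<subseteq> ?J" using sub by (auto simp: subdiagram_def)
  have kept: "(i, restrict a (N i)) \<in> sat_basis D I N \<longleftrightarrow> i \<in> I" if "(i, a) \<in> sat_basis D ?L (\<lambda>i. ?J)" for i a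
    using that N by (auto simp: sat_basis_def PiE_iff)
  have split: "sat_matrix D (\<lambda>i. ?J) g (i, a) (i', b)
      = sat_matrix D (\<lambda>i. ?J - N i) (\<lambda>i. 1, snd g) (i, restrict a (?J - N i)) (i', restrict b (?J - N i'))
        * sat_matrix D N h (i, restrict a (N i)) (i', restrict b (N i'))" if i: "i \<in> I" for i a i' b
  proof (cases "i = i'")
    case True
    let ?f = "\<lambda>j. factor D i j (snd g j) $$ (a j, b j)"
    have "(\<Prod>j\<in>?J. ?f j) = (\<Prod>j\<in>?J - N i. ?f j) * (\<Prod>j\<in>N i. ?f j)"
      by (rule prod.subset_diff[OF N[OF i]]) simp
    moreover have "(\<Prod>j\<in>?J - N i. ?f j) = (\<Prod>j\<in>?J - N i. factor D i j (snd g j) $$ (restrict a (?J - N i) j, restrict b (?J - N i) j))"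
      by (intro prod.cong) auto
    moreover have "(\<Prod>j\<in>N i. ?f j) = (\<Prod>j\<in>N i. factor D i j (snd h j) $$ (restrict a (N i) j, restrict b (N i) j))"
      using gj[OF i] by (intro prod.cong) auto
    ultimately show ?thesis using True z[OF i] by (simp add: sat_matrix_apply)
  qed (simp add: sat_matrix_apply)
  show ?thesis
    unfolding F.compatible_def
  proof (intro conjI ballI impI)
    fix b c assume bc: "b \<in> sat_basis D ?L (\<lambda>i. ?J)" "c \<in> sat_basis D ?L (\<lambda>i. ?J)"
    obtain i a i' a' where b: "b = (i, a)" and c: "c = (i', a')" by (cases b, cases c)
    show "sat_matrix D (\<lambda>i. ?J) g b c
      = sat_matrix D (\<lambda>i. ?J - N i) (\<lambda>i. 1, snd g) (case b of (i, a) \<Rightarrow> (i, restrict a (?J - N i))) (case c of (i, a) \<Rightarrow> (i, restrict a (?J - N i)))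
        * sat_matrix D N h (case b of (i, a) \<Rightarrow> (i, restrict a (N i))) (case c of (i, a) \<Rightarrow> (i, restrict a (N i)))"
      if "(case b of (i, a) \<Rightarrow> (i, restrict a (N i))) \<in> sat_basis D I N"
      using that kept[of i a] bc(1) split[of i a i' a'] unfolding b c by simp
    show "sat_matrix D (\<lambda>i. ?J) g b c = 0"
      if "((case b of (i, a) \<Rightarrow> (i, restrict a (N i))) \<in> sat_basis D I N) \<noteq> ((case c of (i, a) \<Rightarrow> (i, restrict a (N i))) \<in> sat_basis D I N)"
      using that kept[of i a] kept[of i' a'] bc unfolding b c by (auto simp: sat_matrix_apply)
  next
    fix x y :: "nat \<times> (nat \<Rightarrow> nat)" assume "fst x \<noteq> fst y"
    then show "sat_matrix D (\<lambda>i. ?J - N i) (\<lambda>i. 1, snd g) x y = 0" "sat_matrix D N h x y = 0"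
      by (cases x, cases y, simp add: sat_matrix_apply)+
  qed
qed

text \<open>A single torus element suffices: let the coordinates be distinct primes. By unique factorisation
  its eigenvalues on different multidegrees are different.\<close>

lemma type_multiset_graded:
  assumes sub: "subdiagram D I J N"
    and inv: "group_rep.invariant (\<lambda>c v x. c * v x) (sat_group D I J) (alternating (sat_basis D I N))
      (\<lambda>g. tensor_map (sat_basis D I N) (sat_matrix D N g)) U"
    and f: "f \<in> U"
  shows "(\<lambda>v. h (mset (map fst v)) * f v) \<in> U"
proof -
  let ?B = "sat_basis D I N"
  have D: "saturated D" and I: "I \<subseteq> {..<num_summands D}" and J: "J \<subseteq> {..<num_groups D}" and N: "\<And>i. i \<in> I \<Longrightarrow> N i \<subseteq> J"
    using sub by (auto simp: subdiagram_def)
  have finB: "finite ?B" using word_factorisation_sat_basis[OF sub] by (rule word_factorisation.finite_B')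
  interpret R: group_rep "\<lambda>c v x. c * v x" "sat_group D I J" "alternating ?B" "\<lambda>g. tensor_map ?B (sat_matrix D N g)"
    by (rule group_rep_alternating[OF finB])
  define pr where "pr = enumerate {p :: nat. Factorial_Ring.prime p}"
  have pr: "Factorial_Ring.prime (pr i)" for i using enumerate_in_set[OF primes_infinite, of i] by (simp add: pr_def)
  have pr_inj: "inj pr" unfolding pr_def using strict_mono_enumerate[OF primes_infinite] by (rule strict_mono_imp_inj_on)
  define t where "t = (restrict (\<lambda>i. of_nat (pr i) :: complex) I, restrict (\<lambda>j. 1\<^sub>m (msize D j) :: complex mat) J)"
  have t: "t \<in> carrier (sat_group D I J)"
  proof -
    have "pr i \<noteq> 0" for i using prime_gt_0_nat[OF pr[of i]] by simp
    then show ?thesis unfolding carrier_sat_group t_def using J one_mem_simple_group[OF D] by auto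
  qed
  define \<chi> where "\<chi> T = (of_nat (prod_mset (image_mset pr T)) :: complex)" for T
  have \<chi>_inj: "S = T" if "\<chi> S = \<chi> T" for S T
  proof -
    have "prod_mset (image_mset pr S) = prod_mset (image_mset pr T)" using that by (simp only: \<chi>_def of_nat_eq_iff)
    then have "prime_factorization (prod_mset (image_mset pr S)) = prime_factorization (prod_mset (image_mset pr T))" by simp
    then have "image_mset pr S = image_mset pr T" using pr by (subst (asm) (1 2) prime_factorization_prod_mset_primes) auto
    then have "image_mset (inv_into UNIV pr) (image_mset pr S) = image_mset (inv_into UNIV pr) (image_mset pr T)" by simp
    then show "S = T" using pr_inj by (simp add: multiset.map_comp o_def)
  qed
  have act: "tensor_map ?B (sat_matrix D N t) u = (\<lambda>v. \<chi> (mset (map fst v)) * u v)" if u: "u \<in> U" for u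
  proof -
    have ua: "u \<in> alternating ?B" by (rule R.invariantD(2)[OF inv u])
    have "tensor_map ?B (sat_matrix D N t) u = (\<lambda>v. prod_list (map (\<lambda>x. fst t (fst x)) v) * u v)"
    proof (rule tensor_map_diagonal[OF finB])
      show "set w \<subseteq> ?B" if "u w \<noteq> 0" for w by (rule alternatingD(1)[OF ua that])
      fix x y assume xy: "x \<in> ?B" "y \<in> ?B"
      show "sat_matrix D N t x y = (if x = y then fst t (fst x) else 0)"
      proof (rule sat_matrix_diagonal[OF _ _ xy])
        show "finite (N i)" if "i \<in> I" for i by (rule finite_subset[OF order_trans[OF N[OF that] J]]) simp
        fix i j assume ij: "i \<in> I" "j \<in> N i"
        then have j: "j \<in> J" "j < num_groups D" and i: "i < num_summands D" using N J I by auto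
        then show "factor D i j (snd t j) = 1\<^sub>m (fdim D i j)"
          using rational_rep_one[OF saturatedD(1)[OF D j(2)] saturatedD(2)[OF D j(2) i]] by (simp add: t_def)
      qed
    qed
    also have "\<dots> = (\<lambda>v. \<chi> (mset (map fst v)) * u v)"
    proof
      fix v
      show "prod_list (map (\<lambda>x. fst t (fst x)) v) * u v = \<chi> (mset (map fst v)) * u v"
      proof (cases "u v = 0")
        case False
        then have "set v \<subseteq> ?B" by (rule alternatingD(1)[OF ua])
        then have "fst x \<in> I" if "x \<in> set v" for x using that by (auto simp: sat_basis_def)
        then have "prod_list (map (\<lambda>x. fst t (fst x)) v) = prod_list (map (\<lambda>x. of_nat (pr (fst x))) v)"
          by (intro arg_cong[of _ _ prod_list] map_cong) (auto simp: t_def)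
        also have "\<dots> = \<chi> (mset (map fst v))" unfolding \<chi>_def by (induction v) auto
        finally show ?thesis by simp
      qed simp
    qed
    finally show ?thesis .
  qed
  have supp: "finite {v. f v \<noteq> 0}"
  proof (rule finite_subset[OF _ finite_distinct_words[OF finB]])
    show "{v. f v \<noteq> 0} \<subseteq> distinct_words ?B" using alternating_support[OF R.invariantD(2)[OF inv f]] by blast
  qed
  have "(\<lambda>v. h (inv_into UNIV \<chi> (\<chi> (mset (map fst v)))) * f v) \<in> U"
  proof (rule eigencomponent_in_subspace[where c="\<lambda>v. \<chi> (mset (map fst v))" and h="\<lambda>x. h (inv_into UNIV \<chi> x)",
        OF _ _ f supp])
    show "fs.subspace U" using inv by (simp add: R.invariant_def)
    show "(\<lambda>v. \<chi> (mset (map fst v)) * u v) \<in> U" if "u \<in> U" for u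
      using R.invariantD(6)[OF inv that t] act[OF that] by simp
  qed
  moreover have "inv_into UNIV \<chi> (\<chi> T) = T" for T by (rule inv_into_f_f) (auto intro: injI \<chi>_inj)
  ultimately show ?thesis by simp
qed

text \<open>Every element of the small group is the restriction of an element of the large group, extended by
  \<open>1\<close>, and conversely; both act on \<open>V'\<close> in the same way.\<close>

lemma skew_multiplicity_free_subdiagram:
  assumes sub: "subdiagram D I J N" and smf: "SMF D"
  shows "skew_multiplicity_free (sat_group D I J) (sat_basis D I N) (sat_matrix D N)"
proof -
  let ?J = "{..<num_groups D}" and ?L = "{..<num_summands D}"
  interpret F: word_factorisation "sat_basis D ?L (\<lambda>i. ?J)" "sat_basis D I N" "sat_basis D I (\<lambda>i. ?J - N i)"
    "\<lambda>(i, a). (i, restrict a (?J - N i))" "\<lambda>(i, a). (i, restrict a (N i))" fst fst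
    by (rule word_factorisation_sat_basis[OF sub])
  let ?A = "sat_basis D I (\<lambda>i. ?J - N i)" and ?B = "sat_basis D ?L (\<lambda>i. ?J)" and ?B' = "sat_basis D I N"
  let ?m = "sat_matrix D (\<lambda>i. ?J)"
  have D: "saturated D" and I: "I \<subseteq> ?L" and J: "J \<subseteq> ?J" and N: "\<And>i. i \<in> I \<Longrightarrow> N i \<subseteq> J"
    using sub by (auto simp: subdiagram_def)
  have "skew_multiplicity_free (sat_group D ?L ?J) (?B) (sat_matrix D (\<lambda>i. ?J))"
    using smf by (simp add: SMF_def Let_def)
  note sp = this[unfolded skew_multiplicity_free_iff_strong_projections[OF F.finite_B]]
  show ?thesis
    unfolding skew_multiplicity_free_iff_strong_projections[OF F.finite_B']
  proof (rule F.strong_projections_transfer[OF sp])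
    fix g assume g: "g \<in> carrier (sat_group D ?L ?J)"
    let ?h = "(restrict (fst g) I, restrict (snd g) J)"
    have "?h \<in> carrier (sat_group D I J)" using g I J unfolding carrier_sat_group by (auto simp: PiE_iff subset_iff)
    moreover have "F.compatible (?m g) (sat_matrix D (\<lambda>i. ?J - N i) (\<lambda>i. 1, snd g)) (sat_matrix D N ?h)"
      using N by (intro sat_matrix_compatible[OF sub]) auto
    ultimately show "\<exists>u. \<exists>h\<in>carrier (sat_group D I J). F.compatible (?m g) u (sat_matrix D N h)" by blast
  next
    fix h assume h: "h \<in> carrier (sat_group D I J)"
    define z where "z = (\<lambda>i\<in>?L. if i \<in> I then fst h i else 1)"
    define k where "k = (\<lambda>j\<in>?J. if j \<in> J then snd h j else 1\<^sub>m (msize D j))"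
    have kS: "k j \<in> simple_group D j" if "j \<in> ?J" for j
      using that h one_mem_simple_group[OF D, of j] by (auto simp: k_def carrier_sat_group PiE_iff)
    have zk: "(z, k) \<in> carrier (sat_group D ?L ?J)"
    proof -
      have "z \<in> (\<Pi>\<^sub>E i\<in>?L. - {0})" using h by (auto simp: z_def carrier_sat_group PiE_iff)
      moreover have "k \<in> (\<Pi>\<^sub>E j\<in>?J. simple_group D j)" using kS by (auto simp: k_def)
      ultimately show ?thesis by (simp add: carrier_sat_group)
    qed
    have "\<forall>j\<in>?J. \<exists>k'. k' \<in> simple_group D j \<and> k j * k' = 1\<^sub>m (msize D j) \<and> k' * k j = 1\<^sub>m (msize D j)"
      using exists_simple_group_inverse[OF D _ kS] by auto
    from bchoice[OF this] obtain k' where k': "\<And>j. j \<in> ?J \<Longrightarrow> k' j \<in> simple_group D j"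
      "\<And>j. j \<in> ?J \<Longrightarrow> k j * k' j = 1\<^sub>m (msize D j)" "\<And>j. j \<in> ?J \<Longrightarrow> k' j * k j = 1\<^sub>m (msize D j)" by blast
    let ?u = "sat_matrix D (\<lambda>i. ?J - N i) (\<lambda>i. 1, k)" and ?v = "sat_matrix D (\<lambda>i. ?J - N i) (\<lambda>i. 1, k')"
    have finI: "finite I" using I finite_subset by blast
    have comp: "F.compatible (?m (z, k)) (sat_matrix D (\<lambda>i. ?J - N i) (\<lambda>i. 1, snd (z, k))) (sat_matrix D N h)"
      using N I J by (intro sat_matrix_compatible[OF sub]) (auto simp: z_def k_def subset_iff)
    have rep: "rational_rep (msize D j) (simple_group D j) (fdim D i j) (factor D i j)"
      "factor D i j (1\<^sub>m (msize D j)) = 1\<^sub>m (fdim D i j)" if "i \<in> I" "j \<in> ?J - N i" for i j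
      using that I saturatedD(1,2)[OF D, of j] rational_rep_one by auto
    have uv: "(\<Sum>y\<in>?A. ?u x y * ?v y w) = (if x = w then 1 else 0)"
      if "x \<in> ?A" "w \<in> ?A" for x w
    proof (rule sat_matrix_inverse[OF finI _ _ _ that])
      fix i j a b assume ij: "i \<in> I" "j \<in> ?J - N i" "a < fdim D i j" "b < fdim D i j"
      then have j: "j \<in> ?J" by simp
      show "(\<Sum>c<fdim D i j. factor D i j (snd (\<lambda>i. 1 :: complex, k) j) $$ (a, c) * factor D i j (snd (\<lambda>i. 1 :: complex, k') j) $$ (c, b)) = (if a = b then 1 else 0)"
        using rational_rep_mult[OF rep(1)[OF ij(1,2)] kS[OF j] k'(1)[OF j] k'(2)[OF j] rep(2)[OF ij(1,2)] ij(3,4)] by simp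
    qed auto
    have vu: "(\<Sum>y\<in>?A. ?v x y * ?u y w) = (if x = w then 1 else 0)"
      if "x \<in> ?A" "w \<in> ?A" for x w
    proof (rule sat_matrix_inverse[OF finI _ _ _ that])
      fix i j a b assume ij: "i \<in> I" "j \<in> ?J - N i" "a < fdim D i j" "b < fdim D i j"
      then have j: "j \<in> ?J" by simp
      show "(\<Sum>c<fdim D i j. factor D i j (snd (\<lambda>i. 1 :: complex, k') j) $$ (a, c) * factor D i j (snd (\<lambda>i. 1 :: complex, k) j) $$ (c, b)) = (if a = b then 1 else 0)"
        using rational_rep_mult[OF rep(1)[OF ij(1,2)] k'(1)[OF j] kS[OF j] k'(3)[OF j] rep(2)[OF ij(1,2)] ij(3,4)] by simp
    qed auto
    show "\<exists>g\<in>carrier (sat_group D ?L ?J). \<exists>u v. F.compatible (?m g) u (sat_matrix D N h) \<and>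
      (\<forall>x\<in>?A. \<forall>w\<in>?A. (\<Sum>y\<in>?A. u x y * v y w) = (if x = w then 1 else 0)) \<and>
      (\<forall>x\<in>?A. \<forall>w\<in>?A. (\<Sum>y\<in>?A. v x y * u y w) = (if x = w then 1 else 0))"
      using comp uv vu by (intro bexI[OF _ zk] exI[of _ ?u] exI[of _ ?v] conjI ballI) simp_all
  next
    fix U and h :: "nat multiset \<Rightarrow> complex" and f
    assume "group_rep.invariant (\<lambda>c v x. c * v x) (sat_group D I J) (alternating (?B'))
        (\<lambda>g. tensor_map (?B') (sat_matrix D N g)) U" "f \<in> U"
    then show "(\<lambda>v. h (mset (map fst v)) * f v) \<in> U" by (rule type_multiset_graded[OF sub])
  qed
qed

theorem proposition5p6:
  fixes D :: saturated_data and H :: "node pair_pre_digraph"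
  assumes "saturated D"
    and "SMF D"
    and "subgraph (with_proj H) (with_proj (rep_diagram D))"
    and "Digraph_Component.connected (with_proj H)"
  shows "SMF_subgraph D H"
proof -
  define I where "I = {i. Bottom i \<in> pverts H}"
  define J where "J = {j. Top j \<in> pverts H}"
  define N where "N = (\<lambda>i. {j. (Top j, Bottom i) \<in> parcs H})"
  have verts: "pverts H \<subseteq> pverts (rep_diagram D)" and wf: "wf_digraph (with_proj H)"
    using assms(3) by (auto simp: subgraph_def)
  have "I \<subseteq> {..<num_summands D}" "J \<subseteq> {..<num_groups D}"
    using verts by (auto simp: I_def J_def rep_diagram_def)
  moreover have "N i \<subseteq> J" for i
    using wf_digraph.tail_in_verts[OF wf] by (force simp: N_def J_def)
  ultimately have "subdiagram D I J N" using assms(1) by (simp add: subdiagram_def)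
  from skew_multiplicity_free_subdiagram[OF this assms(2)]
  show ?thesis by (simp add: SMF_subgraph_def Let_def I_def J_def N_def)
qed

end
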